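(* Let $O$ be an observable on the $n$-qudit space $\mathcal H_n$, let $o(\boldsymbol g)=\mathrm{tr}\big(O\,C(\boldsymbol g)|0^n\rangle\langle 0^n|C(\boldsymbol g)^\dagger\big)$ be its expectation value for the circuit family $C(\boldsymbol g)$, $\boldsymbol g\in\mathbb G=G^{\times D}$, and let $\tilde o(\boldsymbol g)$ be the corresponding noisy expectation value, for a noise channel $\mathcal E$ satisfying the noise penalisation assumption with spectral gap $\gamma$ (all defined in the context). Suppose that with respect to a symmetry-adapted operator basis the rank of $O$ satisfies $r(O)=\mathrm{poly}(n)$, and that with respect to that basis the controlled tree growth and path contraction assumption holds with parameter $s$. Then there is a classical algorithm, with a truncation rule governed by a controllable parameter $L$ (a positive integer), that outputs the truncated noisy expectation value $\tilde o^{\mathcal T}(\boldsymbol g)$, such that $$\|\tilde o-\tilde o^{\mathcal T}\|_{L^2(\mathbb G)}\le e^{-\gamma L}\,\|O\|_{HS},$$ and whose run-time is $$\mathcal O\big(r(O)\,(s\,d_{max})^{L}\,\mathrm{cost}(\texttt{evaluate})\big),$$ where $d_{max}$ is the maximal dimension of the irreducible representations occurring in the decompositions of the representations $U_i\otimes U_i^*$.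
   Context: **Circuits.** $\mathcal H_n=(\mathbb C^d)^{\otimes n}$. $G$ is a compact or finite group, $\mathbb G=G^{\times D}$ carries the normalised Haar measure $d\boldsymbol g$ and $\|f\|_{L^2(\mathbb G)}^2=\int|f(\boldsymbol g)|^2d\boldsymbol g$. For $i=1,\dots,D$, $U_i$ is a unitary representation of $G$ on $\mathcal H_n$ and $W_i$ is a fixed unitary on $\mathcal H_n$. For $\boldsymbol g=(g_1,\dots,g_D)$, $C(\boldsymbol g)=U_1(g_1)W_1U_2(g_2)W_2\cdots U_D(g_D)W_D$; $|0^n\rangle$ is the all-zero computational basis state. **Vectorisation.** For an operator $A$ on $\mathcal H_n$, $|A\rangle\rangle\in\mathcal H_n\otimes\mathcal H_n^*$ is its vectorisation, $\langle\langle A|B\rangle\rangle=\mathrm{tr}(A^\dagger B)$, $\|A\|_{HS}^2=\mathrm{tr}(A^\dagger A)$, and $(U\otimes U^* )|A\rangle\rangle=|UAU^\dagger\rangle\rangle$. A channel $\mathcal E$ has Liouville matrix $\mathbf E$ with $\mathbf E|A\rangle\rangle=|\mathcal E(A)\rangle\rangle$. $|\mathbf 0\rangle\rangle$ is the vectorisation of $|0^n\rangle\langle0^n|$. **Symmetry-adapted (irreducible tensor operator) basis.** For each slot $i=1,\dots,D$, $\mathcal B^{(i)}=\{T^{\lambda,\alpha}_k\}$ is an orthonormal (Hilbert–Schmidt) basis of the operators on $\mathcal H_n$ with $U_i(g)T^{\lambda,\alpha}_kU_i(g)^\dagger=\sum_{k'}v^{\lambda}_{k'k}(g)T^{\lambda,\alpha}_{k'}$,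 where $\lambda$ runs over the irreps in $U_i\otimes U_i^*$, $\alpha$ labels multiplicity, $k=1,\dots,d_\lambda=\dim\lambda$, and $v^\lambda_{k'k}$ are the matrix coefficients of $\lambda$ in a fixed orthonormal basis. The same basis is used at all slots when it is adapted to all $U_i$; otherwise the basis may depend on the slot. $\mathcal B^{(D+1)}$ is a final orthonormal operator basis (for a common basis, the same one). The position and multiplicity labels are absorbed in $\lambda$. $\lambda=0$ denotes the trivial irrep, and $\Pi_0=\Pi_0^{(i)}=\sum_\alpha|T^{0,\alpha}_0\rangle\rangle\langle\langle T^{0,\alpha}_0|$ is the projector onto the span of basis operators of $\mathcal B^{(i)}$ transforming trivially (with $\Pi_0^{(D+1)}=\mathbb I$ if no group acts at that slot). **Rank.** $r(O)=|\{B\in\mathcal B^{(1)}:\mathrm{tr}(B^\dagger O)\ne0\}|$. **Controlled tree growth and path contraction assumption.** (i) For all $i\in\{1,\dots,D\}$ and every basis operator $T$ (of slot $i+1$), $\Pi_0^{(i)}(W_i\otimes W_i^* )|T\rangle\rangle$ equals either $0$ or $(W_i\otimes W_i^* )|T\rangle\rangle$; and, since basis operators are propagated in the Heisenberg picture, the analogous property holds for the adjoints: for every $T\in\mathcal B^{(i)}$, $\Pi_0^{(i+1)}(W_i\otimes W_i^* )^\dagger|T\rangle\rangle$ equals $0$ or $(W_i\otimes W_i^* )^\dagger|T\rangle\rangle$. (ii) For any consecutive product $(W_i\otimes W_i^* )\cdots(W_{i+J}\otimes W_{i+J}^* )$ and any fixed basis operator on one side, the number of basis operators on the other side for which the matrix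 element $\langle\langle T^\mu_m|(W_i\otimes W_i^* )\cdots(W_{i+J}\otimes W_{i+J}^* )|T^\lambda_k\rangle\rangle$ is non-zero is at most $s=\mathrm{poly}(n)$, and these matrix elements can be evaluated in time at most $\mathrm{cost}(\texttt{contract})=\mathrm{poly}(n)$. **Noise penalisation assumption.** The noisy circuit has Liouville matrix $$\tilde{\mathbf C}(\boldsymbol g)=\mathbf E\,(U_1(g_1)W_1\otimes U_1^*(g_1)W_1^* )\cdots\mathbf E\,(U_D(g_D)W_D\otimes U_D^*(g_D)W_D^* ),$$ where $\mathcal E$ is a quantum channel with spectral gap $\gamma=1-\max_{|e|\neq1}|e|$ (maximum over eigenvalues $e$ of $\mathbf E$). $\mathbf E$ is diagonal in the symmetry-adapted basis, $\mathbf E|T^\lambda_k\rangle\rangle=e_{\lambda,k}|T^\lambda_k\rangle\rangle$, with $e_{\lambda,k}=1$ if $\lambda$ is trivial and $|e_{\lambda,k}|\le1-\gamma$ if $\lambda$ is non-trivial. The noisy expectation value is $\tilde o(\boldsymbol g)=\langle\langle O|\tilde{\mathbf C}(\boldsymbol g)|\mathbf 0\rangle\rangle$. **Truncation.** Inserting resolutions of the identity, $$\tilde o(\boldsymbol g)=\sum_{B_1,\dots,B_{D+1}}\langle\langle O|B_1\rangle\rangle\Big(\prod_{i=1}^{D}\langle\langle B_i|\mathbf E\,(U_i(g_i)W_i\otimes U_i^*(g_i)W_i^* )|B_{i+1}\rangle\rangle\Big)\langle\langle B_{D+1}|\mathbf 0\rangle\rangle,\qquad B_i\in\mathcal B^{(i)}.$$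 $\tilde o^{\mathcal T}(\boldsymbol g)$ is the same sum restricted to those sequences in which at most $L$ of $B_1,\dots,B_D$ belong to non-trivial irreps. **Cost.** $\mathrm{cost}(\texttt{evaluate})$ is the time needed to evaluate the contribution of one path in the truncated expansion: it includes the at most $L$ contractions of products of $W$'s (each of cost $\mathrm{cost}(\texttt{contract})$), the evaluation of the at most $L$ irreducible matrix coefficients $v^\lambda_{kk'}$ and noise eigenvalues along the path, and the final overlap with $|\mathbf 0\rangle\rangle$.
   Formalization: Assumption (i) is also required, in the adjoint direction, for consecutive products of W's while the propagated operator stays trivial; with single gates only the run-time bound fails. Contraction calls also list the non-zero operators; the final run of W's is part of the overlap. *)

theory Defs
  imports
    "HOL-Analysis.Analysis"
    "HOL-Library.Landau_Symbols"
    "HOL-Algebra.Group"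
    "Jordan_Normal_Form.Schur_Decomposition"
    "Jordan_Normal_Form.VS_Connect"
begin

section \<open>Operators and superoperators\<close>

text \<open>
  The space \<open>(\<complex>\<^sup>d)\<^sup>\<otimes>\<^sup>n\<close> is \<open>\<complex>\<^sup>N\<close> with \<open>N = d ^ n\<close>; the computational basis state
  \<open>|x\<^sub>1 \<dots> x\<^sub>n\<rangle>\<close> is the unit vector whose index has the base-\<open>d\<close> digits \<open>x\<^sub>1 \<dots> x\<^sub>n\<close> (Kronecker
  ordering), so \<open>|0\<^sup>n\<rangle>\<close> has index \<open>0\<close>. The vectorisation \<open>|A\<rangle>\<rangle>\<close> is identified with \<open>A\<close>: Liouville
  space is the space of \<open>N \<times> N\<close> matrices with the Hilbert-Schmidt inner product, and a Liouville
  matrix is a map on matrices. In particular \<open>V \<otimes> V\<^sup>*\<close> is \<open>A \<mapsto> V A V\<^sup>\<dagger>\<close>.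
\<close>

definition hs :: "complex mat \<Rightarrow> complex mat \<Rightarrow> complex" where
  "hs A B = (\<Sum>r<dim_col A. (mat_adjoint A * B) $$ (r, r))"

definition hs_norm :: "complex mat \<Rightarrow> real" where
  "hs_norm A = sqrt (Re (hs A A))"

definition conj_by :: "complex mat \<Rightarrow> complex mat \<Rightarrow> complex mat" where
  "conj_by V A = V * A * mat_adjoint V"

definition unitary_mat :: "nat \<Rightarrow> complex mat \<Rightarrow> bool" where
  "unitary_mat N V \<longleftrightarrow> V \<in> carrier_mat N N \<and> V * mat_adjoint V = 1\<^sub>m N \<and> mat_adjoint V * V = 1\<^sub>m N"

definition opsum :: "nat \<Rightarrow> 'i set \<Rightarrow> ('i \<Rightarrow> complex mat) \<Rightarrow> complex mat" where
  "opsum N I F = mat N N (\<lambda>(r, c). \<Sum>i\<in>I. F i $$ (r, c))"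

definition zero_state :: "nat \<Rightarrow> complex mat" where
  "zero_state N = mat N N (\<lambda>(r, c). if r = 0 \<and> c = 0 then 1 else 0)"

definition orthonormal_op_basis :: "nat \<Rightarrow> 'i set \<Rightarrow> ('i \<Rightarrow> complex mat) \<Rightarrow> bool" where
  "orthonormal_op_basis N I T \<longleftrightarrow> finite I \<and> (\<forall>b\<in>I. T b \<in> carrier_mat N N) \<and>
     (\<forall>b\<in>I. \<forall>c\<in>I. hs (T b) (T c) = (if b = c then 1 else 0)) \<and>
     (\<forall>A\<in>carrier_mat N N. \<exists>a. A = opsum N I (\<lambda>b. a b \<cdot>\<^sub>m T b))"

definition quantum_channel :: "nat \<Rightarrow> (complex mat \<Rightarrow> complex mat) \<Rightarrow> bool" where
  "quantum_channel N E \<longleftrightarrow> (\<exists>(m::nat) K. (\<forall>k<m. K k \<in> carrier_mat N N) \<and>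
     opsum N {..<m} (\<lambda>k. mat_adjoint (K k) * K k) = 1\<^sub>m N \<and>
     (\<forall>A\<in>carrier_mat N N. E A = opsum N {..<m} (\<lambda>k. conj_by (K k) A)))"

definition superop_eigenvalues :: "nat \<Rightarrow> (complex mat \<Rightarrow> complex mat) \<Rightarrow> complex set" where
  "superop_eigenvalues N E = {e. \<exists>A\<in>carrier_mat N N. A \<noteq> 0\<^sub>m N N \<and> E A = e \<cdot>\<^sub>m A}"

text \<open>The inserted \<open>0\<close> only fixes the value (namely \<open>1\<close>) when all eigenvalues have modulus one.\<close>

definition spectral_gap :: "nat \<Rightarrow> (complex mat \<Rightarrow> complex mat) \<Rightarrow> real" where
  "spectral_gap N E = 1 - Max (insert 0 {cmod e | e. e \<in> superop_eigenvalues N E \<and> cmod e \<noteq> 1})"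

section \<open>Compact groups and their representations\<close>

text \<open>A finite group is covered by taking the discrete topology.\<close>

definition compact_group :: "'g monoid \<Rightarrow> 'g topology \<Rightarrow> bool" where
  "compact_group G T \<longleftrightarrow> group G \<and> topspace T = carrier G \<and> compact_space T \<and> Hausdorff_space T \<and>
     continuous_map (prod_topology T T) T (\<lambda>(x, y). x \<otimes>\<^bsub>G\<^esub> y) \<and>
     continuous_map T T (\<lambda>x. inv\<^bsub>G\<^esub> x)"

definition normalised_haar :: "'g monoid \<Rightarrow> 'g topology \<Rightarrow> 'g measure \<Rightarrow> bool" where
  "normalised_haar G T \<mu> \<longleftrightarrow> space \<mu> = carrier G \<and>
     sets \<mu> = sigma_sets (carrier G) {S. openin T S} \<and> emeasure \<mu> (carrier G) = 1 \<and>
     (\<forall>h\<in>carrier G. \<forall>A\<in>sets \<mu>. emeasure \<mu> ((\<lambda>x. h \<otimes>\<^bsub>G\<^esub> x) ` A) = emeasure \<mu> A) \<and>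
     (\<forall>A\<in>sets \<mu>. emeasure \<mu> A = (INF S\<in>{S. openin T S \<and> A \<subseteq> S}. emeasure \<mu> S))"

definition unitary_rep :: "'g monoid \<Rightarrow> 'g topology \<Rightarrow> nat \<Rightarrow> ('g \<Rightarrow> complex mat) \<Rightarrow> bool" where
  "unitary_rep G T m R \<longleftrightarrow> (\<forall>g\<in>carrier G. unitary_mat m (R g)) \<and> R \<one>\<^bsub>G\<^esub> = 1\<^sub>m m \<and>
     (\<forall>g\<in>carrier G. \<forall>h\<in>carrier G. R (g \<otimes>\<^bsub>G\<^esub> h) = R g * R h) \<and>
     (\<forall>r<m. \<forall>c<m. continuous_map T euclidean (\<lambda>g. R g $$ (r, c)))"

definition irreducible_rep :: "'g monoid \<Rightarrow> 'g topology \<Rightarrow> nat \<Rightarrow> ('g \<Rightarrow> complex mat) \<Rightarrow> bool" where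
  "irreducible_rep G T m R \<longleftrightarrow> unitary_rep G T m R \<and> m > 0 \<and>
     (\<forall>S. VectorSpace.subspace class_ring S (module_vec TYPE(complex) m) \<longrightarrow>
        (\<forall>g\<in>carrier G. \<forall>x\<in>S. R g *\<^sub>v x \<in> S) \<longrightarrow> S = {0\<^sub>v m} \<or> S = carrier_vec m)"

definition trivial_rep :: "'g monoid \<Rightarrow> nat \<Rightarrow> ('g \<Rightarrow> complex mat) \<Rightarrow> bool" where
  "trivial_rep G m R \<longleftrightarrow> m = 1 \<and> (\<forall>g\<in>carrier G. R g = 1\<^sub>m 1)"

section \<open>Symmetric circuits, symmetry-adapted bases, noise\<close>

text \<open>A label \<open>(\<lambda>, \<alpha>, k)\<close> consists of an irrep label, a multiplicity index and a row index.\<close>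

type_synonym label = "nat \<times> nat \<times> nat"

text \<open>
  The first argument of the slot-dependent fields is the slot \<open>i\<close>. Slots \<open>1, \<dots>, depth\<close> carry a
  group representation; slot \<open>depth + 1\<close> only carries an operator basis. Multiplicities and
  eigenvalues may depend on the slot, i.e. the position label is part of the irrep label.
\<close>

record 'g circuit =
  grp :: "'g monoid"
  gtop :: "'g topology"
  haar :: "'g measure"
  depth :: nat
  rep :: "nat \<Rightarrow> 'g \<Rightarrow> complex mat"
  gate :: "nat \<Rightarrow> complex mat"
  irreps :: "nat \<Rightarrow> nat set"
  mlt :: "nat \<Rightarrow> nat \<Rightarrow> nat"
  irdim :: "nat \<Rightarrow> nat \<Rightarrow> nat"
  mcoef :: "nat \<Rightarrow> nat \<Rightarrow> 'g \<Rightarrow> complex mat"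
  tens :: "nat \<Rightarrow> label \<Rightarrow> complex mat"
  noise :: "complex mat \<Rightarrow> complex mat"
  neig :: "nat \<Rightarrow> label \<Rightarrow> complex"
  obsv :: "complex mat"

definition labels :: "('g, 'z) circuit_scheme \<Rightarrow> nat \<Rightarrow> label set" where
  "labels X i = {(l, a, k). l \<in> irreps X i \<and> a < mlt X i l \<and> k < irdim X i l}"

abbreviation irrep_of :: "label \<Rightarrow> nat" where
  "irrep_of b \<equiv> fst b"

definition is_circuit :: "nat \<Rightarrow> ('g, 'z) circuit_scheme \<Rightarrow> bool" where
  "is_circuit N X \<longleftrightarrow> compact_group (grp X) (gtop X) \<and>
     normalised_haar (grp X) (gtop X) (haar X) \<and> depth X \<ge> 1 \<and>
     (\<forall>i\<in>{1..depth X}. unitary_rep (grp X) (gtop X) N (rep X i) \<and> unitary_mat N (gate X i))"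

definition observable :: "nat \<Rightarrow> complex mat \<Rightarrow> bool" where
  "observable N A \<longleftrightarrow> A \<in> carrier_mat N N \<and> mat_adjoint A = A"

text \<open>
  The label \<open>0\<close> is reserved for the trivial irrep. No condition links the irrep labels of slot
  \<open>depth + 1\<close> to a group: labelling everything there by \<open>0\<close> expresses that no group acts (then
  \<open>triv_proj\<close> is the identity at that slot), and a common basis reuses the labels of the other slots.
\<close>

definition symmetry_adapted :: "nat \<Rightarrow> ('g, 'z) circuit_scheme \<Rightarrow> bool" where
  "symmetry_adapted N X \<longleftrightarrow>
     (\<forall>i\<in>{1..depth X + 1}. orthonormal_op_basis N (labels X i) (tens X i)) \<and>
     (\<forall>i\<in>{1..depth X}. finite (irreps X i) \<and>
        (\<forall>l\<in>irreps X i. mlt X i l > 0 \<and>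
           irreducible_rep (grp X) (gtop X) (irdim X i l) (mcoef X i l) \<and>
           (l = 0 \<longleftrightarrow> trivial_rep (grp X) (irdim X i l) (mcoef X i l))) \<and>
        (\<forall>(l, a, k)\<in>labels X i. \<forall>g\<in>carrier (grp X).
           conj_by (rep X i g) (tens X i (l, a, k)) =
           opsum N {..<irdim X i l} (\<lambda>k'. mcoef X i l g $$ (k', k) \<cdot>\<^sub>m tens X i (l, a, k'))))"

definition triv_proj :: "nat \<Rightarrow> ('g, 'z) circuit_scheme \<Rightarrow> nat \<Rightarrow> complex mat \<Rightarrow> complex mat" where
  "triv_proj N X i A =
     opsum N {b \<in> labels X i. irrep_of b = 0} (\<lambda>b. hs (tens X i b) A \<cdot>\<^sub>m tens X i b)"

definition noise_penalisation :: "nat \<Rightarrow> ('g, 'z) circuit_scheme \<Rightarrow> bool" where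
  "noise_penalisation N X \<longleftrightarrow> quantum_channel N (noise X) \<and>
     (\<forall>i\<in>{1..depth X}. \<forall>b\<in>labels X i.
        noise X (tens X i b) = neig X i b \<cdot>\<^sub>m tens X i b \<and>
        (if irrep_of b = 0 then neig X i b = 1
         else cmod (neig X i b) \<le> 1 - spectral_gap N (noise X)))"

definition op_support :: "('g, 'z) circuit_scheme \<Rightarrow> label set" where
  "op_support X = {b \<in> labels X 1. hs (tens X 1 b) (obsv X) \<noteq> 0}"

definition op_rank :: "('g, 'z) circuit_scheme \<Rightarrow> nat" where
  "op_rank X = card (op_support X)"

definition max_irdim :: "('g, 'z) circuit_scheme \<Rightarrow> nat" where
  "max_irdim X = Max {irdim X i l | i l. i \<in> {1..depth X} \<and> l \<in> irreps X i}"

text \<open>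
  \<open>propagate X i j\<close> is \<open>(W\<^sub>i \<otimes> W\<^sub>i\<^sup>*) \<cdots> (W\<^sub>j\<^sub>-\<^sub>1 \<otimes> W\<^sub>j\<^sub>-\<^sub>1\<^sup>*)\<close>, mapping slot \<open>j\<close> to slot \<open>i\<close>, and
  \<open>propagate_adj X i j\<close> is its adjoint (Heisenberg picture), mapping slot \<open>i\<close> to slot \<open>j\<close>.
\<close>

definition propagate :: "('g, 'z) circuit_scheme \<Rightarrow> nat \<Rightarrow> nat \<Rightarrow> complex mat \<Rightarrow> complex mat" where
  "propagate X i j A = foldr (\<lambda>m. conj_by (gate X m)) [i..<j] A"

definition propagate_adj :: "('g, 'z) circuit_scheme \<Rightarrow> nat \<Rightarrow> nat \<Rightarrow> complex mat \<Rightarrow> complex mat" where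
  "propagate_adj X i j A = fold (\<lambda>m. conj_by (mat_adjoint (gate X m))) [i..<j] A"

definition remains_trivial :: "nat \<Rightarrow> ('g, 'z) circuit_scheme \<Rightarrow> nat \<Rightarrow> label \<Rightarrow> nat \<Rightarrow> bool" where
  "remains_trivial N X i b m \<longleftrightarrow> triv_proj N X m (propagate_adj X i m (tens X i b)) =
     propagate_adj X i m (tens X i b)"

text \<open>
  In the second conjunct of \<open>tree_growth\<close> the case \<open>j = i\<close> is the condition on a single gate. For
  \<open>j > i\<close> the condition is required as long as the propagated basis operator stayed in the trivial
  sector of all slots in between. This is what allows such a run to be contracted as the
  plain product \<open>W\<^sub>i \<cdots> W\<^sub>j\<close>. It does not follow from the case \<open>j = i\<close>: an operator
  \<open>W\<^sub>i\<^sup>\<dagger> T W\<^sub>i\<close> may be a combination of two trivial basis operators of which \<open>W\<^sub>i\<^sub>+\<^sub>1\<close> maps one to the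
  trivial and the other to the non-trivial sector.
\<close>

definition tree_growth :: "nat \<Rightarrow> ('g, 'z) circuit_scheme \<Rightarrow> bool" where
  "tree_growth N X \<longleftrightarrow>
     (\<forall>i\<in>{1..depth X}. \<forall>b\<in>labels X (i + 1).
        triv_proj N X i (conj_by (gate X i) (tens X (i + 1) b)) \<in>
          {0\<^sub>m N N, conj_by (gate X i) (tens X (i + 1) b)}) \<and>
     (\<forall>i\<in>{1..depth X}. \<forall>b\<in>labels X i. \<forall>j\<in>{i..depth X}.
        (\<forall>m\<in>{i<..j}. remains_trivial N X i b m) \<longrightarrow>
        triv_proj N X (j + 1) (propagate_adj X i (j + 1) (tens X i b)) \<in>
          {0\<^sub>m N N, propagate_adj X i (j + 1) (tens X i b)})"

definition path_count :: "('g, 'z) circuit_scheme \<Rightarrow> nat \<Rightarrow> bool" where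
  "path_count X s \<longleftrightarrow> (\<forall>i\<in>{1..depth X}. \<forall>j\<in>{i<..depth X + 1}.
     (\<forall>b\<in>labels X i.
        card {c \<in> labels X j. hs (tens X i b) (propagate X i j (tens X j c)) \<noteq> 0} \<le> s) \<and>
     (\<forall>c\<in>labels X j.
        card {b \<in> labels X i. hs (tens X i b) (propagate X i j (tens X j c)) \<noteq> 0} \<le> s))"

section \<open>Noisy expectation value and its truncation\<close>

definition noisy_layer :: "('g, 'z) circuit_scheme \<Rightarrow> (nat \<Rightarrow> 'g) \<Rightarrow> nat \<Rightarrow> complex mat \<Rightarrow> complex mat"
  where "noisy_layer X g i A = noise X (conj_by (rep X i (g i) * gate X i) A)"

definition noisy_value :: "nat \<Rightarrow> ('g, 'z) circuit_scheme \<Rightarrow> (nat \<Rightarrow> 'g) \<Rightarrow> complex" where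
  "noisy_value N X g = hs (obsv X) (foldr (noisy_layer X g) [1..<depth X + 1] (zero_state N))"

definition path_amplitude ::
    "nat \<Rightarrow> ('g, 'z) circuit_scheme \<Rightarrow> (nat \<Rightarrow> 'g) \<Rightarrow> (nat \<Rightarrow> label) \<Rightarrow> complex" where
  "path_amplitude N X g B = hs (obsv X) (tens X 1 (B 1)) *
     (\<Prod>i\<in>{1..depth X}. hs (tens X i (B i)) (noisy_layer X g i (tens X (i + 1) (B (i + 1))))) *
     hs (tens X (depth X + 1) (B (depth X + 1))) (zero_state N)"

definition truncated_value ::
    "nat \<Rightarrow> ('g, 'z) circuit_scheme \<Rightarrow> nat \<Rightarrow> (nat \<Rightarrow> 'g) \<Rightarrow> complex" where
  "truncated_value N X L g =
     (\<Sum>B\<in>{B \<in> Pi\<^sub>E {1..depth X + 1} (labels X). card {i \<in> {1..depth X}. irrep_of (B i) \<noteq> 0} \<le> L}.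
        path_amplitude N X g B)"

definition product_haar :: "('g, 'z) circuit_scheme \<Rightarrow> (nat \<Rightarrow> 'g) measure" where
  "product_haar X = Pi\<^sub>M {1..depth X} (\<lambda>_. haar X)"

definition square_integrable :: "'a measure \<Rightarrow> ('a \<Rightarrow> complex) \<Rightarrow> bool" where
  "square_integrable M f \<longleftrightarrow> f \<in> borel_measurable M \<and> integrable M (\<lambda>x. (cmod (f x))\<^sup>2)"

definition l2_norm :: "'a measure \<Rightarrow> ('a \<Rightarrow> complex) \<Rightarrow> real" where
  "l2_norm M f = sqrt (\<integral>x. (cmod (f x))\<^sup>2 \<partial>M)"

section \<open>Machine model\<close>

text \<open>
  Classical algorithms are programs for a random access machine with one memory of natural numbers
  and one of complex numbers, exact arithmetic, and subroutine calls. Every basic instruction and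
  every test takes one time unit, a subroutine call takes the time assigned to that subroutine.
  The circuit, the basis, the observable and the group elements are only accessible by calls.
\<close>

datatype subroutine = QObs | QDim | QContract | QCoeff | QNoise | QOverlap

type_synonym answers = "subroutine \<Rightarrow> nat list \<Rightarrow> nat list \<times> complex"
type_synonym store = "(nat \<Rightarrow> nat) \<times> (nat \<Rightarrow> complex)"

datatype prog =
    Skip
  | NConst nat nat | NAdd nat nat nat | NSub nat nat nat
  | NLoad nat nat | NStore nat nat
  | ZNat nat nat | ZAdd nat nat nat | ZMul nat nat nat
  | ZLoad nat nat | ZStore nat nat
  | Call subroutine "nat list" "nat list" nat
  | Seq prog prog
  | IfLess nat nat prog prog
  | WhileLess nat nat prog

inductive exec :: "answers \<Rightarrow> (subroutine \<Rightarrow> nat) \<Rightarrow> prog \<Rightarrow> store \<Rightarrow> nat \<Rightarrow> store \<Rightarrow> bool"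
  for ans cost where
  "exec ans cost Skip st 0 st"
| "exec ans cost (NConst x c) (M, Z) 1 (M(x := c), Z)"
| "exec ans cost (NAdd x y z) (M, Z) 1 (M(x := M y + M z), Z)"
| "exec ans cost (NSub x y z) (M, Z) 1 (M(x := M y - M z), Z)"
| "exec ans cost (NLoad x y) (M, Z) 1 (M(x := M (M y)), Z)"
| "exec ans cost (NStore x y) (M, Z) 1 (M(M x := M y), Z)"
| "exec ans cost (ZNat x y) (M, Z) 1 (M, Z(x := of_nat (M y)))"
| "exec ans cost (ZAdd x y z) (M, Z) 1 (M, Z(x := Z y + Z z))"
| "exec ans cost (ZMul x y z) (M, Z) 1 (M, Z(x := Z y * Z z))"
| "exec ans cost (ZLoad x y) (M, Z) 1 (M, Z(x := Z (M y)))"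
| "exec ans cost (ZStore x y) (M, Z) 1 (M, Z(M x := Z y))"
| "ans q (map M xs) = (vs, w) \<Longrightarrow>
     exec ans cost (Call q xs ys z) (M, Z) (cost q)
       (fold (\<lambda>(y, v) M'. M'(y := v)) (zip ys vs) M, Z(z := w))"
| "exec ans cost P st t st' \<Longrightarrow> exec ans cost Q st' u st'' \<Longrightarrow>
     exec ans cost (Seq P Q) st (t + u) st''"
| "fst st x < fst st y \<Longrightarrow> exec ans cost P st t st' \<Longrightarrow>
     exec ans cost (IfLess x y P Q) st (1 + t) st'"
| "\<not> fst st x < fst st y \<Longrightarrow> exec ans cost Q st t st' \<Longrightarrow>
     exec ans cost (IfLess x y P Q) st (1 + t) st'"
| "fst st x < fst st y \<Longrightarrow> exec ans cost P st t st' \<Longrightarrow>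
     exec ans cost (WhileLess x y P) st' u st'' \<Longrightarrow>
     exec ans cost (WhileLess x y P) st (1 + t + u) st''"
| "\<not> fst st x < fst st y \<Longrightarrow> exec ans cost (WhileLess x y P) st 1 st"

record cost_params =
  contract_cost :: nat
  coeff_cost :: nat
  neig_cost :: nat
  overlap_cost :: nat

definition positive_costs :: "cost_params \<Rightarrow> bool" where
  "positive_costs c \<longleftrightarrow>
     contract_cost c \<ge> 1 \<and> coeff_cost c \<ge> 1 \<and> neig_cost c \<ge> 1 \<and> overlap_cost c \<ge> 1"

fun call_cost :: "cost_params \<Rightarrow> subroutine \<Rightarrow> nat" where
  "call_cost c QObs = 1"
| "call_cost c QDim = 1"
| "call_cost c QContract = contract_cost c"
| "call_cost c QCoeff = coeff_cost c"
| "call_cost c QNoise = neig_cost c"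
| "call_cost c QOverlap = overlap_cost c"

definition evaluate_cost :: "cost_params \<Rightarrow> nat \<Rightarrow> nat" where
  "evaluate_cost c L = L * contract_cost c + L * (coeff_cost c + neig_cost c) + overlap_cost c"

text \<open>
  The run of a basis operator \<open>T\<close> of slot \<open>i\<close> ends at the first later slot at which the propagated
  operator leaves the trivial sector, or at slot \<open>depth + 1\<close>.
\<close>

definition next_slot :: "nat \<Rightarrow> ('g, 'z) circuit_scheme \<Rightarrow> nat \<Rightarrow> label \<Rightarrow> nat" where
  "next_slot N X i b = (LEAST j. i < j \<and> (j = depth X + 1 \<or> \<not> remains_trivial N X i b j))"

fun code_of :: "label \<Rightarrow> nat list" where
  "code_of (l, a, k) = [l, a, k]"

text \<open>
  \<open>implements N X g f\<close>: on valid arguments, the subroutines \<open>f\<close> answer for the circuit \<open>X\<close> at the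
  group elements \<open>g\<close>.
  \<open>QObs\<close> lists the expansion of the observable in the basis of slot \<open>1\<close>.
  One call of \<open>QContract\<close> returns one matrix element of the product of gates of a run: its arguments
  are a slot, a basis operator of that slot and an index into the list \<open>cs\<close> of basis operators with
  non-zero matrix element, and it returns the length of that list, the slot where the run ends, the
  basis operator with the given index and the matrix element.
  \<open>QOverlap\<close> is the final overlap with \<open>|0\<^sup>n\<rangle>\<langle>0\<^sup>n|\<close> of a basis operator propagated through all
  remaining gates.
  The order of the lists \<open>os\<close> and \<open>cs\<close> is arbitrary.
\<close>

definition implements ::
    "nat \<Rightarrow> ('g, 'z) circuit_scheme \<Rightarrow> (nat \<Rightarrow> 'g) \<Rightarrow> answers \<Rightarrow> bool" where
  "implements N X g f \<longleftrightarrow>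
     (\<exists>os. distinct os \<and> set os = op_support X \<and>
        (\<forall>p<length os. f QObs [p] = (code_of (os ! p), hs (obsv X) (tens X 1 (os ! p))))) \<and>
     (\<forall>i\<in>{1..depth X}. \<forall>l\<in>irreps X i. f QDim [i, l] = ([irdim X i l], 0) \<and>
        (\<forall>k<irdim X i l. \<forall>k'<irdim X i l.
           f QCoeff [i, l, k, k'] = ([], mcoef X i l (g i) $$ (k, k')))) \<and>
     (\<forall>i\<in>{1..depth X}. \<forall>b\<in>labels X i.
        f QNoise (i # code_of b) = ([], neig X i b) \<and>
        f QOverlap (i # code_of b) =
          ([], hs (tens X i b) (propagate X i (depth X + 1) (zero_state N))) \<and>
        (let j = next_slot N X i b in
         \<exists>cs. distinct cs \<and>
           set cs = {c \<in> labels X j. hs (tens X i b) (propagate X i j (tens X j c)) \<noteq> 0} \<and>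
           (\<forall>p<length cs. f QContract (i # code_of b @ [p]) =
              (length cs # j # code_of (cs ! p),
               hs (tens X i b) (propagate X i j (tens X j (cs ! p)))))))"

text \<open>Input: the rank, the truncation parameter and the depth in registers 0, 1 and 2.\<close>

definition init_store :: "nat \<Rightarrow> nat \<Rightarrow> nat \<Rightarrow> store" where
  "init_store r L D = ((\<lambda>_. 0)(0 := r, 1 := L, 2 := D), \<lambda>_. 0)"

definition computes_in ::
    "prog \<Rightarrow> answers \<Rightarrow> (subroutine \<Rightarrow> nat) \<Rightarrow> store \<Rightarrow> complex \<Rightarrow> real \<Rightarrow> bool" where
  "computes_in P f cost st w bound \<longleftrightarrow>
     (\<exists>t st'. exec f cost P st t st' \<and> snd st' 0 = w \<and> real t \<le> bound)"

definition poly_bounded :: "(nat \<Rightarrow> nat) \<Rightarrow> bool" where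
  "poly_bounded f \<longleftrightarrow> (\<exists>k. (\<lambda>n. real (f n)) \<in> O(\<lambda>n. real n ^ k))"

end

theory Submission
  imports Defs "HOL-Probability.Probability"
begin

text \<open>
  \<^bold>\<open>Error bound.\<close> Group the paths by the set \<open>S\<close> of slots at which they carry a non-trivial operator.
  Matrix coefficients of non-trivial irreps have mean zero and those of the trivial irrep are
  constant, so the partial sums belonging to different \<open>S\<close> are orthogonal in \<open>L\<^sup>2\<close> and only
  \<open>\<Sum>\<^sub>S |f\<^sub>S(g)|\<^sup>2\<close> over \<open>|S| > L\<close> has to be bounded. This is possible for each fixed \<open>g\<close>: by
  Parseval every layer splits the squared norm into a trivial part, which is kept, and a non-trivial
  part, which the noise damps by \<open>q\<^sup>2\<close>, where \<open>q\<close> is \<open>1 - \<gamma>\<close> cut off to \<open>[0, 1]\<close>; the result is \<open>q\<^sup>2\<^sup>(\<^sup>L\<^sup>+\<^sup>1\<^sup>)\<close> times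
  the squared norm of \<open>O\<close>.

  \<^bold>\<open>Algorithm.\<close> By tree growth, a basis operator stays in the trivial sector until the end of its
  run and is purely non-trivial there, so all trivial operators of a run are summed by one
  contraction and every further branching consumes one of the \<open>L\<close> admissible non-trivial operators.
  The resulting tree of depth at most \<open>L\<close>, with branching \<open>s d\<^sub>m\<^sub>a\<^sub>x\<close>, is searched with an explicit
  stack of weighted nodes; the running time follows from a potential assigned to each pending node.
\<close>

section \<open>Hilbert-Schmidt space and channels\<close>

text \<open>Paths with the same \<open>S\<close> need not be orthogonal, and their number is not
  controlled, so a bound path by path would pick up a counting factor. Grouping by \<open>S\<close>
  is coarse enough to avoid this: inside one group only norms are compared, and every circuit layer
  is unitary up to the noise. The noise assumption alone gives \<open>1 - \<gamma>\<close> as a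
  bound for the damping; that it never exceeds one is a property of channels and has to be proved
  separately, since the induction over the layers needs \<open>q \<le> 1\<close>.

  The run-time bound must not contain the depth. Stepping through the trivial slots one by one is
  therefore excluded, and the end of a run has to be reached in a single call. The factor d_max
  arises where a group element spreads a non-trivial operator over the rows of its irrep; the
  trivial irrep has one row and does not branch in this way. Weights are multiplied in when a node
  is created, so that no value has to be passed back up the tree and a plain stack replaces
  recursion.\<close>

lemma adjoint_carrier [simp]: "V \<in> carrier_mat m n \<Longrightarrow> mat_adjoint V \<in> carrier_mat n m"
  by (auto simp: mat_adjoint_def mat_of_rows_def)

lemma adjoint_index [simp]:
  fixes V :: "complex mat"
  shows
  "V \<in> carrier_mat m n \<Longrightarrow> i < n \<Longrightarrow> j < m \<Longrightarrow> mat_adjoint V $$ (i, j) = cnj (V $$ (j, i))"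
  by (auto simp: mat_adjoint_def mat_of_rows_def cols_def)

lemma adjoint_adjoint:
  fixes V :: "complex mat"
  assumes V: "V \<in> carrier_mat m n"
  shows "mat_adjoint (mat_adjoint V) = V"
proof (rule eq_matI)
  have V2: "mat_adjoint V \<in> carrier_mat n m" using V by simp
  show "mat_adjoint (mat_adjoint V) $$ (i, j) = V $$ (i, j)" if "i < dim_row V" "j < dim_col V" for i j
    using that V adjoint_index[OF V2, of i j] by simp
  show "dim_row (mat_adjoint (mat_adjoint V)) = dim_row V" "dim_col (mat_adjoint (mat_adjoint V)) = dim_col V"
    using carrier_matD[OF V] carrier_matD[OF adjoint_carrier[OF V2]] by auto
qed

lemma adjoint_mult:
  fixes V W :: "complex mat"
  assumes V: "V \<in> carrier_mat N N" and W: "W \<in> carrier_mat N N"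
  shows "mat_adjoint (V * W) = mat_adjoint W * mat_adjoint V"
proof (rule eq_matI)
  have VW: "V * W \<in> carrier_mat N N" and R: "mat_adjoint W * mat_adjoint V \<in> carrier_mat N N"
    using V W by (auto intro!: mult_carrier_mat[of _ N N])
  show "mat_adjoint (V * W) $$ (i, j) = (mat_adjoint W * mat_adjoint V) $$ (i, j)"
    if "i < dim_row (mat_adjoint W * mat_adjoint V)" "j < dim_col (mat_adjoint W * mat_adjoint V)" for i j
  proof -
    have ij: "i < N" "j < N" using that R by auto
    have "mat_adjoint (V * W) $$ (i, j) = cnj ((V * W) $$ (j, i))"
      using VW ij by simp
    also have "\<dots> = (\<Sum>k<N. cnj (V $$ (j, k) * W $$ (k, i)))"
      using ij V W by (simp add: scalar_prod_def atLeast0LessThan)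
    also have "\<dots> = (mat_adjoint W * mat_adjoint V) $$ (i, j)"
    proof -
      have dims: "dim_row (mat_adjoint W) = N" "dim_col (mat_adjoint V) = N" "dim_row (mat_adjoint V) = N"
        "dim_col (mat_adjoint W) = N"
        using adjoint_carrier[OF V] adjoint_carrier[OF W] by auto
      show ?thesis using ij V W dims
        by (auto simp: scalar_prod_def atLeast0LessThan mult.commute intro!: sum.cong)
    qed
    finally show ?thesis .
  qed
  show "dim_row (mat_adjoint (V * W)) = dim_row (mat_adjoint W * mat_adjoint V)"
    "dim_col (mat_adjoint (V * W)) = dim_col (mat_adjoint W * mat_adjoint V)"
    using adjoint_carrier[OF VW] R by auto
qed

lemma conj_by_carrier [simp]:
  "V \<in> carrier_mat N N \<Longrightarrow> A \<in> carrier_mat N N \<Longrightarrow> conj_by V A \<in> carrier_mat N N"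
  unfolding conj_by_def by (intro mult_carrier_mat[of _ N N] adjoint_carrier)

lemma opsum_carrier [simp]: "opsum N I F \<in> carrier_mat N N"
  by (simp add: opsum_def)

lemma zero_state_carrier [simp]: "zero_state N \<in> carrier_mat N N"
  by (simp add: zero_state_def)

lemma opsum_index [simp]: "r < N \<Longrightarrow> c < N \<Longrightarrow> opsum N I F $$ (r, c) = (\<Sum>i\<in>I. F i $$ (r, c))"
  by (simp add: opsum_def)

lemma conj_by_index:
  assumes V: "V \<in> carrier_mat N N" and A: "A \<in> carrier_mat N N" and rc: "r < N" "c < N"
  shows "conj_by V A $$ (r, c) = (\<Sum>x<N. \<Sum>y<N. V $$ (r, x) * A $$ (x, y) * cnj (V $$ (c, y)))"
proof -
  have d: "dim_row (mat_adjoint V) = N" "dim_col (mat_adjoint V) = N"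
    using adjoint_carrier[OF V] by auto
  have VA: "V * A \<in> carrier_mat N N" using V A by (rule mult_carrier_mat)
  have "conj_by V A $$ (r, c) = (\<Sum>y<N. (V * A) $$ (r, y) * cnj (V $$ (c, y)))"
    unfolding conj_by_def using VA V A rc d by (simp add: scalar_prod_def atLeast0LessThan)
  also have "\<dots> = (\<Sum>y<N. \<Sum>x<N. V $$ (r, x) * A $$ (x, y) * cnj (V $$ (c, y)))"
    using A V rc by (auto simp: scalar_prod_def atLeast0LessThan sum_distrib_right intro!: sum.cong)
  also have "\<dots> = (\<Sum>x<N. \<Sum>y<N. V $$ (r, x) * A $$ (x, y) * cnj (V $$ (c, y)))"
    by (rule sum.swap)
  finally show ?thesis .
qed

lemma conj_by_mult:
  assumes "V \<in> carrier_mat N N" "W \<in> carrier_mat N N" "A \<in> carrier_mat N N"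
  shows "conj_by (V * W) A = conj_by V (conj_by W A)"
proof -
  have c: "mat_adjoint V \<in> carrier_mat N N" "mat_adjoint W \<in> carrier_mat N N"
    "W * A \<in> carrier_mat N N" "W * A * mat_adjoint W \<in> carrier_mat N N"
    using assms by (auto intro!: mult_carrier_mat[of _ N N])
  show ?thesis
    unfolding conj_by_def adjoint_mult[OF assms(1,2)]
    using assms c
    by (simp add: assoc_mult_mat[of _ N N _ N _ N] mult_carrier_mat[of _ N N])
qed

lemma conj_by_unitary_inv:
  assumes "unitary_mat N V" "A \<in> carrier_mat N N"
  shows "conj_by (mat_adjoint V) (conj_by V A) = A"
proof -
  have V: "V \<in> carrier_mat N N" "mat_adjoint V * V = 1\<^sub>m N" using assms by (auto simp: unitary_mat_def)
  have "conj_by (mat_adjoint V) (conj_by V A) = conj_by (1\<^sub>m N) A"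
    using conj_by_mult[of "mat_adjoint V" N V A] V assms by simp
  also have "\<dots> = A"
  proof -
    have "mat_adjoint (1\<^sub>m N) = (1\<^sub>m N :: complex mat)"
    proof (rule eq_matI)
      have c: "mat_adjoint (1\<^sub>m N :: complex mat) \<in> carrier_mat N N" by simp
      then show "dim_row (mat_adjoint (1\<^sub>m N :: complex mat)) = dim_row (1\<^sub>m N :: complex mat)"
        "dim_col (mat_adjoint (1\<^sub>m N :: complex mat)) = dim_col (1\<^sub>m N :: complex mat)"
        using carrier_matD[OF c] by auto
      show "mat_adjoint (1\<^sub>m N :: complex mat) $$ (i, j) = (1\<^sub>m N :: complex mat) $$ (i, j)"
        if "i < dim_row (1\<^sub>m N :: complex mat)" "j < dim_col (1\<^sub>m N :: complex mat)" for i j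
        using that adjoint_index[of "1\<^sub>m N :: complex mat" N N i j] by auto
    qed
    then show ?thesis unfolding conj_by_def using assms by simp
  qed
  finally show ?thesis .
qed

lemma unitary_mat_mult:
  assumes "unitary_mat N V" "unitary_mat N W"
  shows "unitary_mat N (V * W)"
proof -
  have V: "V \<in> carrier_mat N N" "mat_adjoint V \<in> carrier_mat N N" "V * mat_adjoint V = 1\<^sub>m N" "mat_adjoint V * V = 1\<^sub>m N"
    and W: "W \<in> carrier_mat N N" "mat_adjoint W \<in> carrier_mat N N" "W * mat_adjoint W = 1\<^sub>m N" "mat_adjoint W * W = 1\<^sub>m N"
    using assms by (auto simp: unitary_mat_def)
  have "V * W * (mat_adjoint W * mat_adjoint V) = V * (W * mat_adjoint W) * mat_adjoint V"
    using V(1,2) W(1,2) by (simp add: assoc_mult_mat[of _ N N _ N _ N] mult_carrier_mat[of _ N N])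
  moreover have "mat_adjoint W * mat_adjoint V * (V * W) = mat_adjoint W * (mat_adjoint V * V) * W"
    using V(1,2) W(1,2) by (simp add: assoc_mult_mat[of _ N N _ N _ N] mult_carrier_mat[of _ N N])
  ultimately show ?thesis
    unfolding unitary_mat_def adjoint_mult[OF V(1) W(1)] using V W by simp
qed

lemma unitary_adjoint: "unitary_mat N V \<Longrightarrow> unitary_mat N (mat_adjoint V)"
  by (auto simp: unitary_mat_def adjoint_adjoint)

lemma hs_eq:
  assumes A: "A \<in> carrier_mat N N" and B: "B \<in> carrier_mat N N"
  shows "hs A B = (\<Sum>r<N. \<Sum>c<N. cnj (A $$ (r, c)) * B $$ (r, c))"
proof -
  have d: "dim_row (mat_adjoint A) = N" "dim_col (mat_adjoint A) = N"
    using adjoint_carrier[OF A] by auto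
  have "hs A B = (\<Sum>c<N. \<Sum>r<N. cnj (A $$ (r, c)) * B $$ (r, c))"
    unfolding hs_def using A B d
    by (auto simp: scalar_prod_def atLeast0LessThan intro!: sum.cong)
  also have "\<dots> = (\<Sum>r<N. \<Sum>c<N. cnj (A $$ (r, c)) * B $$ (r, c))" by (rule sum.swap)
  finally show ?thesis .
qed

lemma hs_cnj:
  assumes "A \<in> carrier_mat N N" "B \<in> carrier_mat N N"
  shows "cnj (hs A B) = hs B A"
  using assms by (simp add: hs_eq[of _ N] mult.commute)

lemma hs_self:
  assumes A: "A \<in> carrier_mat N N"
  shows "hs A A = of_real ((hs_norm A)\<^sup>2)"
proof -
  have e: "hs A A = of_real (\<Sum>r<N. \<Sum>c<N. (cmod (A $$ (r, c)))\<^sup>2)"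
    unfolding hs_eq[OF A A] of_real_sum
    by (simp only: mult.commute[of "cnj _"] complex_norm_square[symmetric])
  have "0 \<le> (\<Sum>r<N. \<Sum>c<N. (cmod (A $$ (r, c)))\<^sup>2)" by (intro sum_nonneg) auto
  then show ?thesis unfolding hs_norm_def e by simp
qed

lemma hs_smult_right [simp]:
  assumes "A \<in> carrier_mat N N" "B \<in> carrier_mat N N"
  shows "hs A (z \<cdot>\<^sub>m B) = z * hs A B"
  using assms by (simp add: hs_eq[of _ N] sum_distrib_left mult_ac)

lemma hs_opsum_right:
  assumes B: "B \<in> carrier_mat N N" and F: "\<And>i. i \<in> I \<Longrightarrow> F i \<in> carrier_mat N N"
  shows "hs B (opsum N I F) = (\<Sum>i\<in>I. hs B (F i))"
proof -
  have "hs B (opsum N I F) = (\<Sum>r<N. \<Sum>c<N. \<Sum>i\<in>I. cnj (B $$ (r, c)) * F i $$ (r, c))"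
    using B by (simp add: hs_eq[of _ N] sum_distrib_left)
  also have "\<dots> = (\<Sum>i\<in>I. \<Sum>r<N. \<Sum>c<N. cnj (B $$ (r, c)) * F i $$ (r, c))"
    unfolding sum.swap[of _ "{..<N}" I] by simp
  also have "\<dots> = (\<Sum>i\<in>I. hs B (F i))"
    using B F by (auto simp: hs_eq[of _ N] intro!: sum.cong)
  finally show ?thesis .
qed

lemma hs_opsum_left:
  assumes B: "B \<in> carrier_mat N N" and F: "\<And>i. i \<in> I \<Longrightarrow> F i \<in> carrier_mat N N"
  shows "hs (opsum N I F) B = (\<Sum>i\<in>I. hs (F i) B)"
proof -
  have "hs (opsum N I F) B = cnj (hs B (opsum N I F))" using B by (simp add: hs_cnj[of _ N])
  also have "\<dots> = (\<Sum>i\<in>I. cnj (hs B (F i)))" using hs_opsum_right[OF B F, of I "\<lambda>i. i"] by simp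
  also have "\<dots> = (\<Sum>i\<in>I. hs (F i) B)" using B F by (auto simp: hs_cnj[of _ N] intro!: sum.cong)
  finally show ?thesis .
qed

text \<open>Cyclicity of the trace, carried out on entries. It covers arbitrary square matrices
  because it is applied to Kraus operators as well as to gates.\<close>

lemma hs_conj_by:
  assumes V: "V \<in> carrier_mat N N" and A: "A \<in> carrier_mat N N" and B: "B \<in> carrier_mat N N"
  shows "hs (conj_by (mat_adjoint V) B) A = hs B (conj_by V A)"
proof -
  have V': "mat_adjoint V \<in> carrier_mat N N" using V by simp
  let ?t = "\<lambda>r c x y. cnj (B $$ (r, c)) * V $$ (r, x) * A $$ (x, y) * cnj (V $$ (c, y))"
  have "hs (conj_by (mat_adjoint V) B) A = (\<Sum>x<N. \<Sum>y<N. \<Sum>r<N. \<Sum>c<N. ?t r c x y)"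
    using assms V'
    by (auto simp: hs_eq[of _ N] conj_by_index[of _ N] sum_distrib_right sum_distrib_left mult_ac intro!: sum.cong)
  also have "\<dots> = (\<Sum>x<N. \<Sum>r<N. \<Sum>y<N. \<Sum>c<N. ?t r c x y)"
    by (intro sum.cong refl sum.swap)
  also have "\<dots> = (\<Sum>x<N. \<Sum>r<N. \<Sum>c<N. \<Sum>y<N. ?t r c x y)"
    by (intro sum.cong refl sum.swap)
  also have "\<dots> = (\<Sum>r<N. \<Sum>x<N. \<Sum>c<N. \<Sum>y<N. ?t r c x y)"
    by (rule sum.swap)
  also have "\<dots> = (\<Sum>r<N. \<Sum>c<N. \<Sum>x<N. \<Sum>y<N. ?t r c x y)"
    by (intro sum.cong refl sum.swap)
  also have "\<dots> = hs B (conj_by V A)"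
    using assms V'
    by (auto simp: hs_eq[of _ N] conj_by_index[of _ N] sum_distrib_left mult_ac intro!: sum.cong)
  finally show ?thesis by simp
qed

lemma hs_conj_by_unitary:
  assumes V: "unitary_mat N V" and A: "A \<in> carrier_mat N N" and B: "B \<in> carrier_mat N N"
  shows "hs (conj_by V A) (conj_by V B) = hs A B"
  using hs_conj_by[of V N B "conj_by V A"] conj_by_unitary_inv[OF V A] assms
  by (simp add: unitary_mat_def)

lemma zero_state_norm: "N > 0 \<Longrightarrow> hs (zero_state N) (zero_state N) = 1"
proof -
  assume N: "N > 0"
  have *: "(\<Sum>c<N. if r = 0 \<and> c = 0 then 1 else 0) = (if r = 0 then 1 else 0 :: complex)" for r
    using N by (cases "r = 0") (auto simp: sum.delta)
  have "hs (zero_state N) (zero_state N) = (\<Sum>r<N. \<Sum>c<N. if r = 0 \<and> c = 0 then 1 else 0)"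
    by (auto simp: hs_eq[of _ N] zero_state_def intro!: sum.cong)
  also have "\<dots> = 1" unfolding * using N by (simp add: sum.delta)
  finally show ?thesis .
qed

section \<open>Orthonormal operator bases: expansion and Parseval\<close>

context
  fixes N :: nat and I :: "'i set" and T :: "'i \<Rightarrow> complex mat"
  assumes ob: "orthonormal_op_basis N I T"
begin

lemma ob_finite: "finite I" using ob by (simp add: orthonormal_op_basis_def)

lemma ob_carrier: "b \<in> I \<Longrightarrow> T b \<in> carrier_mat N N" using ob by (simp add: orthonormal_op_basis_def)

lemma ob_orth: "b \<in> I \<Longrightarrow> c \<in> I \<Longrightarrow> hs (T b) (T c) = (if b = c then 1 else 0)"
  using ob by (simp add: orthonormal_op_basis_def)

text \<open>The sum runs over a subset \<open>J\<close> because projections and sector sums use only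
  part of a basis.\<close>

lemma ob_coeff:
  assumes b: "b \<in> I" and J: "J \<subseteq> I"
  shows "hs (T b) (opsum N J (\<lambda>c. a c \<cdot>\<^sub>m T c)) = (if b \<in> J then a b else 0)"
proof -
  have "hs (T b) (opsum N J (\<lambda>c. a c \<cdot>\<^sub>m T c)) = (\<Sum>c\<in>J. hs (T b) (a c \<cdot>\<^sub>m T c))"
    using ob_carrier b J by (intro hs_opsum_right) auto
  also have "\<dots> = (\<Sum>c\<in>J. if c = b then a c else 0)"
  proof (rule sum.cong)
    fix c assume "c \<in> J"
    then have c: "c \<in> I" using J by auto
    show "hs (T b) (a c \<cdot>\<^sub>m T c) = (if c = b then a c else 0)"
      using ob_carrier[OF b] ob_carrier[OF c] ob_orth[OF b c] by auto
  qed simp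
  also have "\<dots> = (if b \<in> J then a b else 0)"
    using finite_subset[OF J ob_finite] by (simp add: sum.delta)
  finally show ?thesis .
qed

lemma ob_expand:
  assumes A: "A \<in> carrier_mat N N"
  shows "A = opsum N I (\<lambda>b. hs (T b) A \<cdot>\<^sub>m T b)"
proof -
  obtain a where a: "A = opsum N I (\<lambda>b. a b \<cdot>\<^sub>m T b)"
    using ob A by (auto simp: orthonormal_op_basis_def)
  have ab: "hs (T b) A = a b" if "b \<in> I" for b
    unfolding a using ob_coeff[OF that order_refl] that by simp
  show ?thesis unfolding opsum_def
  proof (rule eq_matI)
    fix r c assume "r < dim_row (mat N N (\<lambda>(r, c). \<Sum>b\<in>I. (hs (T b) A \<cdot>\<^sub>m T b) $$ (r, c)))"
      "c < dim_col (mat N N (\<lambda>(r, c). \<Sum>b\<in>I. (hs (T b) A \<cdot>\<^sub>m T b) $$ (r, c)))"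
    then show "A $$ (r, c) = mat N N (\<lambda>(r, c). \<Sum>b\<in>I. (hs (T b) A \<cdot>\<^sub>m T b) $$ (r, c)) $$ (r, c)"
      by (subst a) (auto simp: ab intro!: sum.cong)
  qed (use A in auto)
qed

lemma ob_parseval:
  assumes A: "A \<in> carrier_mat N N" and B: "B \<in> carrier_mat N N"
  shows "hs A B = (\<Sum>b\<in>I. hs A (T b) * hs (T b) B)"
proof -
  have "hs A B = hs A (opsum N I (\<lambda>b. hs (T b) B \<cdot>\<^sub>m T b))" using ob_expand[OF B] by simp
  also have "\<dots> = (\<Sum>b\<in>I. hs A (hs (T b) B \<cdot>\<^sub>m T b))"
    using ob_carrier by (intro hs_opsum_right A) auto
  also have "\<dots> = (\<Sum>b\<in>I. hs A (T b) * hs (T b) B)"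
    using ob_carrier A by (auto simp: mult.commute intro!: sum.cong)
  finally show ?thesis .
qed

lemma ob_norm:
  assumes A: "A \<in> carrier_mat N N"
  shows "(\<Sum>b\<in>I. (cmod (hs (T b) A))\<^sup>2) = (hs_norm A)\<^sup>2"
proof -
  have "complex_of_real (\<Sum>b\<in>I. (cmod (hs (T b) A))\<^sup>2) = (\<Sum>b\<in>I. hs A (T b) * hs (T b) A)"
    unfolding of_real_sum complex_norm_square
    using hs_cnj[OF ob_carrier A] by (auto intro!: sum.cong)
  also have "\<dots> = hs A A" using ob_parseval[OF A A] by simp
  finally show ?thesis unfolding hs_self[OF A] of_real_eq_iff .
qed

end

text \<open>Operator norm of \<open>B\<close> at most \<open>c\<close>, tested on the sesquilinear
  form; this is the shape in which a sum over Kraus operators can be estimated by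
  Cauchy-Schwarz.\<close>

definition bounded_form :: "nat \<Rightarrow> real \<Rightarrow> complex mat \<Rightarrow> bool" where
  "bounded_form N c B \<longleftrightarrow> (\<forall>u v. cmod (\<Sum>r<N. \<Sum>s<N. cnj (u r) * B $$ (r, s) * v s)
     \<le> c * L2_set (\<lambda>r. cmod (u r)) {..<N} * L2_set (\<lambda>r. cmod (v r)) {..<N})"

text \<open>A crude constant suffices: later only boundedness along an iteration matters.\<close>

lemma bounded_form_exists: "bounded_form N (\<Sum>r<N. \<Sum>s<N. cmod (B $$ (r, s))) B"
  unfolding bounded_form_def
proof (intro allI)
  fix u v :: "nat \<Rightarrow> complex"
  let ?u = "L2_set (\<lambda>r. cmod (u r)) {..<N}" and ?v = "L2_set (\<lambda>r. cmod (v r)) {..<N}"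
  have "cmod (\<Sum>r<N. \<Sum>s<N. cnj (u r) * B $$ (r, s) * v s)
    \<le> (\<Sum>r<N. \<Sum>s<N. cmod (u r) * cmod (B $$ (r, s)) * cmod (v s))"
    by (rule order_trans[OF norm_sum] sum_mono | simp add: norm_mult)+
  also have "\<dots> \<le> (\<Sum>r<N. \<Sum>s<N. ?u * cmod (B $$ (r, s)) * ?v)"
    by (intro sum_mono mult_mono member_le_L2_set) (auto intro: mult_nonneg_nonneg)
  also have "\<dots> = (\<Sum>r<N. \<Sum>s<N. cmod (B $$ (r, s))) * ?u * ?v"
    by (simp add: sum_distrib_left sum_distrib_right mult_ac)
  finally show "cmod (\<Sum>r<N. \<Sum>s<N. cnj (u r) * B $$ (r, s) * v s)
    \<le> (\<Sum>r<N. \<Sum>s<N. cmod (B $$ (r, s))) * ?u * ?v" .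
qed

text \<open>Testing the form on two unit vectors returns the entry.\<close>

lemma bounded_form_entry:
  assumes "bounded_form N c B" "r < N" "s < N"
  shows "cmod (B $$ (r, s)) \<le> c"
proof -
  let ?e = "\<lambda>i j. if j = i then 1 else 0 :: complex"
  have d: "(if P then 1 else 0) * z = (if P then z else 0)" "z * (if P then 1 else 0) = (if P then z else 0)"
    "(if P then 1 else 0)\<^sup>2 = (if P then 1 else 0 :: real)" for P and z :: complex
    by auto
  have L: "L2_set (\<lambda>j. cmod (?e i j)) {..<N} = 1" if "i < N" for i
  proof -
    have "(cmod (?e i j))\<^sup>2 = (if j = i then 1 else 0)" for j by simp
    then show ?thesis unfolding L2_set_def using that by (simp only:) simp
  qed
  have "(\<Sum>i<N. \<Sum>j<N. cnj (?e r i) * B $$ (i, j) * ?e s j) = (\<Sum>i<N. cnj (?e r i) * B $$ (i, s))"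
    using assms(3) by (intro sum.cong) (auto simp: d)
  also have "\<dots> = (\<Sum>i<N. if i = r then B $$ (i, s) else 0)" by (intro sum.cong) auto
  also have "\<dots> = B $$ (r, s)" using assms(2) by simp
  finally have "(\<Sum>i<N. \<Sum>j<N. cnj (?e r i) * B $$ (i, j) * ?e s j) = B $$ (r, s)" .
  then show ?thesis using assms(1)[unfolded bounded_form_def, rule_format, of "?e r" "?e s"] L assms by simp
qed

text \<open>
  The unital Heisenberg-picture adjoint of a channel does not increase the operator norm; this is
  what bounds all eigenvalues by one.
\<close>

lemma channel_adjoint:
  assumes E: "quantum_channel N E"
  obtains E' where "\<And>A. A \<in> carrier_mat N N \<Longrightarrow> E A \<in> carrier_mat N N"
    "\<And>B. B \<in> carrier_mat N N \<Longrightarrow> E' B \<in> carrier_mat N N"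
    "\<And>A B. A \<in> carrier_mat N N \<Longrightarrow> B \<in> carrier_mat N N \<Longrightarrow> hs (E' B) A = hs B (E A)"
    "\<And>B c. B \<in> carrier_mat N N \<Longrightarrow> bounded_form N c B \<Longrightarrow> c \<ge> 0 \<Longrightarrow> bounded_form N c (E' B)"
proof -
  obtain m :: nat and K where K: "\<And>k. k < m \<Longrightarrow> K k \<in> carrier_mat N N"
    and tp: "opsum N {..<m} (\<lambda>k. mat_adjoint (K k) * K k) = 1\<^sub>m N"
    and EK: "\<And>A. A \<in> carrier_mat N N \<Longrightarrow> E A = opsum N {..<m} (\<lambda>k. conj_by (K k) A)"
    using E by (auto simp: quantum_channel_def)
  define E' where "E' B = opsum N {..<m} (\<lambda>k. conj_by (mat_adjoint (K k)) B)" for B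
  have 1: "hs (E' B) A = hs B (E A)" if A: "A \<in> carrier_mat N N" and B: "B \<in> carrier_mat N N" for A B
  proof -
    have "hs (E' B) A = (\<Sum>k<m. hs (conj_by (mat_adjoint (K k)) B) A)"
      unfolding E'_def using K A B by (intro hs_opsum_left) auto
    also have "\<dots> = (\<Sum>k<m. hs B (conj_by (K k) A))"
      using hs_conj_by[OF K A B] by simp
    also have "\<dots> = hs B (E A)"
      unfolding EK[OF A] using K A B by (intro hs_opsum_right[symmetric]) auto
    finally show ?thesis .
  qed
  define Kv where "Kv k u x = (\<Sum>r<N. K k $$ (x, r) * u r)" for k and u :: "nat \<Rightarrow> complex" and x
  have tp': "(\<Sum>k<m. \<Sum>x<N. cnj (K k $$ (x, r)) * K k $$ (x, s)) = (if r = s then 1 else 0)"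
    if "r < N" "s < N" for r s
  proof -
    have "(\<Sum>k<m. \<Sum>x<N. cnj (K k $$ (x, r)) * K k $$ (x, s)) = (\<Sum>k<m. (mat_adjoint (K k) * K k) $$ (r, s))"
    proof (intro sum.cong refl)
      fix k assume "k \<in> {..<m}"
      then have Kk: "K k \<in> carrier_mat N N" using K by auto
      have "dim_row (mat_adjoint (K k)) = N" "dim_col (mat_adjoint (K k)) = N"
        using adjoint_carrier[OF Kk] by auto
      then show "(\<Sum>x<N. cnj (K k $$ (x, r)) * K k $$ (x, s)) = (mat_adjoint (K k) * K k) $$ (r, s)"
        using Kk that by (simp add: scalar_prod_def atLeast0LessThan)
    qed
    also have "\<dots> = (1\<^sub>m N :: complex mat) $$ (r, s)" using that unfolding tp[symmetric] by simp
    finally show ?thesis using that by simp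
  qed
  \<comment> \<open>\<open>Kv k u\<close> is the k-th Kraus operator applied to \<open>u\<close>.
    Trace preservation says that sending \<open>u\<close> to the tuple of all \<open>Kv k u\<close>
    is an isometry.\<close>
  have iso: "(\<Sum>k<m. (L2_set (\<lambda>x. cmod (Kv k u x)) {..<N})\<^sup>2) = (L2_set (\<lambda>r. cmod (u r)) {..<N})\<^sup>2" for u
  proof -
    have "complex_of_real (\<Sum>k<m. (L2_set (\<lambda>x. cmod (Kv k u x)) {..<N})\<^sup>2)
      = (\<Sum>k<m. \<Sum>x<N. Kv k u x * cnj (Kv k u x))"
      by (simp add: L2_set_def sum_nonneg complex_norm_square del: of_real_power)
    also have "\<dots> = (\<Sum>k<m. \<Sum>x<N. \<Sum>r<N. \<Sum>s<N. cnj (u r) * u s * (cnj (K k $$ (x, r)) * K k $$ (x, s)))"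
      unfolding Kv_def
      by (subst (1) mult.commute, unfold cnj_sum sum_product) (simp add: mult_ac)
    also have "\<dots> = (\<Sum>k<m. \<Sum>r<N. \<Sum>x<N. \<Sum>s<N. cnj (u r) * u s * (cnj (K k $$ (x, r)) * K k $$ (x, s)))"
      by (intro sum.cong refl sum.swap)
    also have "\<dots> = (\<Sum>k<m. \<Sum>r<N. \<Sum>s<N. \<Sum>x<N. cnj (u r) * u s * (cnj (K k $$ (x, r)) * K k $$ (x, s)))"
      by (intro sum.cong refl sum.swap)
    also have "\<dots> = (\<Sum>r<N. \<Sum>k<m. \<Sum>s<N. \<Sum>x<N. cnj (u r) * u s * (cnj (K k $$ (x, r)) * K k $$ (x, s)))"
      by (rule sum.swap)
    also have "\<dots> = (\<Sum>r<N. \<Sum>s<N. \<Sum>k<m. \<Sum>x<N. cnj (u r) * u s * (cnj (K k $$ (x, r)) * K k $$ (x, s)))"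
      by (intro sum.cong refl sum.swap)
    also have "\<dots> = (\<Sum>r<N. \<Sum>s<N. cnj (u r) * u s * (if r = s then 1 else 0))"
      unfolding sum_distrib_left[symmetric] by (intro sum.cong refl) (simp add: tp')
    also have "\<dots> = (\<Sum>r<N. u r * cnj (u r))"
      by (intro sum.cong refl) (auto simp: if_distrib sum.delta mult.commute cong: if_cong)
    also have "\<dots> = complex_of_real ((L2_set (\<lambda>r. cmod (u r)) {..<N})\<^sup>2)"
      by (simp add: L2_set_def sum_nonneg complex_norm_square del: of_real_power)
    finally show ?thesis unfolding of_real_eq_iff .
  qed
  have iso': "L2_set (\<lambda>k. L2_set (\<lambda>x. cmod (Kv k w x)) {..<N}) {..<m} = L2_set (\<lambda>r. cmod (w r)) {..<N}" for w
    unfolding L2_set_def[of "\<lambda>k. L2_set (\<lambda>x. cmod (Kv k w x)) {..<N}"] iso by simp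
  have 2: "bounded_form N c (E' B)" if B: "B \<in> carrier_mat N N" and bf: "bounded_form N c B" and c: "c \<ge> 0" for B c
    unfolding bounded_form_def
  proof (intro allI)
    fix u v :: "nat \<Rightarrow> complex"
    let ?l = "\<lambda>u k. L2_set (\<lambda>x. cmod (Kv k u x)) {..<N}"
    have "(\<Sum>r<N. \<Sum>s<N. cnj (u r) * E' B $$ (r, s) * v s)
      = (\<Sum>r<N. \<Sum>s<N. \<Sum>k<m. \<Sum>x<N. \<Sum>y<N. cnj (u r) * (cnj (K k $$ (x, r)) * B $$ (x, y) * K k $$ (y, s)) * v s)"
    proof (intro sum.cong refl)
      fix r s assume rs: "r \<in> {..<N}" "s \<in> {..<N}"
      have "E' B $$ (r, s) = (\<Sum>k<m. conj_by (mat_adjoint (K k)) B $$ (r, s))"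
        unfolding E'_def using rs by simp
      also have "\<dots> = (\<Sum>k<m. \<Sum>x<N. \<Sum>y<N. cnj (K k $$ (x, r)) * B $$ (x, y) * K k $$ (y, s))"
        using rs B adjoint_carrier[OF K] adjoint_index[OF K]
        by (auto simp: conj_by_index[of _ N] intro!: sum.cong)
      finally show "cnj (u r) * E' B $$ (r, s) * v s = (\<Sum>k<m. \<Sum>x<N. \<Sum>y<N. cnj (u r) * (cnj (K k $$ (x, r)) * B $$ (x, y) * K k $$ (y, s)) * v s)"
        by (simp add: sum_distrib_left sum_distrib_right)
    qed
    also have "\<dots> = (\<Sum>r<N. \<Sum>k<m. \<Sum>s<N. \<Sum>x<N. \<Sum>y<N. cnj (u r) * (cnj (K k $$ (x, r)) * B $$ (x, y) * K k $$ (y, s)) * v s)"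
      by (intro sum.cong refl sum.swap)
    also have "\<dots> = (\<Sum>k<m. \<Sum>r<N. \<Sum>s<N. \<Sum>x<N. \<Sum>y<N. cnj (u r) * (cnj (K k $$ (x, r)) * B $$ (x, y) * K k $$ (y, s)) * v s)"
      by (rule sum.swap)
    also have "\<dots> = (\<Sum>k<m. \<Sum>r<N. \<Sum>x<N. \<Sum>s<N. \<Sum>y<N. cnj (u r) * (cnj (K k $$ (x, r)) * B $$ (x, y) * K k $$ (y, s)) * v s)"
      by (intro sum.cong refl sum.swap)
    also have "\<dots> = (\<Sum>k<m. \<Sum>x<N. \<Sum>r<N. \<Sum>s<N. \<Sum>y<N. cnj (u r) * (cnj (K k $$ (x, r)) * B $$ (x, y) * K k $$ (y, s)) * v s)"
      by (intro sum.cong refl sum.swap)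
    also have "\<dots> = (\<Sum>k<m. \<Sum>x<N. \<Sum>r<N. \<Sum>y<N. \<Sum>s<N. cnj (u r) * (cnj (K k $$ (x, r)) * B $$ (x, y) * K k $$ (y, s)) * v s)"
      by (intro sum.cong refl sum.swap)
    also have "\<dots> = (\<Sum>k<m. \<Sum>x<N. \<Sum>y<N. \<Sum>r<N. \<Sum>s<N. cnj (u r) * (cnj (K k $$ (x, r)) * B $$ (x, y) * K k $$ (y, s)) * v s)"
      by (intro sum.cong refl sum.swap)
    also have "\<dots> = (\<Sum>k<m. \<Sum>x<N. \<Sum>y<N. cnj (Kv k u x) * B $$ (x, y) * Kv k v y)"
    proof (intro sum.cong refl)
      fix k x y
      have "cnj (Kv k u x) * B $$ (x, y) * Kv k v y = B $$ (x, y) * (\<Sum>r<N. \<Sum>s<N. (cnj (K k $$ (x, r)) * cnj (u r)) * (K k $$ (y, s) * v s))"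
        unfolding Kv_def cnj_sum sum_product[symmetric] by simp
      also have "\<dots> = (\<Sum>r<N. \<Sum>s<N. cnj (u r) * (cnj (K k $$ (x, r)) * B $$ (x, y) * K k $$ (y, s)) * v s)"
        by (simp add: sum_distrib_left mult_ac)
      finally show "(\<Sum>r<N. \<Sum>s<N. cnj (u r) * (cnj (K k $$ (x, r)) * B $$ (x, y) * K k $$ (y, s)) * v s) = cnj (Kv k u x) * B $$ (x, y) * Kv k v y"
        by simp
    qed
    finally have "cmod (\<Sum>r<N. \<Sum>s<N. cnj (u r) * E' B $$ (r, s) * v s)
      \<le> (\<Sum>k<m. cmod (\<Sum>x<N. \<Sum>y<N. cnj (Kv k u x) * B $$ (x, y) * Kv k v y))"
      by (simp add: norm_sum)
    also have "\<dots> \<le> (\<Sum>k<m. c * ?l u k * ?l v k)"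
      by (intro sum_mono bf[unfolded bounded_form_def, rule_format])
    also have "\<dots> = c * (\<Sum>k<m. \<bar>?l u k\<bar> * \<bar>?l v k\<bar>)"
      by (simp add: sum_distrib_left mult.assoc)
    \<comment> \<open>Cauchy-Schwarz over the Kraus index; the isometry then collapses both
      factors.\<close>
    also have "\<dots> \<le> c * (L2_set (?l u) {..<m} * L2_set (?l v) {..<m})"
      using c by (intro mult_left_mono L2_set_mult_ineq)
    also have "\<dots> = c * L2_set (\<lambda>r. cmod (u r)) {..<N} * L2_set (\<lambda>r. cmod (v r)) {..<N}"
      by (simp add: iso')
    finally show "cmod (\<Sum>r<N. \<Sum>s<N. cnj (u r) * E' B $$ (r, s) * v s)
      \<le> c * L2_set (\<lambda>r. cmod (u r)) {..<N} * L2_set (\<lambda>r. cmod (v r)) {..<N}" .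
  qed
  have c: "E A \<in> carrier_mat N N" if "A \<in> carrier_mat N N" for A using EK[OF that] by simp
  have c': "E' B \<in> carrier_mat N N" for B by (simp add: E'_def)
  show thesis by (rule that[OF c c' 1 2])
qed

text \<open>Pairing the n-th Heisenberg iterate of \<open>T\<close> with \<open>T\<close> gives
  \<open>e ^ n\<close>, while the form bound of the iterate stays that of \<open>T\<close>. The
  powers of \<open>e\<close> are therefore bounded. The Hilbert-Schmidt norm could not take the
  place of the form bound, since the dual of a non-unital channel can increase it.\<close>

lemma channel_eigenvalue_le_1:
  assumes E: "quantum_channel N E" and T: "T \<in> carrier_mat N N" "hs T T = 1" and ev: "E T = e \<cdot>\<^sub>m T"
  shows "cmod e \<le> 1"
proof (rule ccontr)
  assume "\<not> cmod e \<le> 1"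
  then have e1: "1 < cmod e" by simp
  obtain E' where E': "\<And>B. B \<in> carrier_mat N N \<Longrightarrow> E' B \<in> carrier_mat N N"
    "\<And>A B. A \<in> carrier_mat N N \<Longrightarrow> B \<in> carrier_mat N N \<Longrightarrow> hs (E' B) A = hs B (E A)"
    "\<And>B c. B \<in> carrier_mat N N \<Longrightarrow> bounded_form N c B \<Longrightarrow> c \<ge> 0 \<Longrightarrow> bounded_form N c (E' B)"
    using channel_adjoint[OF E] by metis
  define c where "c = (\<Sum>r<N. \<Sum>s<N. cmod (T $$ (r, s)))"
  have c0: "c \<ge> 0" unfolding c_def by (intro sum_nonneg) auto
  have it: "(E' ^^ n) T \<in> carrier_mat N N \<and> bounded_form N c ((E' ^^ n) T) \<and> hs ((E' ^^ n) T) T = e ^ n" for n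
  proof (induction n)
    case 0
    then show ?case using T bounded_form_exists[of N T] by (simp add: c_def)
  next
    case (Suc n)
    have "hs (E' ((E' ^^ n) T)) T = e * hs ((E' ^^ n) T) T"
      using E'(2)[of T "(E' ^^ n) T"] Suc T ev hs_smult_right[of "(E' ^^ n) T" N T e] by simp
    then show ?case using Suc E' c0 by simp
  qed
  have "cmod e ^ n \<le> c * c" for n
  proof -
    have "cmod e ^ n = cmod (hs ((E' ^^ n) T) T)" using it[of n] by (simp add: norm_power)
    also have "\<dots> \<le> (\<Sum>r<N. \<Sum>s<N. cmod ((E' ^^ n) T $$ (r, s)) * cmod (T $$ (r, s)))"
      unfolding hs_eq[OF conjunct1[OF it[of n]] T(1)]
      by (rule order_trans[OF norm_sum] sum_mono | simp add: norm_mult)+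
    also have "\<dots> \<le> (\<Sum>r<N. \<Sum>s<N. c * cmod (T $$ (r, s)))"
      using bounded_form_entry[of N c "(E' ^^ n) T"] it[of n]
      by (intro sum_mono mult_right_mono) auto
    also have "\<dots> = c * c" unfolding c_def by (simp add: sum_distrib_left)
    finally show ?thesis .
  qed
  then show False using real_arch_pow[OF e1, of "c * c"] by (meson not_le)
qed

section \<open>Path sums\<close>

text \<open>Product of transfer matrices applied to the final vector \<open>z\<close>, with the
  summation at slot m restricted to \<open>\<Lambda> m\<close>. The label at slot i is an argument,
  so only the index sets after i enter.\<close>

definition chain ::
    "nat \<Rightarrow> (nat \<Rightarrow> 'b set) \<Rightarrow> (nat \<Rightarrow> 'b \<Rightarrow> 'b \<Rightarrow> complex) \<Rightarrow> ('b \<Rightarrow> complex) \<Rightarrow> nat \<Rightarrow> 'b \<Rightarrow> complex"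
  where "chain D \<Lambda> A z i = foldr (\<lambda>m v b. \<Sum>c\<in>\<Lambda> (Suc m). A m b c * v c) [i..<Suc D] z"

lemma chain_end [simp]: "chain D \<Lambda> A z (Suc D) = z"
  by (simp add: chain_def)

lemma chain_step:
  "i \<le> D \<Longrightarrow> chain D \<Lambda> A z i b = (\<Sum>c\<in>\<Lambda> (Suc i). A i b c * chain D \<Lambda> A z (Suc i) c)"
  unfolding chain_def by (subst upt_conv_Cons) auto

lemma chain_cong:
  assumes "i \<le> Suc D" "\<And>m. i < m \<Longrightarrow> m \<le> Suc D \<Longrightarrow> \<Lambda> m = \<Lambda>' m"
  shows "chain D \<Lambda> A z i = chain D \<Lambda>' A z i"
  using assms
proof (induction i rule: inc_induct)
  case (step i)
  then have "chain D \<Lambda> A z (Suc i) = chain D \<Lambda>' A z (Suc i)" by auto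
  then show ?case using step by (auto simp: chain_step)
qed auto

lemma sum_PiE_insert:
  assumes "x \<notin> S"
  shows "(\<Sum>B\<in>Pi\<^sub>E (insert x S) \<Lambda>. F B) = (\<Sum>b\<in>\<Lambda> x. \<Sum>B\<in>Pi\<^sub>E S \<Lambda>. F (B(x := b)))"
proof -
  have "(\<Sum>B\<in>Pi\<^sub>E (insert x S) \<Lambda>. F B) = (\<Sum>p\<in>\<Lambda> x \<times> Pi\<^sub>E S \<Lambda>. F ((snd p)(x := fst p)))"
    unfolding PiE_insert_eq
    by (subst sum.reindex[OF inj_combinator[OF assms]]) (simp add: case_prod_beta comp_def)
  also have "\<dots> = (\<Sum>b\<in>\<Lambda> x. \<Sum>B\<in>Pi\<^sub>E S \<Lambda>. F (B(x := b)))"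
    by (simp add: sum.cartesian_product case_prod_beta)
  finally show ?thesis .
qed

text \<open>Distributivity, slot by slot. The function \<open>h\<close> varies in the induction
  because peeling off slot i turns the matrix element \<open>A i b\<close> into the \<open>h\<close>
  of the next slot.\<close>

lemma chain_paths:
  fixes \<Lambda> :: "nat \<Rightarrow> 'b set"
  assumes "i \<le> Suc D"
  shows "(\<Sum>B\<in>Pi\<^sub>E {i..Suc D} \<Lambda>. h (B i) * (\<Prod>m\<in>{i..D}. A m (B m) (B (Suc m))) * z (B (Suc D)))
    = (\<Sum>b\<in>\<Lambda> i. h b * chain D \<Lambda> A z i b)"
  using assms
proof (induction i arbitrary: h rule: inc_induct)
  case base
  have e: "{Suc D..Suc D} = insert (Suc D) {}" by auto
  show ?case unfolding e by (subst sum_PiE_insert) auto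
next
  case (step i)
  have ins: "{i..Suc D} = insert i {Suc i..Suc D}" and ins': "{i..D} = insert i {Suc i..D}"
    using step by auto
  have "(\<Sum>B\<in>Pi\<^sub>E {i..Suc D} \<Lambda>. h (B i) * (\<Prod>m\<in>{i..D}. A m (B m) (B (Suc m))) * z (B (Suc D)))
    = (\<Sum>b\<in>\<Lambda> i. \<Sum>B\<in>Pi\<^sub>E {Suc i..Suc D} \<Lambda>. h b * (A i b (B (Suc i)) * (\<Prod>m\<in>{Suc i..D}. A m (B m) (B (Suc m))) * z (B (Suc D))))"
    unfolding ins
  proof (subst sum_PiE_insert, simp, intro sum.cong refl)
    fix b :: 'b and B :: "nat \<Rightarrow> 'b"
    let ?B = "B(i := b)"
    have "(\<Prod>m\<in>{i..D}. A m (?B m) (?B (Suc m))) = A i b (B (Suc i)) * (\<Prod>m\<in>{Suc i..D}. A m (?B m) (?B (Suc m)))"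
      unfolding ins' by (subst prod.insert) auto
    also have "(\<Prod>m\<in>{Suc i..D}. A m (?B m) (?B (Suc m))) = (\<Prod>m\<in>{Suc i..D}. A m (B m) (B (Suc m)))"
      by (intro prod.cong) auto
    finally show "h (?B i) * (\<Prod>m\<in>{i..D}. A m (?B m) (?B (Suc m))) * z (?B (Suc D))
      = h b * (A i b (B (Suc i)) * (\<Prod>m\<in>{Suc i..D}. A m (B m) (B (Suc m))) * z (B (Suc D)))"
      using step by (simp add: mult_ac)
  qed
  also have "\<dots> = (\<Sum>b\<in>\<Lambda> i. h b * (\<Sum>c\<in>\<Lambda> (Suc i). A i b c * chain D \<Lambda> A z (Suc i) c))"
    unfolding sum_distrib_left[symmetric] step.IH[of "A i _"] ..
  also have "\<dots> = (\<Sum>b\<in>\<Lambda> i. h b * chain D \<Lambda> A z i b)"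
    using step by (auto simp: chain_step)
  finally show ?case .
qed

lemma sum_Pow_insert:
  assumes "finite A" "x \<notin> A"
  shows "(\<Sum>S\<in>Pow (insert x A). f S) = (\<Sum>S\<in>Pow A. f S + f (insert x S))"
proof -
  have "(\<Sum>S\<in>Pow (insert x A). f S) = (\<Sum>S\<in>Pow A. f S) + (\<Sum>S\<in>insert x ` Pow A. f S)"
    unfolding Pow_insert using assms by (intro sum.union_disjoint) auto
  also have "(\<Sum>S\<in>insert x ` Pow A. f S) = (\<Sum>S\<in>Pow A. f (insert x S))"
    using assms by (intro sum.reindex_cong[of "insert x"]) (auto simp: inj_on_def)
  finally show ?thesis by (simp add: sum.distrib)
qed

section \<open>One circuit layer in the adapted bases\<close>

locale noisy_circuit =
  fixes N :: nat and X :: "('g, 'z) circuit_scheme"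
  assumes N_pos: "N > 0"
    and circ: "is_circuit N X"
    and obs: "observable N (obsv X)"
    and adapted: "symmetry_adapted N X"
    and noisy: "noise_penalisation N X"
begin

abbreviation "D \<equiv> depth X"
abbreviation "T \<equiv> tens X"
abbreviation "I \<equiv> labels X"
abbreviation "W i \<equiv> conj_by (gate X i)"

lemma obs_carrier [simp]: "obsv X \<in> carrier_mat N N"
  using obs by (simp add: observable_def)

lemma op_basis: "1 \<le> i \<Longrightarrow> i \<le> Suc D \<Longrightarrow> orthonormal_op_basis N (I i) (T i)"
  using adapted by (simp add: symmetry_adapted_def)

lemma T_carrier [simp]: "1 \<le> i \<Longrightarrow> i \<le> Suc D \<Longrightarrow> b \<in> I i \<Longrightarrow> T i b \<in> carrier_mat N N"
  by (rule ob_carrier[OF op_basis])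

lemma I_finite [simp]: "1 \<le> i \<Longrightarrow> i \<le> Suc D \<Longrightarrow> finite (I i)"
  by (rule ob_finite[OF op_basis])

lemma gate_unitary: "1 \<le> i \<Longrightarrow> i \<le> D \<Longrightarrow> unitary_mat N (gate X i)"
  using circ by (simp add: is_circuit_def)

lemma gate_carrier [simp]: "1 \<le> i \<Longrightarrow> i \<le> D \<Longrightarrow> gate X i \<in> carrier_mat N N"
  using gate_unitary by (simp add: unitary_mat_def)

lemma rep_unitary: "1 \<le> i \<Longrightarrow> i \<le> D \<Longrightarrow> \<gamma> \<in> carrier (grp X) \<Longrightarrow> unitary_mat N (rep X i \<gamma>)"
  using circ by (simp add: is_circuit_def unitary_rep_def)

lemma rep_carrier [simp]: "1 \<le> i \<Longrightarrow> i \<le> D \<Longrightarrow> \<gamma> \<in> carrier (grp X) \<Longrightarrow> rep X i \<gamma> \<in> carrier_mat N N"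
  using rep_unitary by (simp add: unitary_mat_def)

lemma noise_carrier [simp]: "A \<in> carrier_mat N N \<Longrightarrow> noise X A \<in> carrier_mat N N"
  using noisy channel_adjoint[of N "noise X"] unfolding noise_penalisation_def by metis

lemma noise_neig:
  "1 \<le> i \<Longrightarrow> i \<le> D \<Longrightarrow> b \<in> I i \<Longrightarrow> noise X (T i b) = neig X i b \<cdot>\<^sub>m T i b"
  using noisy unfolding noise_penalisation_def by auto

lemma neig_trivial: "1 \<le> i \<Longrightarrow> i \<le> D \<Longrightarrow> b \<in> I i \<Longrightarrow> irrep_of b = 0 \<Longrightarrow> neig X i b = 1"
  using noisy unfolding noise_penalisation_def by auto

text \<open>The bound by one minus the gap is the noise assumption; the bound by one holds because
  the basis operator is a normalised eigenvector of a channel. The expression on the right is the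
  later damping factor \<open>q\<close>.\<close>

lemma neig_nontrivial:
  "1 \<le> i \<Longrightarrow> i \<le> D \<Longrightarrow> b \<in> I i \<Longrightarrow> irrep_of b \<noteq> 0 \<Longrightarrow>
    cmod (neig X i b) \<le> min 1 (max 0 (1 - spectral_gap N (noise X)))"
proof -
  assume i: "1 \<le> i" "i \<le> D" and b: "b \<in> I i" "irrep_of b \<noteq> 0"
  have "cmod (neig X i b) \<le> 1"
    using noisy i b ob_orth[OF op_basis, of i b b]
    by (intro channel_eigenvalue_le_1[of N "noise X" "T i b"]) (auto simp: noise_penalisation_def noise_neig)
  moreover have "cmod (neig X i b) \<le> 1 - spectral_gap N (noise X)"
    using noisy i b unfolding noise_penalisation_def by auto
  ultimately show ?thesis by simp
qed

text \<open>The eigenvalue equation is known on basis operators only. Expanding the dual image of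
  \<open>T i b\<close> moves the channel back onto basis operators, where orthonormality leaves the
  single term c = b.\<close>

lemma noise_coeff:
  assumes i: "1 \<le> i" "i \<le> D" and b: "b \<in> I i" and Y: "Y \<in> carrier_mat N N"
  shows "hs (T i b) (noise X Y) = neig X i b * hs (T i b) Y"
proof -
  have ob: "orthonormal_op_basis N (I i) (T i)" using i op_basis by simp
  have Tc: "T i c \<in> carrier_mat N N" if "c \<in> I i" for c using i that by simp
  obtain E' where E': "\<And>B. B \<in> carrier_mat N N \<Longrightarrow> E' B \<in> carrier_mat N N"
    "\<And>A B. A \<in> carrier_mat N N \<Longrightarrow> B \<in> carrier_mat N N \<Longrightarrow> hs (E' B) A = hs B (noise X A)"
    using noisy channel_adjoint[of N "noise X"] unfolding noise_penalisation_def by metis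
  have "hs (T i b) (noise X Y) = hs (E' (T i b)) Y" using E' Tc b Y by simp
  also have "\<dots> = (\<Sum>c\<in>I i. hs (E' (T i b)) (T i c) * hs (T i c) Y)"
    using E' Tc b Y by (intro ob_parseval[OF ob]) auto
  also have "\<dots> = (\<Sum>c\<in>I i. if c = b then neig X i c * hs (T i c) Y else 0)"
    using E' Tc b i
    by (intro sum.cong) (auto simp: noise_neig hs_smult_right[of _ N] ob_orth[OF ob])
  also have "\<dots> = neig X i b * hs (T i b) Y" using b i by simp
  finally show ?thesis .
qed

lemma label_dim: "(l, a, k) \<in> I i \<Longrightarrow> k' < irdim X i l \<Longrightarrow> (l, a, k') \<in> I i"
  by (auto simp: labels_def)

text \<open>Conjugation by a group element is block diagonal: it keeps irrep and multiplicity and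
  mixes only rows. Hence row \<open>(l, a, k)\<close> of its matrix lives on the block of
  \<open>(l, a)\<close>.\<close>

lemma rep_coeff:
  assumes i: "1 \<le> i" "i \<le> D" and b: "(l, a, k) \<in> I i" and Z: "Z \<in> carrier_mat N N"
    and \<gamma>: "\<gamma> \<in> carrier (grp X)"
  shows "hs (T i (l, a, k)) (conj_by (rep X i \<gamma>) Z)
    = (\<Sum>k'<irdim X i l. mcoef X i l \<gamma> $$ (k, k') * hs (T i (l, a, k')) Z)"
proof -
  have ob: "orthonormal_op_basis N (I i) (T i)" using i op_basis by simp
  have Tc: "T i c \<in> carrier_mat N N" if "c \<in> I i" for c using i that by simp
  have U: "rep X i \<gamma> \<in> carrier_mat N N" using i \<gamma> by simp
  let ?b = "(l, a, k)"
  have col: "hs (T i ?b) (conj_by (rep X i \<gamma>) (T i c)) =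
      (if c \<in> Pair l ` Pair a ` {..<irdim X i l} then mcoef X i l \<gamma> $$ (k, snd (snd c)) else 0)" if c: "c \<in> I i" for c
  proof -
    obtain l' a' k' where c': "c = (l', a', k')" by (cases c)
    have "conj_by (rep X i \<gamma>) (T i c) = opsum N {..<irdim X i l'} (\<lambda>j. mcoef X i l' \<gamma> $$ (j, k') \<cdot>\<^sub>m T i (l', a', j))"
      using adapted i \<gamma> c c' unfolding symmetry_adapted_def by fastforce
    then have "hs (T i ?b) (conj_by (rep X i \<gamma>) (T i c))
      = (\<Sum>j<irdim X i l'. hs (T i ?b) (mcoef X i l' \<gamma> $$ (j, k') \<cdot>\<^sub>m T i (l', a', j)))"
      using Tc b c c' label_dim by (simp only:) (intro hs_opsum_right smult_carrier_mat, auto)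
    also have "\<dots> = (\<Sum>j<irdim X i l'. if (l', a', j) = ?b then mcoef X i l' \<gamma> $$ (j, k') else 0)"
      using Tc b c c' label_dim
      by (intro sum.cong) (auto simp: hs_smult_right[of _ N] ob_orth[OF ob])
    also have "\<dots> = (\<Sum>j<irdim X i l'. if j = k then if l' = l \<and> a' = a then mcoef X i l' \<gamma> $$ (j, k') else 0 else 0)"
      by (intro sum.cong) auto
    also have "\<dots> = (if k < irdim X i l' then if l' = l \<and> a' = a then mcoef X i l' \<gamma> $$ (k, k') else 0 else 0)"
      by simp
    also have "\<dots> = (if c \<in> Pair l ` Pair a ` {..<irdim X i l} then mcoef X i l \<gamma> $$ (k, snd (snd c)) else 0)"
      using b c c' by (auto simp: labels_def)
    finally show ?thesis .
  qed
  have "hs (T i ?b) (conj_by (rep X i \<gamma>) Z) = hs (conj_by (mat_adjoint (rep X i \<gamma>)) (T i ?b)) Z"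
    using hs_conj_by[OF U Z Tc[OF b]] by simp
  also have "\<dots> = (\<Sum>c\<in>I i. hs (conj_by (mat_adjoint (rep X i \<gamma>)) (T i ?b)) (T i c) * hs (T i c) Z)"
    using U Tc b Z by (intro ob_parseval[OF ob]) auto
  also have "\<dots> = (\<Sum>c\<in>I i. hs (T i ?b) (conj_by (rep X i \<gamma>) (T i c)) * hs (T i c) Z)"
    using U Tc b by (simp add: hs_conj_by)
  also have "\<dots> = (\<Sum>c\<in>Pair l ` Pair a ` {..<irdim X i l}. hs (T i ?b) (conj_by (rep X i \<gamma>) (T i c)) * hs (T i c) Z)"
    using i b col by (intro sum.mono_neutral_right) (auto simp: label_dim)
  also have "\<dots> = (\<Sum>k'<irdim X i l. mcoef X i l \<gamma> $$ (k, k') * hs (T i (l, a, k')) Z)"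
    unfolding image_image using label_dim[OF b] col
    by (subst sum.reindex) (auto simp: inj_on_def intro!: sum.cong)
  finally show ?thesis .
qed

text \<open>Variant of \<open>noisy_layer\<close> taking the group element of its own slot instead
  of the whole tuple, so that path amplitudes become products of functions of one group variable
  each.\<close>

definition layer :: "nat \<Rightarrow> 'g \<Rightarrow> complex mat \<Rightarrow> complex mat" where
  "layer i \<gamma> Y = noise X (conj_by (rep X i \<gamma> * gate X i) Y)"

definition transfer :: "nat \<Rightarrow> 'g \<Rightarrow> label \<Rightarrow> label \<Rightarrow> complex" where
  "transfer i \<gamma> b c = hs (T i b) (layer i \<gamma> (T (Suc i) c))"

lemma layer_unitary:
  "1 \<le> i \<Longrightarrow> i \<le> D \<Longrightarrow> \<gamma> \<in> carrier (grp X) \<Longrightarrow> unitary_mat N (rep X i \<gamma> * gate X i)"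
  by (intro unitary_mat_mult rep_unitary gate_unitary)

lemma layer_carrier [simp]:
  "1 \<le> i \<Longrightarrow> i \<le> D \<Longrightarrow> \<gamma> \<in> carrier (grp X) \<Longrightarrow> Y \<in> carrier_mat N N \<Longrightarrow> layer i \<gamma> Y \<in> carrier_mat N N"
  unfolding layer_def using layer_unitary by (simp add: unitary_mat_def)

context
  fixes i \<gamma>
  assumes i: "1 \<le> i" "i \<le> D" and \<gamma>: "\<gamma> \<in> carrier (grp X)"
begin

lemma layer_coeff:
  assumes b: "b \<in> I i" and Y: "Y \<in> carrier_mat N N"
  shows "hs (T i b) (layer i \<gamma> Y) = neig X i b * hs (T i b) (conj_by (rep X i \<gamma> * gate X i) Y)"
  unfolding layer_def
  using noise_coeff[OF i b] layer_unitary[OF i \<gamma>] Y by (simp add: unitary_mat_def)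

lemma layer_coeff':
  assumes b: "(l, a, k) \<in> I i" and Y: "Y \<in> carrier_mat N N"
  shows "hs (T i (l, a, k)) (layer i \<gamma> Y) = neig X i (l, a, k) *
    (\<Sum>k'<irdim X i l. mcoef X i l \<gamma> $$ (k, k') * hs (T i (l, a, k')) (W i Y))"
  using layer_coeff[OF b Y] rep_coeff[OF i b _ \<gamma>, of "W i Y"] i Y \<gamma> conj_by_mult[of "rep X i \<gamma>" N "gate X i" Y]
  by simp

lemma trivial_label:
  assumes b: "b \<in> I i" "irrep_of b = 0"
  shows "irdim X i 0 = 1 \<and> (\<exists>a. b = (0, a, 0)) \<and> mcoef X i 0 \<gamma> $$ (0, 0) = 1"
proof -
  obtain a k where b': "b = (0, a, k)" using b by (cases b) auto
  have "0 \<in> irreps X i" using b b' by (auto simp: labels_def)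
  then have "trivial_rep (grp X) (irdim X i 0) (mcoef X i 0)"
    using adapted i unfolding symmetry_adapted_def by auto
  then have "irdim X i 0 = 1" "mcoef X i 0 \<gamma> = 1\<^sub>m 1" using \<gamma> unfolding trivial_rep_def by auto
  then show ?thesis using b b' by (auto simp: labels_def)
qed

lemma layer_coeff_trivial:
  assumes b: "b \<in> I i" "irrep_of b = 0" and Y: "Y \<in> carrier_mat N N"
  shows "hs (T i b) (layer i \<gamma> Y) = hs (T i b) (W i Y)"
proof -
  obtain a where a: "b = (0, a, 0)" "irdim X i 0 = 1" "mcoef X i 0 \<gamma> $$ (0, 0) = 1"
    using trivial_label[OF b] by blast
  have "(0, a, 0) \<in> I i" "neig X i (0, a, 0) = 1" using a b neig_trivial[OF i b] by auto
  then show ?thesis using layer_coeff'[of 0 a 0, OF _ Y] a by simp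
qed

lemma layer_expand:
  assumes b: "b \<in> I i" and Y: "Y \<in> carrier_mat N N"
  shows "hs (T i b) (layer i \<gamma> Y) = (\<Sum>c\<in>I (Suc i). transfer i \<gamma> b c * hs (T (Suc i) c) Y)"
proof -
  let ?V = "rep X i \<gamma> * gate X i" let ?B = "conj_by (mat_adjoint ?V) (T i b)"
  have V: "?V \<in> carrier_mat N N" using layer_unitary[OF i \<gamma>] by (simp add: unitary_mat_def)
  have Tb: "T i b \<in> carrier_mat N N" using i b by simp
  have "hs (T i b) (layer i \<gamma> Y) = neig X i b * hs ?B Y"
    using layer_coeff[OF b Y] hs_conj_by[OF V Y Tb] by simp
  also have "hs ?B Y = (\<Sum>c\<in>I (Suc i). hs ?B (T (Suc i) c) * hs (T (Suc i) c) Y)"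
    using V Tb Y i by (intro ob_parseval[OF op_basis]) auto
  also have "neig X i b * \<dots> = (\<Sum>c\<in>I (Suc i). transfer i \<gamma> b c * hs (T (Suc i) c) Y)"
    unfolding sum_distrib_left transfer_def using V Tb i b
    by (intro sum.cong) (auto simp: layer_coeff hs_conj_by)
  finally show ?thesis .
qed

text \<open>Splits a layer into a unitary and a damping: \<open>u\<close> lists the coefficients of
  the rotated operator before the noise acts, and Parseval in the bases of both slots identifies the
  norms.\<close>

lemma transfer_norm:
  assumes J: "J \<subseteq> I (Suc i)"
  shows "\<exists>u. (\<forall>b\<in>I i. (\<Sum>c\<in>J. transfer i \<gamma> b c * v c) = neig X i b * u b) \<and>
    (\<Sum>b\<in>I i. (cmod (u b))\<^sup>2) = (\<Sum>c\<in>J. (cmod (v c))\<^sup>2)"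
proof -
  have ob: "orthonormal_op_basis N (I i) (T i)" "orthonormal_op_basis N (I (Suc i)) (T (Suc i))"
    using i op_basis by auto
  define Y where "Y = opsum N J (\<lambda>c. v c \<cdot>\<^sub>m T (Suc i) c)"
  let ?V = "rep X i \<gamma> * gate X i"
  have Y: "Y \<in> carrier_mat N N" by (simp add: Y_def)
  have V: "unitary_mat N ?V" by (rule layer_unitary[OF i \<gamma>])
  then have VY: "conj_by ?V Y \<in> carrier_mat N N" using Y by (simp add: unitary_mat_def)
  have fin: "finite (I (Suc i))" using i by simp
  have cf: "hs (T (Suc i) c) Y = (if c \<in> J then v c else 0)" if "c \<in> I (Suc i)" for c
    unfolding Y_def by (rule ob_coeff[OF ob(2) that J])
  have 1: "(\<Sum>c\<in>J. transfer i \<gamma> b c * v c) = neig X i b * hs (T i b) (conj_by ?V Y)" if b: "b \<in> I i" for b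
  proof -
    have "neig X i b * hs (T i b) (conj_by ?V Y) = (\<Sum>c\<in>I (Suc i). transfer i \<gamma> b c * (if c \<in> J then v c else 0))"
      unfolding layer_coeff[OF b Y, symmetric] layer_expand[OF b Y] by (simp add: cf)
    also have "\<dots> = (\<Sum>c\<in>J. transfer i \<gamma> b c * v c)"
      using fin J by (intro sum.mono_neutral_cong_right) auto
    finally show ?thesis by simp
  qed
  have n: "(hs_norm (conj_by ?V Y))\<^sup>2 = (hs_norm Y)\<^sup>2"
    using hs_self[OF Y] hs_self[OF VY] hs_conj_by_unitary[OF V Y Y] by (metis of_real_eq_iff)
  have "(\<Sum>b\<in>I i. (cmod (hs (T i b) (conj_by ?V Y)))\<^sup>2) = (\<Sum>c\<in>I (Suc i). (cmod (hs (T (Suc i) c) Y))\<^sup>2)"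
    unfolding ob_norm[OF ob(1) VY] ob_norm[OF ob(2) Y] by (rule n)
  also have "\<dots> = (\<Sum>c\<in>J. (cmod (v c))\<^sup>2)"
    using fin J by (intro sum.mono_neutral_cong_right) (auto simp: cf)
  finally show ?thesis using 1 by (intro exI[of _ "\<lambda>b. hs (T i b) (conj_by ?V Y)"]) auto
qed

end

section \<open>Splitting the path sum by the set of non-trivial slots\<close>

text \<open>Slot \<open>D + 1\<close> carries no group, so no operator counts as non-trivial there.\<close>

definition sector :: "nat set \<Rightarrow> nat \<Rightarrow> label set" where
  "sector S m = (if m \<le> D then {b \<in> I m. irrep_of b \<noteq> 0 \<longleftrightarrow> m \<in> S} else I m)"

definition final :: "label \<Rightarrow> complex" where
  "final b = hs (T (Suc D) b) (zero_state N)"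

text \<open>Total amplitude of all continuations after slot i whose non-trivial slots are exactly
  the elements of \<open>S\<close> beyond i. Whether i itself lies in \<open>S\<close> has no
  influence, which the induction on slots exploits.\<close>

definition amps :: "(nat \<Rightarrow> 'g) \<Rightarrow> nat set \<Rightarrow> nat \<Rightarrow> label \<Rightarrow> complex" where
  "amps g S = chain D (sector S) (\<lambda>m. transfer m (g m)) final"

definition part :: "(nat \<Rightarrow> 'g) \<Rightarrow> nat set \<Rightarrow> complex" where
  "part g S = (\<Sum>b\<in>sector S 1. hs (obsv X) (T 1 b) * amps g S 1 b)"

definition nontriv :: "(nat \<Rightarrow> label) \<Rightarrow> nat set" where
  "nontriv B = {i \<in> {1..D}. irrep_of (B i) \<noteq> 0}"

lemma path_amplitude_eq:
  "path_amplitude N X g B = hs (obsv X) (T 1 (B 1)) *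
    (\<Prod>i\<in>{1..D}. transfer i (g i) (B i) (B (Suc i))) * final (B (Suc D))"
  by (simp add: path_amplitude_def transfer_def final_def layer_def noisy_layer_def)

text \<open>Prescribing the set of non-trivial slots is a separate condition at each slot, so these
  paths form a product set; this is what turns a partial sum into a chain.\<close>

lemma paths_nontriv:
  "{B \<in> Pi\<^sub>E {1..Suc D} I. nontriv B = S} = (if S \<subseteq> {1..D} then Pi\<^sub>E {1..Suc D} (sector S) else {})"
proof (cases "S \<subseteq> {1..D}")
  case True
  have "B \<in> Pi\<^sub>E {1..Suc D} I \<and> nontriv B = S \<longleftrightarrow> B \<in> Pi\<^sub>E {1..Suc D} (sector S)" for B
  proof
    assume "B \<in> Pi\<^sub>E {1..Suc D} I \<and> nontriv B = S"
    then show "B \<in> Pi\<^sub>E {1..Suc D} (sector S)" by (auto simp: sector_def nontriv_def PiE_iff)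
  next
    assume B: "B \<in> Pi\<^sub>E {1..Suc D} (sector S)"
    then have "B i \<in> sector S i" if "i \<in> {1..Suc D}" for i using that by auto
    then have "nontriv B = S" using True unfolding nontriv_def sector_def by fastforce
    moreover have "B \<in> Pi\<^sub>E {1..Suc D} I"
      using B by (auto simp: sector_def PiE_iff split: if_splits)
    ultimately show "B \<in> Pi\<^sub>E {1..Suc D} I \<and> nontriv B = S" by simp
  qed
  then show ?thesis using True by auto
qed (auto simp: nontriv_def)

lemma part_paths:
  assumes "S \<subseteq> {1..D}"
  shows "(\<Sum>B\<in>{B \<in> Pi\<^sub>E {1..Suc D} I. nontriv B = S}. path_amplitude N X g B) = part g S"
  unfolding paths_nontriv part_def amps_def using assms
    chain_paths[where i = 1 and D = D and \<Lambda> = "sector S" and h = "\<lambda>b. hs (obsv X) (T 1 b)" and A = "\<lambda>m. transfer m (g m)" and z = final]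
  by (simp add: path_amplitude_eq)

lemma finite_paths: "finite (Pi\<^sub>E {1..Suc D} I)"
  by (intro finite_PiE) auto

lemma paths_by_nontriv:
  "(\<Sum>B\<in>{B \<in> Pi\<^sub>E {1..Suc D} I. P (nontriv B)}. path_amplitude N X g B) = (\<Sum>S\<in>{S \<in> Pow {1..D}. P S}. part g S)"
proof -
  have "(\<Sum>S\<in>{S \<in> Pow {1..D}. P S}. \<Sum>B\<in>{B \<in> {B \<in> Pi\<^sub>E {1..Suc D} I. P (nontriv B)}. nontriv B = S}. path_amplitude N X g B)
    = (\<Sum>B\<in>{B \<in> Pi\<^sub>E {1..Suc D} I. P (nontriv B)}. path_amplitude N X g B)"
    using finite_paths by (intro sum.group) (auto simp: nontriv_def)
  moreover have "(\<Sum>B\<in>{B \<in> {B \<in> Pi\<^sub>E {1..Suc D} I. P (nontriv B)}. nontriv B = S}. path_amplitude N X g B) = part g S"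
    if "S \<in> {S \<in> Pow {1..D}. P S}" for S
  proof -
    have "{B \<in> {B \<in> Pi\<^sub>E {1..Suc D} I. P (nontriv B)}. nontriv B = S} = {B \<in> Pi\<^sub>E {1..Suc D} I. nontriv B = S}"
      using that by auto
    then show ?thesis using part_paths[of S g] that by auto
  qed
  ultimately show ?thesis by simp
qed

lemma truncated_eq: "truncated_value N X L g = (\<Sum>S\<in>{S \<in> Pow {1..D}. card S \<le> L}. part g S)"
  unfolding paths_by_nontriv[symmetric] by (simp add: truncated_value_def nontriv_def)

lemma amps_cong:
  assumes "i \<le> Suc D" "S \<inter> {Suc i..D} = S' \<inter> {Suc i..D}"
  shows "amps g S i = amps g S' i"
proof -
  have "m \<in> S \<longleftrightarrow> m \<in> S'" if "i < m" "m \<le> D" for m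
    using assms(2)[THEN eqset_imp_iff, of m] that by simp
  then have "sector S m = sector S' m" if "i < m" for m
    using that by (cases "m \<le> D") (simp_all add: sector_def)
  then show ?thesis unfolding amps_def using assms(1) by (intro chain_cong) simp_all
qed

context
  fixes g assumes g: "\<And>i. 1 \<le> i \<Longrightarrow> i \<le> D \<Longrightarrow> g i \<in> carrier (grp X)"
begin

lemma noisy_chain:
  assumes "1 \<le> i" "i \<le> Suc D"
  shows "foldr (noisy_layer X g) [i..<Suc D] (zero_state N) \<in> carrier_mat N N \<and>
    (\<forall>b\<in>I i. hs (T i b) (foldr (noisy_layer X g) [i..<Suc D] (zero_state N)) =
      chain D I (\<lambda>m. transfer m (g m)) final i b)"
  using assms(2,1)
proof (induction i rule: inc_induct)
  case base
  then show ?case by (simp add: final_def)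
next
  case (step i)
  let ?Y = "foldr (noisy_layer X g) [Suc i..<Suc D] (zero_state N)"
  have Y: "?Y \<in> carrier_mat N N" using step by auto
  have e: "foldr (noisy_layer X g) [i..<Suc D] (zero_state N) = layer i (g i) ?Y"
    using step by (subst upt_conv_Cons) (auto simp: layer_def noisy_layer_def)
  show ?case unfolding e using step Y g
    by (auto simp: layer_expand chain_step)
qed

lemma noisy_eq: "noisy_value N X g = (\<Sum>S\<in>Pow {1..D}. part g S)"
proof -
  let ?Y = "foldr (noisy_layer X g) [1..<Suc D] (zero_state N)"
  have Y: "?Y \<in> carrier_mat N N" "\<And>b. b \<in> I 1 \<Longrightarrow> hs (T 1 b) ?Y = chain D I (\<lambda>m. transfer m (g m)) final 1 b"
    using noisy_chain[of 1] by auto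
  have "noisy_value N X g = hs (obsv X) ?Y" by (simp add: noisy_value_def)
  also have "\<dots> = (\<Sum>b\<in>I 1. hs (obsv X) (T 1 b) * hs (T 1 b) ?Y)"
    using Y by (intro ob_parseval[OF op_basis]) auto
  also have "\<dots> = (\<Sum>b\<in>I 1. hs (obsv X) (T 1 b) * chain D I (\<lambda>m. transfer m (g m)) final 1 b)"
    using Y by simp
  also have "\<dots> = (\<Sum>B\<in>Pi\<^sub>E {1..Suc D} I. path_amplitude N X g B)"
    using chain_paths[where i = 1 and D = D and \<Lambda> = I and h = "\<lambda>b. hs (obsv X) (T 1 b)" and A = "\<lambda>m. transfer m (g m)" and z = final]
    by (simp add: path_amplitude_eq)
  also have "\<dots> = (\<Sum>S\<in>Pow {1..D}. part g S)"
    using paths_by_nontriv[where P = "\<lambda>_. True" and g = g] by (simp add: Pow_def)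
  finally show ?thesis .
qed

lemma err_eq: "noisy_value N X g - truncated_value N X L g = (\<Sum>S\<in>{S \<in> Pow {1..D}. L < card S}. part g S)"
proof -
  have "(\<Sum>S\<in>Pow {1..D}. part g S) = (\<Sum>S\<in>{S \<in> Pow {1..D}. L < card S} \<union> {S \<in> Pow {1..D}. card S \<le> L}. part g S)"
    by (intro sum.cong) auto
  also have "\<dots> = (\<Sum>S\<in>{S \<in> Pow {1..D}. L < card S}. part g S) + (\<Sum>S\<in>{S \<in> Pow {1..D}. card S \<le> L}. part g S)"
    by (intro sum.union_disjoint) auto
  finally show ?thesis unfolding noisy_eq truncated_eq by simp
qed

text \<open>
  Because \<open>k - card S\<close> is truncated, every \<open>S\<close> with at least \<open>k\<close> elements enters with weight one, and
  the induction needs no division by \<open>q\<close>.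
\<close>

lemma amps_norm:
  assumes q: "0 \<le> q" "q \<le> 1" "\<And>i b. 1 \<le> i \<Longrightarrow> i \<le> D \<Longrightarrow> b \<in> I i \<Longrightarrow> irrep_of b \<noteq> 0 \<Longrightarrow> cmod (neig X i b) \<le> q"
    and i: "1 \<le> i" "i \<le> Suc D"
  shows "(\<Sum>S\<in>Pow {i..D}. q ^ (2 * (k - card S)) * (\<Sum>b\<in>sector S i. (cmod (amps g S i b))\<^sup>2)) \<le> q ^ (2 * k)"
  using i(2,1)
proof (induction i rule: inc_induct)
  case base
  have "(hs_norm (zero_state N))\<^sup>2 = 1"
    using hs_self[of "zero_state N" N] zero_state_norm[OF N_pos] by (metis of_real_1 of_real_eq_iff zero_state_carrier)
  then have "(\<Sum>b\<in>I (Suc D). (cmod (final b))\<^sup>2) = 1"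
    unfolding final_def using ob_norm[OF op_basis, of "Suc D" "zero_state N"] by simp
  then show ?case by (simp add: amps_def sector_def)
next
  case (step i)
  let ?n = "\<lambda>S i. \<Sum>b\<in>sector S i. (cmod (amps g S i b))\<^sup>2"
  \<comment> \<open>Every set of slots beyond i extends in two ways, without i for a trivial
    operator there and with i for a non-trivial one.\<close>
  have "{i..D} = insert i {Suc i..D}" using step by auto
  then have "(\<Sum>S\<in>Pow {i..D}. q ^ (2 * (k - card S)) * ?n S i)
    = (\<Sum>S\<in>Pow {Suc i..D}. q ^ (2 * (k - card S)) * ?n S i + q ^ (2 * (k - card (insert i S))) * ?n (insert i S) i)"
    by (simp only:) (subst sum_Pow_insert; simp)
  also have "\<dots> \<le> (\<Sum>S\<in>Pow {Suc i..D}. q ^ (2 * (k - card S)) * ?n S (Suc i))"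
  proof (rule sum_mono)
    fix S assume S: "S \<in> Pow {Suc i..D}"
    have iS: "i \<notin> S" "finite S" using S finite_subset[of S "{Suc i..D}"] by auto
    have J: "sector S (Suc i) \<subseteq> I (Suc i)" by (auto simp: sector_def)
    obtain u where u: "\<And>b. b \<in> I i \<Longrightarrow> (\<Sum>c\<in>sector S (Suc i). transfer i (g i) b c * amps g S (Suc i) c) = neig X i b * u b"
      and nu: "(\<Sum>b\<in>I i. (cmod (u b))\<^sup>2) = ?n S (Suc i)"
      using transfer_norm[where i = i and \<gamma> = "g i" and v = "amps g S (Suc i)", OF _ _ _ J] step g by auto
    have am: "amps g S i b = neig X i b * u b" if "b \<in> I i" for b
      using u[OF that] step unfolding amps_def by (simp add: chain_step)
    have am': "amps g (insert i S) i = amps g S i" using step by (intro amps_cong) auto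
    have sec: "sector S i = {b \<in> I i. irrep_of b = 0}" "sector (insert i S) i = {b \<in> I i. irrep_of b \<noteq> 0}"
      using step iS by (auto simp: sector_def)
    let ?t = "\<Sum>b\<in>{b \<in> I i. irrep_of b = 0}. (cmod (u b))\<^sup>2" and ?nt = "\<Sum>b\<in>{b \<in> I i. irrep_of b \<noteq> 0}. (cmod (u b))\<^sup>2"
    have 1: "?n S i = ?t"
      unfolding sec using am step by (intro sum.cong) (auto simp: neig_trivial)
    have "?n (insert i S) i \<le> (\<Sum>b\<in>{b \<in> I i. irrep_of b \<noteq> 0}. q\<^sup>2 * (cmod (u b))\<^sup>2)"
      unfolding sec am' using am step q
      by (intro sum_mono) (auto simp: norm_mult power_mult_distrib intro!: mult_right_mono power_mono)
    then have 2: "?n (insert i S) i \<le> q\<^sup>2 * ?nt" by (simp add: sum_distrib_left)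
    have 3: "?n S (Suc i) = ?t + ?nt"
      unfolding nu[symmetric] using step
      by (subst sum.union_disjoint[symmetric]) (auto intro!: sum.cong)
    \<comment> \<open>Equality as long as \<open>card S\<close> is below k. From there on both
      differences are 0, and the additional \<open>q\<^sup>2\<close> is at most one.\<close>
    have q1: "q ^ (2 * (k - card (insert i S))) * q\<^sup>2 \<le> q ^ (2 * (k - card S))"
    proof -
      have "q ^ (2 * (k - card (insert i S))) * q\<^sup>2 = q ^ (2 * (k - card (insert i S)) + 2)"
        by (simp only: power_add)
      also have "\<dots> \<le> q ^ (2 * (k - card S))"
        using q iS by (intro power_decreasing) auto
      finally show ?thesis .
    qed
    have "q ^ (2 * (k - card (insert i S))) * ?n (insert i S) i \<le> q ^ (2 * (k - card (insert i S))) * (q\<^sup>2 * ?nt)"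
      using 2 q by (intro mult_left_mono) auto
    also have "\<dots> \<le> q ^ (2 * (k - card S)) * ?nt"
      unfolding mult.assoc[symmetric] using q1 by (intro mult_right_mono sum_nonneg) auto
    finally show "q ^ (2 * (k - card S)) * ?n S i + q ^ (2 * (k - card (insert i S))) * ?n (insert i S) i
      \<le> q ^ (2 * (k - card S)) * ?n S (Suc i)"
      unfolding 1 3 by (simp add: algebra_simps)
  qed
  also have "\<dots> \<le> q ^ (2 * k)" using step by auto
  finally show ?case .
qed

text \<open>Cauchy-Schwarz in slot 1 pairs the expansion of the observable with \<open>amps\<close>.
  In \<open>amps_norm\<close> the sets with at least k elements have weight one, and the other sets
  only add non-negative terms.\<close>

lemma part_bound:
  assumes q: "0 \<le> q" "q \<le> 1" "\<And>i b. 1 \<le> i \<Longrightarrow> i \<le> D \<Longrightarrow> b \<in> I i \<Longrightarrow> irrep_of b \<noteq> 0 \<Longrightarrow> cmod (neig X i b) \<le> q"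
  shows "(\<Sum>S\<in>{S \<in> Pow {1..D}. k \<le> card S}. (cmod (part g S))\<^sup>2) \<le> q ^ (2 * k) * (hs_norm (obsv X))\<^sup>2"
proof -
  let ?n = "\<lambda>S. \<Sum>b\<in>sector S 1. (cmod (amps g S 1 b))\<^sup>2"
  have ob: "orthonormal_op_basis N (I 1) (T 1)" by (intro op_basis) auto
  have "(cmod (part g S))\<^sup>2 \<le> (hs_norm (obsv X))\<^sup>2 * ?n S" for S
  proof -
    have "cmod (part g S) \<le> (\<Sum>b\<in>sector S 1. \<bar>cmod (hs (obsv X) (T 1 b))\<bar> * \<bar>cmod (amps g S 1 b)\<bar>)"
      unfolding part_def by (rule order_trans[OF norm_sum]) (simp add: norm_mult)
    also have "\<dots> \<le> L2_set (\<lambda>b. cmod (hs (obsv X) (T 1 b))) (sector S 1) * L2_set (\<lambda>b. cmod (amps g S 1 b)) (sector S 1)"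
      by (rule L2_set_mult_ineq)
    finally have "(cmod (part g S))\<^sup>2 \<le> (L2_set (\<lambda>b. cmod (hs (obsv X) (T 1 b))) (sector S 1) * L2_set (\<lambda>b. cmod (amps g S 1 b)) (sector S 1))\<^sup>2"
      by (intro power_mono) auto
    also have "\<dots> = (\<Sum>b\<in>sector S 1. (cmod (hs (obsv X) (T 1 b)))\<^sup>2) * ?n S"
      by (simp add: L2_set_def power_mult_distrib sum_nonneg)
    also have "\<dots> \<le> (\<Sum>b\<in>I 1. (cmod (hs (obsv X) (T 1 b)))\<^sup>2) * ?n S"
      by (intro mult_right_mono sum_mono2 sum_nonneg) (auto simp: sector_def)
    also have "(\<Sum>b\<in>I 1. (cmod (hs (obsv X) (T 1 b)))\<^sup>2) = (\<Sum>b\<in>I 1. (cmod (hs (T 1 b) (obsv X)))\<^sup>2)"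
      using hs_cnj[OF obs_carrier] by (intro sum.cong) (metis T_carrier complex_mod_cnj le_add1 order_refl plus_1_eq_Suc)+
    also have "\<dots> = (hs_norm (obsv X))\<^sup>2" by (rule ob_norm[OF ob obs_carrier])
    finally show ?thesis .
  qed
  then have "(\<Sum>S\<in>{S \<in> Pow {1..D}. k \<le> card S}. (cmod (part g S))\<^sup>2)
    \<le> (\<Sum>S\<in>{S \<in> Pow {1..D}. k \<le> card S}. (hs_norm (obsv X))\<^sup>2 * ?n S)"
    by (intro sum_mono)
  also have "\<dots> = (hs_norm (obsv X))\<^sup>2 * (\<Sum>S\<in>{S \<in> Pow {1..D}. k \<le> card S}. q ^ (2 * (k - card S)) * ?n S)"
    unfolding sum_distrib_left by (intro sum.cong) auto
  also have "\<dots> \<le> (hs_norm (obsv X))\<^sup>2 * (\<Sum>S\<in>Pow {1..D}. q ^ (2 * (k - card S)) * ?n S)"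
    using q by (intro mult_left_mono sum_mono2) (auto intro!: mult_nonneg_nonneg sum_nonneg)
  also have "\<dots> \<le> (hs_norm (obsv X))\<^sup>2 * q ^ (2 * k)"
    using amps_norm[OF q, of 1 k] by (intro mult_left_mono) auto
  finally show ?thesis by (simp add: mult.commute)
qed

end


subsection \<open>Haar averages and the truncation error\<close>

abbreviation "G \<equiv> grp X"
abbreviation "\<mu> \<equiv> haar X"

lemma G_group: "group G"
  using circ by (simp add: is_circuit_def compact_group_def)

lemma haar_space [simp]: "space \<mu> = carrier G"
  using circ by (simp add: is_circuit_def normalised_haar_def)

lemma gtop_space [simp]: "topspace (gtop X) = carrier G"
  using circ by (simp add: is_circuit_def compact_group_def)

lemma haar_sets: "sets \<mu> = sigma_sets (carrier G) {S. openin (gtop X) S}"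
  using circ by (simp add: is_circuit_def normalised_haar_def)

lemma haar_prob: "prob_space \<mu>"
  using circ by (intro prob_spaceI) (simp add: is_circuit_def normalised_haar_def)

lemma continuous_measurable:
  fixes f :: "'g \<Rightarrow> complex"
  assumes "continuous_map (gtop X) euclidean f"
  shows "f \<in> borel_measurable \<mu>"
proof (rule borel_measurableI)
  fix S :: "complex set" assume "open S"
  then have "openin (gtop X) {x \<in> topspace (gtop X). f x \<in> S}"
    using assms by (auto simp: continuous_map_def)
  moreover have "f -` S \<inter> space \<mu> = {x \<in> topspace (gtop X). f x \<in> S}" by auto
  ultimately show "f -` S \<inter> space \<mu> \<in> sets \<mu>" by (simp add: haar_sets sigma_sets.Basic)
qed

lemma translate_measurable:
  assumes h: "h \<in> carrier G"
  shows "(\<lambda>x. h \<otimes>\<^bsub>G\<^esub> x) \<in> measurable \<mu> \<mu>"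
proof (rule measurable_sigma_sets[OF haar_sets])
  show "{S. openin (gtop X) S} \<subseteq> Pow (carrier G)" using openin_subset[of "gtop X"] by auto
  show "(\<lambda>x. h \<otimes>\<^bsub>G\<^esub> x) \<in> space \<mu> \<rightarrow> carrier G"
    using h G_group by (auto intro: monoid.m_closed group.is_monoid)
  fix S assume S: "S \<in> {S. openin (gtop X) S}"
  have 1: "continuous_map (prod_topology (gtop X) (gtop X)) (gtop X) (\<lambda>(x, y). x \<otimes>\<^bsub>G\<^esub> y)"
    using circ by (simp add: is_circuit_def compact_group_def)
  have 2: "continuous_map (gtop X) (prod_topology (gtop X) (gtop X)) (\<lambda>x. (h, x))"
    using h by (auto simp: continuous_map_pairwise comp_def)
  have "continuous_map (gtop X) (gtop X) (\<lambda>x. h \<otimes>\<^bsub>G\<^esub> x)"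
    using continuous_map_compose[OF 2 1] by (simp add: comp_def)
  then have "openin (gtop X) {x \<in> topspace (gtop X). h \<otimes>\<^bsub>G\<^esub> x \<in> S}"
    using S by (auto simp: continuous_map_def)
  moreover have "(\<lambda>x. h \<otimes>\<^bsub>G\<^esub> x) -` S \<inter> space \<mu> = {x \<in> topspace (gtop X). h \<otimes>\<^bsub>G\<^esub> x \<in> S}" by auto
  ultimately show "(\<lambda>x. h \<otimes>\<^bsub>G\<^esub> x) -` S \<inter> space \<mu> \<in> sets \<mu>"
    by (simp add: haar_sets sigma_sets.Basic)
qed

text \<open>Invariance is given for images under translations, whereas \<open>distr\<close> measures
  preimages; the preimage under h is the image under the inverse of h.\<close>

lemma haar_invariant:
  assumes h: "h \<in> carrier G"
  shows "distr \<mu> \<mu> (\<lambda>x. h \<otimes>\<^bsub>G\<^esub> x) = \<mu>"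
proof (rule measure_eqI)
  fix A assume "A \<in> sets (distr \<mu> \<mu> (\<lambda>x. h \<otimes>\<^bsub>G\<^esub> x))"
  then have A: "A \<in> sets \<mu>" by simp
  then have sub: "A \<subseteq> carrier G" using sets.sets_into_space[of A \<mu>] by simp
  interpret group G by (rule G_group)
  have "(\<lambda>x. h \<otimes>\<^bsub>G\<^esub> x) -` A \<inter> space \<mu> = (\<lambda>x. inv\<^bsub>G\<^esub> h \<otimes>\<^bsub>G\<^esub> x) ` A"
  proof (intro equalityI subsetI)
    fix x assume "x \<in> (\<lambda>x. h \<otimes>\<^bsub>G\<^esub> x) -` A \<inter> space \<mu>"
    then have "h \<otimes>\<^bsub>G\<^esub> x \<in> A" "x = inv\<^bsub>G\<^esub> h \<otimes>\<^bsub>G\<^esub> (h \<otimes>\<^bsub>G\<^esub> x)"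
      using h by (auto simp: m_assoc[symmetric])
    then show "x \<in> (\<lambda>x. inv\<^bsub>G\<^esub> h \<otimes>\<^bsub>G\<^esub> x) ` A" by blast
  next
    fix x assume "x \<in> (\<lambda>x. inv\<^bsub>G\<^esub> h \<otimes>\<^bsub>G\<^esub> x) ` A"
    then show "x \<in> (\<lambda>x. h \<otimes>\<^bsub>G\<^esub> x) -` A \<inter> space \<mu>"
      using h sub by (auto simp: m_assoc[symmetric])
  qed
  then have "emeasure (distr \<mu> \<mu> (\<lambda>x. h \<otimes>\<^bsub>G\<^esub> x)) A = emeasure \<mu> ((\<lambda>x. inv\<^bsub>G\<^esub> h \<otimes>\<^bsub>G\<^esub> x) ` A)"
    using A by (simp add: emeasure_distr translate_measurable h)
  also have "\<dots> = emeasure \<mu> A"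
    using circ A h unfolding is_circuit_def normalised_haar_def by simp
  finally show "emeasure (distr \<mu> \<mu> (\<lambda>x. h \<otimes>\<^bsub>G\<^esub> x)) A = emeasure \<mu> A" .
qed simp

lemma haar_integral_translate:
  fixes f :: "'g \<Rightarrow> complex"
  assumes "h \<in> carrier G" "f \<in> borel_measurable \<mu>"
  shows "(\<integral>x. f (h \<otimes>\<^bsub>G\<^esub> x) \<partial>\<mu>) = (\<integral>x. f x \<partial>\<mu>)"
  using integral_distr[OF translate_measurable[OF assms(1)] assms(2)] haar_invariant[OF assms(1)] by simp

lemma unitary_entry_le_1:
  assumes V: "unitary_mat m V" and rc: "r < m" "c < m"
  shows "cmod (V $$ (r, c)) \<le> 1"
proof -
  have Vc: "V \<in> carrier_mat m m" "V * mat_adjoint V = 1\<^sub>m m" using V by (auto simp: unitary_mat_def)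
  have d: "dim_row (mat_adjoint V) = m" "dim_col (mat_adjoint V) = m"
    using carrier_matD[OF adjoint_carrier[OF Vc(1)]] by auto
  have "(V * mat_adjoint V) $$ (r, r) = (\<Sum>k<m. V $$ (r, k) * cnj (V $$ (r, k)))"
    using Vc(1) rc d by (simp add: scalar_prod_def atLeast0LessThan)
  then have "(\<Sum>k<m. V $$ (r, k) * cnj (V $$ (r, k))) = 1" using Vc rc by simp
  then have "complex_of_real (\<Sum>k<m. (cmod (V $$ (r, k)))\<^sup>2) = 1"
    by (simp add: complex_norm_square del: of_real_power)
  then have "(\<Sum>k<m. (cmod (V $$ (r, k)))\<^sup>2) = 1" by (metis of_real_1 of_real_eq_iff)
  moreover have "(cmod (V $$ (r, c)))\<^sup>2 \<le> (\<Sum>k<m. (cmod (V $$ (r, k)))\<^sup>2)"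
    using rc by (intro member_le_sum) auto
  ultimately have "(cmod (V $$ (r, c)))\<^sup>2 \<le> 1" by linarith
  then show ?thesis using power2_le_imp_le[of "cmod (V $$ (r, c))" 1] by (metis one_power2 zero_le_one)
qed

context
  fixes i l assumes i: "1 \<le> i" "i \<le> D" and l: "l \<in> irreps X i"
begin

lemma mcoef_irreducible: "irreducible_rep G (gtop X) (irdim X i l) (mcoef X i l)"
  using adapted i l unfolding symmetry_adapted_def by auto

lemma mcoef_integrable:
  assumes rc: "r < irdim X i l" "c < irdim X i l"
  shows "integrable \<mu> (\<lambda>\<gamma>. mcoef X i l \<gamma> $$ (r, c))"
proof -
  interpret prob_space \<mu> by (rule haar_prob)
  have "continuous_map (gtop X) euclidean (\<lambda>\<gamma>. mcoef X i l \<gamma> $$ (r, c))"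
    using mcoef_irreducible rc unfolding irreducible_rep_def unitary_rep_def by auto
  then have "(\<lambda>\<gamma>. mcoef X i l \<gamma> $$ (r, c)) \<in> borel_measurable \<mu>" by (rule continuous_measurable)
  moreover have "cmod (mcoef X i l \<gamma> $$ (r, c)) \<le> 1" if "\<gamma> \<in> carrier G" for \<gamma>
    using mcoef_irreducible rc that unfolding irreducible_rep_def unitary_rep_def
    by (intro unitary_entry_le_1) auto
  ultimately show ?thesis by (intro integrable_const_bound[of _ 1]) auto
qed

text \<open>
  The columns of the averaged representation are invariant vectors, and a non-trivial irreducible
  representation has none but \<open>0\<close>.
\<close>

lemma mcoef_mean_zero:
  assumes l0: "l \<noteq> 0" and rc: "r < irdim X i l" "c < irdim X i l"
  shows "(\<integral>\<gamma>. mcoef X i l \<gamma> $$ (r, c) \<partial>\<mu>) = 0"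
proof (rule ccontr)
  assume ne: "(\<integral>\<gamma>. mcoef X i l \<gamma> $$ (r, c) \<partial>\<mu>) \<noteq> 0"
  define m where "m = irdim X i l"
  define R where "R = mcoef X i l"
  define P where "P r = (\<integral>\<gamma>. R \<gamma> $$ (r, c) \<partial>\<mu>)" for r
  have irr: "irreducible_rep G (gtop X) m R" using mcoef_irreducible by (simp add: m_def R_def)
  then have R: "R h \<in> carrier_mat m m" if "h \<in> carrier G" for h
    using that by (simp add: irreducible_rep_def unitary_rep_def unitary_mat_def)
  have Rm: "R (h \<otimes>\<^bsub>G\<^esub> \<gamma>) = R h * R \<gamma>" if "h \<in> carrier G" "\<gamma> \<in> carrier G" for h \<gamma>
    using irr that by (simp add: irreducible_rep_def unitary_rep_def)
  have m: "0 < m" using rc by (simp add: m_def)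
  have c: "c < m" using rc by (simp add: m_def)
  have int: "integrable \<mu> (\<lambda>\<gamma>. R \<gamma> $$ (k, c))" if "k < m" for k
    using mcoef_integrable[of k c] that c by (simp add: m_def R_def)
  have inv: "(\<Sum>k<m. R h $$ (j, k) * P k) = P j" if h: "h \<in> carrier G" and j: "j < m" for h j
  proof -
    have "P j = (\<integral>\<gamma>. R (h \<otimes>\<^bsub>G\<^esub> \<gamma>) $$ (j, c) \<partial>\<mu>)"
      unfolding P_def using haar_integral_translate[OF h, of "\<lambda>\<gamma>. R \<gamma> $$ (j, c)"] int[OF j] by simp
    also have "\<dots> = (\<integral>\<gamma>. (\<Sum>k<m. R h $$ (j, k) * R \<gamma> $$ (k, c)) \<partial>\<mu>)"
    proof (rule Bochner_Integration.integral_cong[OF refl])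
      fix \<gamma> assume "\<gamma> \<in> space \<mu>"
      then show "R (h \<otimes>\<^bsub>G\<^esub> \<gamma>) $$ (j, c) = (\<Sum>k<m. R h $$ (j, k) * R \<gamma> $$ (k, c))"
        using R[OF h] R[of \<gamma>] h j c by (simp add: Rm scalar_prod_def atLeast0LessThan)
    qed
    also have "\<dots> = (\<Sum>k<m. R h $$ (j, k) * P k)"
      unfolding P_def using int by (subst Bochner_Integration.integral_sum) auto
    finally show ?thesis by simp
  qed
  have sub: "VectorSpace.subspace class_ring S (module_vec TYPE(complex) m)"
    if "S \<subseteq> carrier_vec m" "0\<^sub>v m \<in> S" "\<And>x y. x \<in> S \<Longrightarrow> y \<in> S \<Longrightarrow> x + y \<in> S" "\<And>a x. x \<in> S \<Longrightarrow> a \<cdot>\<^sub>v x \<in> S" for S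
    unfolding VectorSpace.subspace_def submodule_def using that vec_vs vec_module
    by (auto simp: module_vec_simps)
  have dich: "S = {0\<^sub>v m} \<or> S = carrier_vec m"
    if "S \<subseteq> carrier_vec m" "0\<^sub>v m \<in> S" "\<And>x y. x \<in> S \<Longrightarrow> y \<in> S \<Longrightarrow> x + y \<in> S" "\<And>a x. x \<in> S \<Longrightarrow> a \<cdot>\<^sub>v x \<in> S"
      "\<And>g x. g \<in> carrier G \<Longrightarrow> x \<in> S \<Longrightarrow> R g *\<^sub>v x \<in> S" for S
    using sub[OF that(1-4)] that(5) irr unfolding irreducible_rep_def by blast
  define S where "S = {x \<in> carrier_vec m. \<forall>h\<in>carrier G. R h *\<^sub>v x = x}"
  have "S = {0\<^sub>v m} \<or> S = carrier_vec m"
  proof (rule dich)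
    show "R g *\<^sub>v x \<in> S" if "g \<in> carrier G" "x \<in> S" for g x
      using that by (auto simp: S_def)
    show "x + y \<in> S" if "x \<in> S" "y \<in> S" for x y
      using that R by (auto simp: S_def mult_add_distrib_mat_vec[of _ m m])
    show "a \<cdot>\<^sub>v x \<in> S" if "x \<in> S" for a x
      using that R by (auto simp: S_def mult_mat_vec[of _ m m])
    show "0\<^sub>v m \<in> S" unfolding S_def
    proof (intro CollectI conjI ballI)
      fix h assume "h \<in> carrier G"
      then show "R h *\<^sub>v 0\<^sub>v m = 0\<^sub>v m" using R[of h] by (intro eq_vecI) (auto simp: scalar_prod_def)
    qed simp
  qed (auto simp: S_def)
  moreover have "vec m P \<in> S"
    unfolding S_def
  proof (intro CollectI conjI ballI)
    fix h assume h: "h \<in> carrier G"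
    show "R h *\<^sub>v vec m P = vec m P"
      using R[OF h] inv[OF h] by (intro eq_vecI) (auto simp: scalar_prod_def atLeast0LessThan)
  qed simp
  moreover have "vec m P \<noteq> 0\<^sub>v m"
  proof
    assume "vec m P = 0\<^sub>v m"
    then have "vec m P $ r = 0\<^sub>v m $ r" by simp
    then show False using ne rc by (simp add: m_def P_def R_def)
  qed
  ultimately have S: "S = carrier_vec m" by auto
  have R1: "R h = 1\<^sub>m m" if h: "h \<in> carrier G" for h
  proof (rule eq_matI)
    fix a b assume ab: "a < dim_row (1\<^sub>m m :: complex mat)" "b < dim_col (1\<^sub>m m :: complex mat)"
    have "unit_vec m b \<in> S" using S by simp
    then have "(R h *\<^sub>v unit_vec m b) $ a = unit_vec m b $ a" using h by (simp add: S_def)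
    then show "R h $$ (a, b) = 1\<^sub>m m $$ (a, b)" using ab R[OF h] by simp
  qed (use R[OF h] in auto)
  \<comment> \<open>Once every \<open>R h\<close> is the identity, all subspaces are invariant, and
    irreducibility applied to the first coordinate axis leaves only dimension one. The irrep is then
    trivial, which is reserved for label 0.\<close>
  define S' where "S' = {x \<in> carrier_vec m. \<forall>j<m. 0 < j \<longrightarrow> x $ j = (0::complex)}"
  have "S' = {0\<^sub>v m} \<or> S' = carrier_vec m"
    by (rule dich) (auto simp: S'_def R1)
  moreover have "unit_vec m 0 \<in> S'" by (auto simp: S'_def)
  moreover have "unit_vec m 0 \<noteq> (0\<^sub>v m :: complex vec)"
    using m by (metis index_unit_vec(2) index_zero_vec(1) zero_neq_one)
  ultimately have S': "S' = carrier_vec m" by auto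
  have "m = 1"
  proof (rule ccontr)
    assume "m \<noteq> 1"
    then have m2: "1 < m" using m by simp
    have "unit_vec m 1 \<in> S'" unfolding S' by simp
    then have "unit_vec m 1 $ 1 = (0::complex)" using m2 by (simp only: S'_def) auto
    then show False using m2 by simp
  qed
  then have "trivial_rep G m R" using R1 by (simp add: trivial_rep_def)
  then have "l = 0" using adapted i l unfolding symmetry_adapted_def m_def R_def by auto
  then show False using l0 by simp
qed

end

section \<open>Transfer coefficients as functions of one group element\<close>

lemma transfer_formula:
  assumes i: "1 \<le> i" "i \<le> D" and b: "(l, a, k) \<in> I i" and c: "c \<in> I (Suc i)" and \<gamma>: "\<gamma> \<in> carrier G"
  shows "transfer i \<gamma> (l, a, k) c = (\<Sum>k'<irdim X i l.
    mcoef X i l \<gamma> $$ (k, k') * (neig X i (l, a, k) * hs (T i (l, a, k')) (W i (T (Suc i) c))))"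
  unfolding transfer_def using layer_coeff'[OF i \<gamma> b, of "T (Suc i) c"] i c
  by (simp add: sum_distrib_left mult_ac)

lemma transfer_trivial:
  assumes i: "1 \<le> i" "i \<le> D" and b: "b \<in> I i" "irrep_of b = 0" and c: "c \<in> I (Suc i)" and \<gamma>: "\<gamma> \<in> carrier G"
  shows "transfer i \<gamma> b c = hs (T i b) (W i (T (Suc i) c))"
  unfolding transfer_def using layer_coeff_trivial[OF i \<gamma> b, of "T (Suc i) c"] i c by simp

lemma transfer_integrable:
  assumes i: "1 \<le> i" "i \<le> D" and b: "b \<in> I i" and c: "c \<in> I (Suc i)"
  shows "integrable \<mu> (\<lambda>\<gamma>. transfer i \<gamma> b c)"
proof -
  obtain l a k where b': "b = (l, a, k)" by (cases b)
  have "l \<in> irreps X i" "k < irdim X i l" using b b' by (auto simp: labels_def)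
  then have "integrable \<mu> (\<lambda>\<gamma>. \<Sum>k'<irdim X i l.
    mcoef X i l \<gamma> $$ (k, k') * (neig X i (l, a, k) * hs (T i (l, a, k')) (W i (T (Suc i) c))))"
    using i by (intro Bochner_Integration.integrable_sum integrable_mult_left mcoef_integrable) auto
  then show ?thesis
    by (rule iffD1[OF Bochner_Integration.integrable_cong[OF refl], rotated])
      (use transfer_formula[OF i _ c] b b' in auto)
qed

lemma transfer_mean_zero:
  assumes i: "1 \<le> i" "i \<le> D" and b: "b \<in> I i" "irrep_of b \<noteq> 0" and c: "c \<in> I (Suc i)"
  shows "(\<integral>\<gamma>. transfer i \<gamma> b c \<partial>\<mu>) = 0"
proof -
  obtain l a k where b': "b = (l, a, k)" by (cases b)
  have l: "l \<in> irreps X i" "k < irdim X i l" "l \<noteq> 0" using b b' by (auto simp: labels_def)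
  have "(\<integral>\<gamma>. transfer i \<gamma> b c \<partial>\<mu>) = (\<integral>\<gamma>. (\<Sum>k'<irdim X i l.
    mcoef X i l \<gamma> $$ (k, k') * (neig X i (l, a, k) * hs (T i (l, a, k')) (W i (T (Suc i) c)))) \<partial>\<mu>)"
    using transfer_formula[OF i _ c] b b' by (intro Bochner_Integration.integral_cong) auto
  also have "\<dots> = (\<Sum>k'<irdim X i l. (\<integral>\<gamma>.
    mcoef X i l \<gamma> $$ (k, k') * (neig X i (l, a, k) * hs (T i (l, a, k')) (W i (T (Suc i) c))) \<partial>\<mu>))"
    using i l by (intro Bochner_Integration.integral_sum integrable_mult_left mcoef_integrable) auto
  also have "\<dots> = 0"
    using mcoef_mean_zero[OF i] l by (intro sum.neutral) auto
  finally show ?thesis .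
qed

lemma transfer_bounded:
  assumes i: "1 \<le> i" "i \<le> D" and b: "b \<in> I i" and c: "c \<in> I (Suc i)"
  shows "\<exists>C. \<forall>\<gamma>\<in>carrier G. cmod (transfer i \<gamma> b c) \<le> C"
proof -
  obtain l a k where b': "b = (l, a, k)" by (cases b)
  have l: "l \<in> irreps X i" "k < irdim X i l" using b b' by (auto simp: labels_def)
  have "cmod (transfer i \<gamma> b c) \<le> (\<Sum>k'<irdim X i l. cmod (neig X i (l, a, k) * hs (T i (l, a, k')) (W i (T (Suc i) c))))"
    if \<gamma>: "\<gamma> \<in> carrier G" for \<gamma>
  proof -
    have "cmod (mcoef X i l \<gamma> $$ (k, k')) \<le> 1" if "k' < irdim X i l" for k'
      using mcoef_irreducible[OF i l(1)] l that \<gamma> unfolding irreducible_rep_def unitary_rep_def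
      by (intro unitary_entry_le_1) auto
    then show ?thesis unfolding b' transfer_formula[OF i b[unfolded b'] c \<gamma>]
      by (intro sum_norm_le) (auto simp: norm_mult intro!: mult_left_le_one_le)
  qed
  then show ?thesis by blast
qed

lemma transfer_product_integrable:
  assumes i: "1 \<le> i" "i \<le> D" and b: "b \<in> I i" "b' \<in> I i" and c: "c \<in> I (Suc i)" "c' \<in> I (Suc i)"
  shows "integrable \<mu> (\<lambda>\<gamma>. transfer i \<gamma> b c * cnj (transfer i \<gamma> b' c'))"
proof -
  interpret prob_space \<mu> by (rule haar_prob)
  obtain C C' where C: "\<And>\<gamma>. \<gamma> \<in> carrier G \<Longrightarrow> cmod (transfer i \<gamma> b c) \<le> C"
      "\<And>\<gamma>. \<gamma> \<in> carrier G \<Longrightarrow> cmod (transfer i \<gamma> b' c') \<le> C'"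
    using transfer_bounded[OF i] b c by metis
  have [measurable]: "(\<lambda>\<gamma>. transfer i \<gamma> b c) \<in> borel_measurable \<mu>" "(\<lambda>\<gamma>. transfer i \<gamma> b' c') \<in> borel_measurable \<mu>"
    using transfer_integrable[OF i] b c by auto
  have [measurable]: "(\<lambda>\<gamma>. cnj (transfer i \<gamma> b' c')) \<in> borel_measurable \<mu>"
    by (intro borel_measurable_continuous_on[OF _ \<open>(\<lambda>\<gamma>. transfer i \<gamma> b' c') \<in> borel_measurable \<mu>\<close>]) (intro continuous_intros)
  have "cmod (transfer i \<gamma> b c * cnj (transfer i \<gamma> b' c')) \<le> C * C'" if "\<gamma> \<in> carrier G" for \<gamma>
    using C[OF that] order_trans[OF norm_ge_zero C(1)[OF that]] by (auto simp: norm_mult intro!: mult_mono)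
  then show ?thesis by (intro integrable_const_bound[of _ "C * C'"]) auto
qed

text \<open>The coefficient of a trivial operator does not depend on the group element and leaves
  the integral; what remains is the mean of a non-trivial coefficient.\<close>

lemma transfer_orthogonal:
  assumes i: "1 \<le> i" "i \<le> D" and b: "b \<in> I i" "b' \<in> I i" and c: "c \<in> I (Suc i)" "c' \<in> I (Suc i)"
    and ne: "irrep_of b \<noteq> 0" "irrep_of b' = 0"
  shows "(\<integral>\<gamma>. transfer i \<gamma> b c * cnj (transfer i \<gamma> b' c') \<partial>\<mu>) = 0"
    and "(\<integral>\<gamma>. transfer i \<gamma> b' c' * cnj (transfer i \<gamma> b c) \<partial>\<mu>) = 0"
proof -
  let ?z = "hs (T i b') (W i (T (Suc i) c'))"
  have "(\<integral>\<gamma>. transfer i \<gamma> b c * cnj (transfer i \<gamma> b' c') \<partial>\<mu>) = (\<integral>\<gamma>. transfer i \<gamma> b c * cnj ?z \<partial>\<mu>)"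
    using transfer_trivial[OF i b(2) ne(2) c(2)] by (intro Bochner_Integration.integral_cong) auto
  also have "\<dots> = 0" using transfer_mean_zero[OF i b(1) ne(1) c(1)] by simp
  finally show 1: "(\<integral>\<gamma>. transfer i \<gamma> b c * cnj (transfer i \<gamma> b' c') \<partial>\<mu>) = 0" .
  have "transfer i \<gamma> b' c' * cnj (transfer i \<gamma> b c) = cnj (transfer i \<gamma> b c * cnj (transfer i \<gamma> b' c'))" for \<gamma>
    by simp
  then show "(\<integral>\<gamma>. transfer i \<gamma> b' c' * cnj (transfer i \<gamma> b c) \<partial>\<mu>) = 0"
    by (simp only: Bochner_Integration.integral_cnj 1 complex_cnj_zero)
qed

section \<open>Orthogonality over the product group\<close>

abbreviation "\<PP> \<equiv> product_haar X"

lemma product_prob: "prob_space \<PP>"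
  unfolding product_haar_def by (intro prob_space_PiM haar_prob)

lemma product_space: "space \<PP> = Pi\<^sub>E {1..D} (\<lambda>_. carrier G)"
  by (simp add: product_haar_def space_PiM)

text \<open>The integrand is a constant times a product of functions of one variable each, so the
  integral is a product of Haar integrals. A slot at which exactly one of the two paths is
  non-trivial contributes the factor 0.\<close>

lemma path_orthogonal:
  assumes B: "B \<in> Pi\<^sub>E {1..Suc D} I" and B': "B' \<in> Pi\<^sub>E {1..Suc D} I"
  shows "integrable \<PP> (\<lambda>g. path_amplitude N X g B * cnj (path_amplitude N X g B'))" (is ?int)
    and "nontriv B \<noteq> nontriv B' \<Longrightarrow> (\<integral>g. path_amplitude N X g B * cnj (path_amplitude N X g B') \<partial>\<PP>) = 0"
proof -
  interpret product_sigma_finite "\<lambda>_. \<mu>"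
    using haar_prob by (simp add: product_sigma_finite_def prob_space_imp_sigma_finite)
  let ?K = "hs (obsv X) (T 1 (B 1)) * final (B (Suc D)) * cnj (hs (obsv X) (T 1 (B' 1)) * final (B' (Suc D)))"
  let ?f = "\<lambda>i \<gamma>. transfer i \<gamma> (B i) (B (Suc i)) * cnj (transfer i \<gamma> (B' i) (B' (Suc i)))"
  have e: "path_amplitude N X g B * cnj (path_amplitude N X g B') = ?K * (\<Prod>i\<in>{1..D}. ?f i (g i))" for g
    by (simp add: path_amplitude_eq prod.distrib mult_ac)
  have mem: "B i \<in> I i" "B (Suc i) \<in> I (Suc i)" "B' i \<in> I i" "B' (Suc i) \<in> I (Suc i)" if "1 \<le> i" "i \<le> D" for i
    using PiE_mem[OF B, of i] PiE_mem[OF B, of "Suc i"] PiE_mem[OF B', of i] PiE_mem[OF B', of "Suc i"] that by auto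
  have int: "integrable \<mu> (?f i)" if "i \<in> {1..D}" for i
    using that mem by (intro transfer_product_integrable) auto
  show ?int unfolding e product_haar_def
    by (intro integrable_mult_right product_integrable_prod int) auto
  assume ne: "nontriv B \<noteq> nontriv B'"
  have "\<exists>i\<in>{1..D}. (irrep_of (B i) \<noteq> 0) \<noteq> (irrep_of (B' i) \<noteq> 0)"
  proof (rule ccontr)
    assume "\<not> ?thesis"
    then have "nontriv B = nontriv B'" unfolding nontriv_def by (intro Collect_cong) blast
    then show False using ne by simp
  qed
  then obtain i where i: "i \<in> {1..D}" "(irrep_of (B i) \<noteq> 0) \<noteq> (irrep_of (B' i) \<noteq> 0)"
    by blast
  have "(\<integral>\<gamma>. ?f i \<gamma> \<partial>\<mu>) = 0"
  proof (cases "irrep_of (B i) = 0")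
    case True
    then show ?thesis using i mem by (intro transfer_orthogonal(2)) auto
  next
    case False
    then show ?thesis using i mem by (intro transfer_orthogonal(1)) auto
  qed
  then have "(\<integral>g. (\<Prod>i\<in>{1..D}. ?f i (g i)) \<partial>\<PP>) = 0"
    unfolding product_haar_def using int i by (subst product_integral_prod) (auto intro!: prod_zero)
  then show "(\<integral>g. path_amplitude N X g B * cnj (path_amplitude N X g B') \<partial>\<PP>) = 0"
    unfolding e by simp
qed

lemma path_measurable:
  assumes B: "B \<in> Pi\<^sub>E {1..Suc D} I"
  shows "(\<lambda>g. path_amplitude N X g B) \<in> borel_measurable \<PP>"
proof -
  interpret product_sigma_finite "\<lambda>_. \<mu>"
    using haar_prob by (simp add: product_sigma_finite_def prob_space_imp_sigma_finite)
  have "integrable \<PP> (\<lambda>g. hs (obsv X) (T 1 (B 1)) * (\<Prod>i\<in>{1..D}. transfer i (g i) (B i) (B (Suc i))) * final (B (Suc D)))"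
    unfolding product_haar_def
    using PiE_mem[OF B] by (intro integrable_mult_right integrable_mult_left product_integrable_prod transfer_integrable) auto
  then show ?thesis unfolding path_amplitude_eq by simp
qed

lemma part_measurable: "S \<subseteq> {1..D} \<Longrightarrow> (\<lambda>g. part g S) \<in> borel_measurable \<PP>"
  unfolding part_paths[symmetric] by (intro borel_measurable_sum path_measurable) auto

lemma part_orthogonal:
  assumes S: "S \<subseteq> {1..D}" and S': "S' \<subseteq> {1..D}"
  shows "integrable \<PP> (\<lambda>g. part g S * cnj (part g S'))"
    and "S \<noteq> S' \<Longrightarrow> (\<integral>g. part g S * cnj (part g S') \<partial>\<PP>) = 0"
proof -
  let ?F = "\<lambda>S. {B \<in> Pi\<^sub>E {1..Suc D} I. nontriv B = S}"
  have e: "part g S * cnj (part g S') = (\<Sum>B\<in>?F S. \<Sum>B'\<in>?F S'. path_amplitude N X g B * cnj (path_amplitude N X g B'))" for g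
    unfolding part_paths[OF S, symmetric] part_paths[OF S', symmetric] cnj_sum sum_product ..
  show "integrable \<PP> (\<lambda>g. part g S * cnj (part g S'))"
    unfolding e by (intro Bochner_Integration.integrable_sum path_orthogonal(1)) auto
  assume "S \<noteq> S'"
  then have z: "(\<integral>g. path_amplitude N X g B * cnj (path_amplitude N X g B') \<partial>\<PP>) = 0" if "B \<in> ?F S" "B' \<in> ?F S'" for B B'
    using that path_orthogonal(2)[of B B'] by auto
  have int: "integrable \<PP> (\<lambda>g. path_amplitude N X g B * cnj (path_amplitude N X g B'))"
    if "B \<in> ?F S" "B' \<in> ?F S'" for B B'
    using that path_orthogonal(1)[of B B'] by blast
  have "(\<integral>g. part g S * cnj (part g S') \<partial>\<PP>)
    = (\<Sum>B\<in>?F S. \<integral>g. (\<Sum>B'\<in>?F S'. path_amplitude N X g B * cnj (path_amplitude N X g B')) \<partial>\<PP>)"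
    unfolding e by (intro Bochner_Integration.integral_sum Bochner_Integration.integrable_sum int)
  also have "\<dots> = (\<Sum>B\<in>?F S. \<Sum>B'\<in>?F S'. \<integral>g. path_amplitude N X g B * cnj (path_amplitude N X g B') \<partial>\<PP>)"
    by (intro sum.cong refl Bochner_Integration.integral_sum int)
  also have "\<dots> = 0" by (intro sum.neutral ballI z)
  finally show "(\<integral>g. part g S * cnj (part g S') \<partial>\<PP>) = 0" .
qed

text \<open>Pythagoras for the parts. The right-hand side stays under a single integral because the
  available bound concerns the whole sum at each fixed \<open>g\<close>, not its individual
  terms.\<close>

lemma parts_l2:
  assumes \<S>: "\<S> \<subseteq> Pow {1..D}"
  shows "integrable \<PP> (\<lambda>g. (cmod (\<Sum>S\<in>\<S>. part g S))\<^sup>2)"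
    and "(\<integral>g. (cmod (\<Sum>S\<in>\<S>. part g S))\<^sup>2 \<partial>\<PP>) = (\<integral>g. (\<Sum>S\<in>\<S>. (cmod (part g S))\<^sup>2) \<partial>\<PP>)"
    and "integrable \<PP> (\<lambda>g. \<Sum>S\<in>\<S>. (cmod (part g S))\<^sup>2)"
proof -
  have fin: "finite \<S>" using \<S> finite_subset by blast
  have sub: "S \<subseteq> {1..D}" if "S \<in> \<S>" for S using that \<S> by auto
  have e: "(cmod (\<Sum>S\<in>\<S>. part g S))\<^sup>2 = Re (\<Sum>S\<in>\<S>. \<Sum>S'\<in>\<S>. part g S * cnj (part g S'))" for g
    unfolding sum_product[symmetric] cnj_sum[symmetric] complex_norm_square[symmetric] by (simp del: of_real_power)
  have i1: "integrable \<PP> (\<lambda>g. \<Sum>S\<in>\<S>. \<Sum>S'\<in>\<S>. part g S * cnj (part g S'))"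
    using sub part_orthogonal(1) by (intro Bochner_Integration.integrable_sum) auto
  show i2: "integrable \<PP> (\<lambda>g. (cmod (\<Sum>S\<in>\<S>. part g S))\<^sup>2)"
    unfolding e using i1 by (rule integrable_Re)
  have d: "(\<Sum>S\<in>\<S>. (cmod (part g S))\<^sup>2) = Re (\<Sum>S\<in>\<S>. part g S * cnj (part g S))" for g
    unfolding complex_norm_square[symmetric] by (simp del: of_real_power)
  have i3: "integrable \<PP> (\<lambda>g. \<Sum>S\<in>\<S>. part g S * cnj (part g S))"
    using sub part_orthogonal(1) by (intro Bochner_Integration.integrable_sum) auto
  show "integrable \<PP> (\<lambda>g. \<Sum>S\<in>\<S>. (cmod (part g S))\<^sup>2)"
    unfolding d using i3 by (rule integrable_Re)
  have "(\<integral>g. (\<Sum>S\<in>\<S>. \<Sum>S'\<in>\<S>. part g S * cnj (part g S')) \<partial>\<PP>)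
    = (\<Sum>S\<in>\<S>. \<integral>g. (\<Sum>S'\<in>\<S>. part g S * cnj (part g S')) \<partial>\<PP>)"
    by (intro Bochner_Integration.integral_sum Bochner_Integration.integrable_sum part_orthogonal(1) sub)
  also have "\<dots> = (\<Sum>S\<in>\<S>. \<Sum>S'\<in>\<S>. \<integral>g. part g S * cnj (part g S') \<partial>\<PP>)"
    by (intro sum.cong refl Bochner_Integration.integral_sum part_orthogonal(1) sub)
  also have "\<dots> = (\<Sum>S\<in>\<S>. \<integral>g. part g S * cnj (part g S) \<partial>\<PP>)"
  proof (intro sum.cong refl)
    fix S assume S: "S \<in> \<S>"
    have "(\<Sum>S'\<in>\<S>. \<integral>g. part g S * cnj (part g S') \<partial>\<PP>) = (\<Sum>S'\<in>\<S>. if S' = S then \<integral>g. part g S * cnj (part g S') \<partial>\<PP> else 0)"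
      using sub S part_orthogonal(2) by (intro sum.cong) auto
    then show "(\<Sum>S'\<in>\<S>. \<integral>g. part g S * cnj (part g S') \<partial>\<PP>) = (\<integral>g. part g S * cnj (part g S) \<partial>\<PP>)"
      using S fin by simp
  qed
  also have "\<dots> = (\<integral>g. (\<Sum>S\<in>\<S>. part g S * cnj (part g S)) \<partial>\<PP>)"
    using sub part_orthogonal(1) by (intro Bochner_Integration.integral_sum[symmetric]) auto
  finally have "(\<integral>g. (\<Sum>S\<in>\<S>. \<Sum>S'\<in>\<S>. part g S * cnj (part g S')) \<partial>\<PP>) = (\<integral>g. (\<Sum>S\<in>\<S>. part g S * cnj (part g S)) \<partial>\<PP>)" .
  then show "(\<integral>g. (cmod (\<Sum>S\<in>\<S>. part g S))\<^sup>2 \<partial>\<PP>) = (\<integral>g. (\<Sum>S\<in>\<S>. (cmod (part g S))\<^sup>2) \<partial>\<PP>)"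
    unfolding e d integral_Re[OF i1] integral_Re[OF i3] by simp
qed

section \<open>The truncation error\<close>

lemma truncation_error:
  fixes L :: nat
  defines "err \<equiv> \<lambda>g. noisy_value N X g - truncated_value N X L g"
  shows "square_integrable \<PP> err"
    and "l2_norm \<PP> err \<le> exp (- spectral_gap N (noise X) * real L) * hs_norm (obsv X)"
proof -
  interpret prob_space \<PP> by (rule product_prob)
  define \<S> where "\<S> = {S \<in> Pow {1..D}. L < card S}"
  have err: "err g = (\<Sum>S\<in>\<S>. part g S)" if "g \<in> space \<PP>" for g
    using that unfolding err_def \<S>_def product_space by (intro err_eq) auto
  have sub: "\<S> \<subseteq> Pow {1..D}" by (auto simp: \<S>_def)
  have meas: "(\<lambda>g. \<Sum>S\<in>\<S>. part g S) \<in> borel_measurable \<PP>"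
    using sub by (intro borel_measurable_sum part_measurable) auto
  show "square_integrable \<PP> err"
    unfolding square_integrable_def
  proof
    show "err \<in> borel_measurable \<PP>" using meas by (subst measurable_cong[OF err]) auto
    show "integrable \<PP> (\<lambda>g. (cmod (err g))\<^sup>2)"
      using parts_l2(1)[OF sub] by (subst Bochner_Integration.integrable_cong[OF refl, of _ _ "\<lambda>g. (cmod (\<Sum>S\<in>\<S>. part g S))\<^sup>2"]) (auto simp: err)
  qed
  define \<gamma> where "\<gamma> = spectral_gap N (noise X)"
  define q where "q = min 1 (max 0 (1 - \<gamma>))"
  have q: "0 \<le> q" "q \<le> 1" by (auto simp: q_def)
  have norm: "0 \<le> hs_norm (obsv X)"
  proof -
    have "Re (hs (obsv X) (obsv X)) = (hs_norm (obsv X))\<^sup>2"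
      unfolding hs_self[OF obs_carrier] by (rule Re_complex_of_real)
    then have "0 \<le> Re (hs (obsv X) (obsv X))" by (simp only: zero_le_power2)
    then show ?thesis by (simp add: hs_norm_def)
  qed
  \<comment> \<open>For \<gamma> \<ge> 1 the left side is 0. Otherwise one factor \<open>q\<close>
    is given away and \<open>1 - \<gamma> \<le> exp (- \<gamma>)\<close> handles the others.\<close>
  have qL: "q ^ Suc L \<le> exp (- \<gamma> * real L)"
  proof (cases "1 - \<gamma> \<le> 0")
    case False
    have "q ^ Suc L \<le> q ^ L" using q by (intro power_decreasing) auto
    also have "\<dots> \<le> exp (- \<gamma>) ^ L"
      using q False exp_ge_add_one_self[of "- \<gamma>"] by (intro power_mono) (auto simp: q_def)
    also have "\<dots> = exp (- \<gamma> * real L)" by (simp add: exp_of_nat_mult[symmetric] mult.commute)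
    finally show ?thesis .
  qed (simp add: q_def)
  \<comment> \<open>Discarded sets have more than L elements, hence the exponent
    \<open>Suc L\<close>.\<close>
  have pw: "(\<Sum>S\<in>\<S>. (cmod (part g S))\<^sup>2) \<le> (q ^ Suc L * hs_norm (obsv X))\<^sup>2" if g: "g \<in> space \<PP>" for g
  proof -
    have "(\<Sum>S\<in>{S \<in> Pow {1..D}. Suc L \<le> card S}. (cmod (part g S))\<^sup>2) \<le> q ^ (2 * Suc L) * (hs_norm (obsv X))\<^sup>2"
      using g q neig_nontrivial unfolding product_space q_def \<gamma>_def by (intro part_bound) auto
    also have "q ^ (2 * Suc L) * (hs_norm (obsv X))\<^sup>2 = (q ^ Suc L * hs_norm (obsv X))\<^sup>2"
      unfolding power_mult_distrib by (simp only: power_mult[symmetric] mult.commute)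
    finally show ?thesis by (simp only: \<S>_def Suc_le_eq)
  qed
  have "(\<integral>g. (cmod (err g))\<^sup>2 \<partial>\<PP>) = (\<integral>g. (cmod (\<Sum>S\<in>\<S>. part g S))\<^sup>2 \<partial>\<PP>)"
    by (intro Bochner_Integration.integral_cong) (auto simp: err)
  also have "\<dots> = (\<integral>g. (\<Sum>S\<in>\<S>. (cmod (part g S))\<^sup>2) \<partial>\<PP>)" by (rule parts_l2(2)[OF sub])
  also have "\<dots> \<le> (\<integral>g. (q ^ Suc L * hs_norm (obsv X))\<^sup>2 \<partial>\<PP>)"
    using parts_l2(3)[OF sub] pw by (intro integral_mono) auto
  also have "\<dots> = (q ^ Suc L * hs_norm (obsv X))\<^sup>2" by (simp add: prob_space)
  finally have "l2_norm \<PP> err \<le> sqrt ((q ^ Suc L * hs_norm (obsv X))\<^sup>2)"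
    unfolding l2_norm_def by (rule real_sqrt_le_mono)
  also have "\<dots> = q ^ Suc L * hs_norm (obsv X)" using q norm by (simp del: power_Suc)
  also have "\<dots> \<le> exp (- \<gamma> * real L) * hs_norm (obsv X)" using qL norm by (intro mult_right_mono)
  finally show "l2_norm \<PP> err \<le> exp (- spectral_gap N (noise X) * real L) * hs_norm (obsv X)"
    by (simp add: \<gamma>_def)
qed


subsection \<open>Runs of trivial operators\<close>

text \<open>
  \<open>tail_sum g i b l\<close> sums the continuations of a path that is at \<open>b\<close> in slot \<open>i\<close>, with \<open>l\<close> non-trivial
  operators still allowed in the later slots; \<open>visit\<close> also charges \<open>b\<close> itself to \<open>l\<close>.
\<close>

definition tail_sum :: "(nat \<Rightarrow> 'g) \<Rightarrow> nat \<Rightarrow> label \<Rightarrow> nat \<Rightarrow> complex" where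
  "tail_sum g i b l = (\<Sum>S\<in>{S \<in> Pow {Suc i..D}. card S \<le> l}. amps g S i b)"

definition visit :: "(nat \<Rightarrow> 'g) \<Rightarrow> nat \<Rightarrow> label \<Rightarrow> nat \<Rightarrow> complex" where
  "visit g i b l = (if i \<le> D \<and> irrep_of b \<noteq> 0 then if l = 0 then 0 else tail_sum g i b (l - 1)
     else tail_sum g i b l)"

lemma tail_sum_end: "tail_sum g (Suc D) b l = final b"
proof -
  have "{S \<in> Pow {Suc (Suc D)..D}. card S \<le> l} = {{}}" by auto
  then show ?thesis by (simp add: tail_sum_def amps_def)
qed

text \<open>A trivial \<open>b\<close> is compatible with the sets avoiding i, a non-trivial one
  with the sets containing i. Deleting i from the latter lowers the cardinality by one, which is the
  charge in \<open>visit\<close>.\<close>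

lemma visit_eq:
  assumes i: "1 \<le> i" "i \<le> Suc D" and b: "b \<in> I i"
  shows "visit g i b l = (\<Sum>S\<in>{S \<in> Pow {i..D}. card S \<le> l \<and> b \<in> sector S i}. amps g S i b)"
proof (cases "i \<le> D")
  case False
  then have "i = Suc D" using i by simp
  then show ?thesis using b by (simp add: visit_def tail_sum_def sector_def)
next
  case True
  let ?f = "\<lambda>S. if card S \<le> l \<and> b \<in> sector S i then amps g S i b else 0"
  have fS: "finite (Pow {Suc i..D})" by simp
  have ins: "{i..D} = insert i {Suc i..D}" using True by auto
  have "(\<Sum>S\<in>{S \<in> Pow {i..D}. card S \<le> l \<and> b \<in> sector S i}. amps g S i b) = (\<Sum>S\<in>Pow {i..D}. ?f S)"
    by (rule sum.inter_filter) simp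
  also have "\<dots> = (\<Sum>S\<in>Pow {Suc i..D}. ?f S + ?f (insert i S))"
    unfolding ins by (rule sum_Pow_insert) auto
  also have "\<dots> = visit g i b l"
  proof (cases "irrep_of b = 0")
    case triv: True
    have "?f S + ?f (insert i S) = (if card S \<le> l then amps g S i b else 0)" if S: "S \<in> Pow {Suc i..D}" for S
    proof -
      have "i \<notin> S" using S by auto
      then have "b \<in> sector S i" "b \<notin> sector (insert i S) i" using triv True b by (auto simp: sector_def)
      then show ?thesis by simp
    qed
    then have "(\<Sum>S\<in>Pow {Suc i..D}. ?f S + ?f (insert i S)) = (\<Sum>S\<in>Pow {Suc i..D}. if card S \<le> l then amps g S i b else 0)"
      by (rule sum.cong[OF refl])
    also have "\<dots> = tail_sum g i b l"
      unfolding tail_sum_def by (rule sum.inter_filter[OF fS, symmetric])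
    finally show ?thesis using triv by (simp add: visit_def)
  next
    case nt: False
    have "?f S + ?f (insert i S) = (if Suc (card S) \<le> l then amps g S i b else 0)" if S: "S \<in> Pow {Suc i..D}" for S
    proof -
      have iS: "i \<notin> S" "finite S" using S finite_subset[of S "{Suc i..D}"] by auto
      then have "b \<notin> sector S i" "b \<in> sector (insert i S) i" using nt True b by (auto simp: sector_def)
      moreover have "amps g (insert i S) i = amps g S i" using True by (intro amps_cong) auto
      ultimately show ?thesis using iS by simp
    qed
    then have "(\<Sum>S\<in>Pow {Suc i..D}. ?f S + ?f (insert i S)) = (\<Sum>S\<in>Pow {Suc i..D}. if Suc (card S) \<le> l then amps g S i b else 0)"
      by (rule sum.cong[OF refl])
    also have "\<dots> = (if l = 0 then 0 else tail_sum g i b (l - 1))"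
    proof (cases l)
      case (Suc l')
      then show ?thesis unfolding tail_sum_def using sum.inter_filter[OF fS, where g = "\<lambda>S. amps g S i b" and P = "\<lambda>S. card S \<le> l'"] by simp
    qed simp
    finally show ?thesis using nt True by (simp add: visit_def)
  qed
  finally show ?thesis by simp
qed

text \<open>Exchanging the two sums turns a global restriction on the set of non-trivial slots into
  a budget carried along by each operator.\<close>

lemma visit_sum:
  assumes i: "1 \<le> i" "i \<le> Suc D"
  shows "(\<Sum>S\<in>{S \<in> Pow {i..D}. card S \<le> l}. \<Sum>c\<in>sector S i. h c * amps g S i c) = (\<Sum>c\<in>I i. h c * visit g i c l)"
proof -
  let ?A = "{S \<in> Pow {i..D}. card S \<le> l}"
  have fA: "finite ?A" by simp
  have sec: "sector S i = {c \<in> I i. c \<in> sector S i}" for S by (auto simp: sector_def)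
  have "(\<Sum>S\<in>?A. \<Sum>c\<in>sector S i. h c * amps g S i c) = (\<Sum>S\<in>?A. \<Sum>c\<in>I i. if c \<in> sector S i then h c * amps g S i c else 0)"
    by (intro sum.cong[OF refl], subst sec, rule sum.inter_filter) (use i in simp)
  also have "\<dots> = (\<Sum>c\<in>I i. \<Sum>S\<in>?A. if c \<in> sector S i then h c * amps g S i c else 0)" by (rule sum.swap)
  also have "\<dots> = (\<Sum>c\<in>I i. h c * visit g i c l)"
  proof (rule sum.cong[OF refl])
    fix c assume c: "c \<in> I i"
    have "(\<Sum>S\<in>?A. if c \<in> sector S i then h c * amps g S i c else 0) = (\<Sum>S\<in>{S \<in> ?A. c \<in> sector S i}. h c * amps g S i c)"
      by (rule sum.inter_filter[OF fA, symmetric])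
    also have "{S \<in> ?A. c \<in> sector S i} = {S \<in> Pow {i..D}. card S \<le> l \<and> c \<in> sector S i}" by blast
    finally show "(\<Sum>S\<in>?A. if c \<in> sector S i then h c * amps g S i c else 0) = h c * visit g i c l"
      unfolding visit_eq[OF i c] sum_distrib_left .
  qed
  finally show ?thesis .
qed

lemma truncated_visit: "truncated_value N X L g = (\<Sum>b\<in>I 1. hs (obsv X) (T 1 b) * visit g 1 b L)"
  unfolding truncated_eq part_def by (rule visit_sum) auto

lemma tail_sum_step:
  assumes i: "1 \<le> i" "i \<le> D"
  shows "tail_sum g i b l = (\<Sum>c\<in>I (Suc i). transfer i (g i) b c * visit g (Suc i) c l)"
proof -
  have "amps g S i b = (\<Sum>c\<in>sector S (Suc i). transfer i (g i) b c * amps g S (Suc i) c)" for S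
    unfolding amps_def by (rule chain_step[OF i(2)])
  then show ?thesis using visit_sum[where i = "Suc i" and l = l and h = "transfer i (g i) b" and g = g] i by (simp add: tail_sum_def)
qed

text \<open>\<open>run_sum\<close> is \<open>tail_sum\<close> with the group element and the noise of slot \<open>i\<close> left out.\<close>

definition run_sum :: "(nat \<Rightarrow> 'g) \<Rightarrow> nat \<Rightarrow> label \<Rightarrow> nat \<Rightarrow> complex" where
  "run_sum g i b l = (\<Sum>c\<in>I (Suc i). hs (T i b) (W i (T (Suc i) c)) * visit g (Suc i) c l)"

text \<open>The group element of slot i only mixes the rows of the irrep; this is the branching by
  d_max. What follows each row is a product of gates free of \<open>g i\<close>.\<close>

lemma tail_sum_run:
  assumes i: "1 \<le> i" "i \<le> D" and b: "(m, a, k) \<in> I i" and g: "g i \<in> carrier G"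
  shows "tail_sum g i (m, a, k) l = neig X i (m, a, k) *
    (\<Sum>k'<irdim X i m. mcoef X i m (g i) $$ (k, k') * run_sum g i (m, a, k') l)"
proof -
  have "tail_sum g i (m, a, k) l = (\<Sum>c\<in>I (Suc i). \<Sum>k'<irdim X i m. neig X i (m, a, k) * (mcoef X i m (g i) $$ (k, k') *
    (hs (T i (m, a, k')) (W i (T (Suc i) c)) * visit g (Suc i) c l)))"
    unfolding tail_sum_step[OF i]
    by (intro sum.cong refl) (simp add: transfer_formula[OF i b _ g] sum_distrib_right sum_distrib_left mult_ac)
  also have "\<dots> = (\<Sum>k'<irdim X i m. \<Sum>c\<in>I (Suc i). neig X i (m, a, k) * (mcoef X i m (g i) $$ (k, k') *
    (hs (T i (m, a, k')) (W i (T (Suc i) c)) * visit g (Suc i) c l)))" by (rule sum.swap)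
  finally show ?thesis by (simp add: run_sum_def sum_distrib_left)
qed

lemma tail_sum_trivial:
  assumes i: "1 \<le> i" "i \<le> D" and b: "b \<in> I i" "irrep_of b = 0" and g: "g i \<in> carrier G"
  shows "tail_sum g i b l = run_sum g i b l"
  unfolding tail_sum_step[OF i] run_sum_def
  by (intro sum.cong refl) (simp add: transfer_trivial[OF i b _ g])

definition dual_sum :: "(nat \<Rightarrow> 'g) \<Rightarrow> nat \<Rightarrow> complex mat \<Rightarrow> nat \<Rightarrow> complex" where
  "dual_sum g i A l = (\<Sum>c\<in>I i. hs A (T i c) * visit g i c l)"

lemma triv_proj_coeff:
  assumes i: "1 \<le> i" "i \<le> Suc D" and c: "c \<in> I i"
  shows "hs (triv_proj N X i A) (T i c) = (if irrep_of c = 0 then cnj (hs (T i c) A) else 0)"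
proof -
  have "hs (T i c) (triv_proj N X i A) = (if irrep_of c = 0 then hs (T i c) A else 0)"
    unfolding triv_proj_def using c by (subst ob_coeff[OF op_basis[OF i] c]) auto
  then show ?thesis using hs_cnj[of "T i c" N "triv_proj N X i A"] i c by (auto simp: triv_proj_def)
qed

lemma propagate_adj_self [simp]: "propagate_adj X i i A = A"
  by (simp add: propagate_adj_def)

lemma propagate_adj_Suc:
  "i \<le> j \<Longrightarrow> propagate_adj X i (Suc j) A = conj_by (mat_adjoint (gate X j)) (propagate_adj X i j A)"
  by (simp add: propagate_adj_def)

lemma propagate_self [simp]: "propagate X i i A = A"
  by (simp add: propagate_def)

lemma propagate_Suc: "i \<le> j \<Longrightarrow> propagate X i (Suc j) A = propagate X i j (W j A)"
  by (simp add: propagate_def)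

lemma propagate_adj_carrier [simp]:
  assumes "i \<le> j" "1 \<le> i" "j \<le> Suc D" "A \<in> carrier_mat N N"
  shows "propagate_adj X i j A \<in> carrier_mat N N"
  using assms(1,3) by (induction j rule: dec_induct) (use assms in \<open>auto simp: propagate_adj_Suc\<close>)

lemma hs_propagate:
  assumes "i \<le> j" "1 \<le> i" "j \<le> Suc D" "A \<in> carrier_mat N N" "B \<in> carrier_mat N N"
  shows "hs (propagate_adj X i j A) B = hs A (propagate X i j B)"
  using assms(1,5)
proof (induction j arbitrary: B rule: dec_induct)
  case (step k)
  have k: "k \<le> D" using step(2) assms(3) by simp
  have "hs (propagate_adj X i (Suc k) A) B = hs (propagate_adj X i k A) (W k B)"
    using step(1,3,4) k assms by (simp add: propagate_adj_Suc hs_conj_by[of _ N])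
  also have "\<dots> = hs A (propagate X i k (W k B))" using step(1,3,4) k assms by simp
  finally show ?case using step by (simp add: propagate_Suc)
qed simp

lemma propagate_adj_norm:
  assumes "i \<le> j" "1 \<le> i" "j \<le> Suc D" "A \<in> carrier_mat N N"
  shows "hs (propagate_adj X i j A) (propagate_adj X i j A) = hs A A"
  using assms(1)
proof (induction j rule: dec_induct)
  case (step k)
  have kD: "k \<le> D" using step(2) assms(3) by simp
  have "hs (propagate_adj X i (Suc k) A) (propagate_adj X i (Suc k) A) = hs (propagate_adj X i k A) (propagate_adj X i k A)"
    using step(1,3) kD assms gate_unitary[of k]
    by (simp add: propagate_adj_Suc hs_conj_by_unitary[of N] unitary_adjoint)
  then show ?case using step by simp
qed simp

lemma run_sum_dual:
  assumes i: "1 \<le> i" "i \<le> D" and b: "b \<in> I i"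
  shows "run_sum g i b l = dual_sum g (Suc i) (propagate_adj X i (Suc i) (T i b)) l"
  unfolding run_sum_def dual_sum_def using i b
  by (intro sum.cong refl) (simp add: propagate_adj_Suc hs_conj_by[of _ N])

text \<open>On trivial operators neither the group element nor the noise nor the budget acts. The
  sum over the basis of slot i is then a resolution of the identity and disappears, leaving the next
  gate.\<close>

lemma dual_sum_trivial:
  assumes i: "1 \<le> i" "i \<le> D" and A: "A \<in> carrier_mat N N" and triv: "triv_proj N X i A = A" and g: "g i \<in> carrier G"
  shows "dual_sum g i A l = dual_sum g (Suc i) (conj_by (mat_adjoint (gate X i)) A) l"
proof -
  have z: "hs A (T i c) = 0" if "c \<in> I i" "irrep_of c \<noteq> 0" for c
    using triv_proj_coeff[of i c A] i that by (simp add: triv)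
  have "dual_sum g i A l = (\<Sum>c\<in>I i. hs A (T i c) * run_sum g i c l)"
    unfolding dual_sum_def
  proof (rule sum.cong[OF refl])
    fix c assume c: "c \<in> I i"
    show "hs A (T i c) * visit g i c l = hs A (T i c) * run_sum g i c l"
      using z[OF c] tail_sum_trivial[where i = i and b = c and g = g and l = l] i c g by (cases "irrep_of c = 0") (auto simp: visit_def)
  qed
  also have "\<dots> = (\<Sum>c\<in>I i. \<Sum>c'\<in>I (Suc i). hs A (T i c) * hs (T i c) (W i (T (Suc i) c')) * visit g (Suc i) c' l)"
    unfolding run_sum_def by (simp add: sum_distrib_left mult.assoc)
  also have "\<dots> = (\<Sum>c'\<in>I (Suc i). \<Sum>c\<in>I i. hs A (T i c) * hs (T i c) (W i (T (Suc i) c')) * visit g (Suc i) c' l)"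
    by (rule sum.swap)
  also have "\<dots> = (\<Sum>c'\<in>I (Suc i). hs A (W i (T (Suc i) c')) * visit g (Suc i) c' l)"
  proof (rule sum.cong[OF refl])
    fix c' assume c': "c' \<in> I (Suc i)"
    have "hs A (W i (T (Suc i) c')) = (\<Sum>c\<in>I i. hs A (T i c) * hs (T i c) (W i (T (Suc i) c')))"
      using i A c' by (intro ob_parseval[OF op_basis]) auto
    then show "(\<Sum>c\<in>I i. hs A (T i c) * hs (T i c) (W i (T (Suc i) c')) * visit g (Suc i) c' l)
      = hs A (W i (T (Suc i) c')) * visit g (Suc i) c' l" by (simp add: sum_distrib_right)
  qed
  also have "\<dots> = dual_sum g (Suc i) (conj_by (mat_adjoint (gate X i)) A) l"
    unfolding dual_sum_def using i A by (intro sum.cong refl) (simp add: hs_conj_by[of _ N])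
  finally show ?thesis .
qed

lemma run_sum_to:
  assumes "Suc i \<le> j" "j \<le> Suc D" and i: "1 \<le> i" and b: "b \<in> I i"
    and rem: "\<And>m. i < m \<Longrightarrow> m < j \<Longrightarrow> remains_trivial N X i b m"
    and g: "\<And>m. 1 \<le> m \<Longrightarrow> m \<le> D \<Longrightarrow> g m \<in> carrier G"
  shows "run_sum g i b l = dual_sum g j (propagate_adj X i j (T i b)) l"
  using assms(1)
proof (induction j rule: dec_induct)
  case base
  then show ?case using i b assms(1,2) by (intro run_sum_dual) linarith+
next
  case (step k)
  have k: "k \<le> D" using step(2) assms(2) by simp
  have Tb: "T i b \<in> carrier_mat N N" using step(1) k i b by simp
  have "run_sum g i b l = dual_sum g k (propagate_adj X i k (T i b)) l" using step(3) by simp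
  also have "\<dots> = dual_sum g (Suc k) (conj_by (mat_adjoint (gate X k)) (propagate_adj X i k (T i b))) l"
  proof (rule dual_sum_trivial)
    show "triv_proj N X k (propagate_adj X i k (T i b)) = propagate_adj X i k (T i b)"
      using rem[of k] step(1,2) by (simp add: remains_trivial_def)
  qed (use step(1) k i Tb g in auto)
  finally show ?case using step(1) by (simp add: propagate_adj_Suc)
qed

lemma next_slot:
  assumes i: "i \<le> D" and j: "j = next_slot N X i b"
  shows "i < j" "j \<le> Suc D" "j = Suc D \<or> \<not> remains_trivial N X i b j"
    "\<And>m. i < m \<Longrightarrow> m < j \<Longrightarrow> remains_trivial N X i b m"
proof -
  let ?P = "\<lambda>j. i < j \<and> (j = D + 1 \<or> \<not> remains_trivial N X i b j)"
  \<comment> \<open>Slot \<open>D + 1\<close> always qualifies, so the least element exists.\<close>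
  have P: "?P (D + 1)" using i by simp
  have j': "j = (LEAST j. ?P j)" by (simp add: j next_slot_def)
  have Pj: "?P j" unfolding j' by (rule LeastI[of ?P, OF P])
  then show "i < j" "j = Suc D \<or> \<not> remains_trivial N X i b j" by auto
  show jD: "j \<le> Suc D" unfolding j' using Least_le[of ?P, OF P] by simp
  show "remains_trivial N X i b m" if "i < m" "m < j" for m
    using not_less_Least[of m ?P] that jD unfolding j' by auto
qed

definition contraction :: "nat \<Rightarrow> label \<Rightarrow> label set" where
  "contraction i b = {c \<in> I (next_slot N X i b).
     hs (T i b) (propagate X i (next_slot N X i b) (T (next_slot N X i b) c)) \<noteq> 0}"

text \<open>Unitary gates preserve the norm, so the propagated operator is non-zero and has a
  non-zero coefficient. The search needs this because it reads the length of the list from the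
  answer for index 0, which is specified only if that entry exists.\<close>

lemma contraction_nonempty:
  assumes i: "1 \<le> i" "i \<le> D" and b: "b \<in> I i"
  shows "contraction i b \<noteq> {}"
proof
  assume e: "contraction i b = {}"
  define j where "j = next_slot N X i b"
  have j: "i < j" "j \<le> Suc D" using next_slot[OF i(2) j_def] by auto
  have Tb: "T i b \<in> carrier_mat N N" using i b by simp
  let ?A = "propagate_adj X i j (T i b)"
  have A: "?A \<in> carrier_mat N N" using i j Tb by simp
  have "hs ?A (T j c) = 0" if "c \<in> I j" for c
  proof -
    have "c \<notin> contraction i b" using e by simp
    then have "hs (T i b) (propagate X i j (T j c)) = 0" using that by (simp add: contraction_def j_def)
    then show ?thesis using that hs_propagate[of i j "T i b" "T j c"] i j Tb by simp
  qed
  then have "hs ?A ?A = 0"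
    using ob_parseval[OF op_basis A A, of j] i j by simp
  then show False
    using propagate_adj_norm[of i j "T i b"] i j Tb ob_orth[OF op_basis, of i b b] b by simp
qed

end

section \<open>Tree growth closes the recursion over runs\<close>

locale contractible_circuit = noisy_circuit +
  assumes growth: "tree_growth N X"
begin

text \<open>At slot \<open>D + 1\<close> nothing is charged, and the remaining basis sum resolves
  into one overlap with the initial state. At an earlier end slot tree growth leaves 0 as the only
  possible trivial projection, so every continuation is non-trivial and uses one unit of the
  budget.\<close>

lemma run_sum_eq:
  assumes i: "1 \<le> i" "i \<le> D" and b: "b \<in> I i" and g: "\<And>m. 1 \<le> m \<Longrightarrow> m \<le> D \<Longrightarrow> g m \<in> carrier G"
    and j: "j = next_slot N X i b"
  shows "run_sum g i b l = (if j = Suc D then hs (T i b) (propagate X i (Suc D) (zero_state N))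
    else if l = 0 then 0
    else \<Sum>c\<in>contraction i b. hs (T i b) (propagate X i j (T j c)) * tail_sum g j c (l - 1))"
proof -
  note nx = next_slot[OF i(2) j]
  have Tb: "T i b \<in> carrier_mat N N" using i b by simp
  define A where "A = propagate_adj X i j (T i b)"
  have A: "A \<in> carrier_mat N N" using i nx Tb by (simp add: A_def)
  have run: "run_sum g i b l = dual_sum g j A l"
    unfolding A_def using nx i b g by (intro run_sum_to) auto
  show ?thesis
  proof (cases "j = Suc D")
    case True
    have "run_sum g i b l = (\<Sum>c\<in>I j. hs A (T j c) * hs (T j c) (zero_state N))"
      unfolding run dual_sum_def True by (simp add: visit_def tail_sum_end final_def)
    also have "\<dots> = hs A (zero_state N)"
      using A True by (intro ob_parseval[OF op_basis, symmetric]) auto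
    also have "\<dots> = hs (T i b) (propagate X i (Suc D) (zero_state N))"
      unfolding A_def True using i Tb by (intro hs_propagate) auto
    finally show ?thesis using True by simp
  next
    case False
    then have jD: "j \<le> D" using nx by simp
    obtain j' where j': "j = Suc j'" "i \<le> j'" using nx(1) by (cases j) auto
    \<comment> \<open>\<open>j'\<close> is the last gate of the run. Minimality of the end slot
      supplies the premise of tree growth, that the operator stayed trivial at all slots after i up
      to \<open>j'\<close>.\<close>
    have "triv_proj N X (j' + 1) (propagate_adj X i (j' + 1) (T i b)) \<in> {0\<^sub>m N N, propagate_adj X i (j' + 1) (T i b)}"
      using growth i b j' jD nx(4) unfolding tree_growth_def by auto
    moreover have "triv_proj N X j A \<noteq> A" using nx(3) False by (simp add: remains_trivial_def A_def)
    ultimately have tp: "triv_proj N X j A = 0\<^sub>m N N" using j' by (simp add: A_def)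
    have triv: "hs A (T j c) = 0" if c: "c \<in> I j" "irrep_of c = 0" for c
    proof -
      have Tc: "T j c \<in> carrier_mat N N" using i nx c by simp
      have "cnj (hs (T j c) A) = hs (triv_proj N X j A) (T j c)" using triv_proj_coeff[of j c A] c i nx by simp
      also have "\<dots> = 0" unfolding tp using Tc by (simp add: hs_eq[of _ N])
      finally show ?thesis using hs_cnj[OF Tc A] by simp
    qed
    have hsA: "hs A (T j c) = hs (T i b) (propagate X i j (T j c))" if "c \<in> I j" for c
      unfolding A_def using i nx Tb that by (intro hs_propagate) auto
    have sub: "contraction i b \<subseteq> I j" by (auto simp: contraction_def j)
    have con: "c \<in> contraction i b \<longleftrightarrow> hs A (T j c) \<noteq> 0" if "c \<in> I j" for c
      using that hsA[OF that] by (simp add: contraction_def j)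
    have "run_sum g i b l = (\<Sum>c\<in>contraction i b. hs A (T j c) * visit g j c l)"
      unfolding run dual_sum_def using sub con i nx by (intro sum.mono_neutral_right) auto
    also have "\<dots> = (\<Sum>c\<in>contraction i b. hs (T i b) (propagate X i j (T j c)) * (if l = 0 then 0 else tail_sum g j c (l - 1)))"
    proof (rule sum.cong[OF refl])
      fix c assume c: "c \<in> contraction i b"
      then have cI: "c \<in> I j" using sub by auto
      have "irrep_of c \<noteq> 0" using triv[OF cI] con[OF cI] c by auto
      then show "hs A (T j c) * visit g j c l = hs (T i b) (propagate X i j (T j c)) * (if l = 0 then 0 else tail_sum g j c (l - 1))"
        using hsA[OF cI] jD by (simp add: visit_def)
    qed
    finally show ?thesis using False by simp
  qed
qed

end

section \<open>The path tree search\<close>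

lemmas exec_Seq = exec.intros(13)
  and exec_If_True = exec.intros(14)
  and exec_If_False = exec.intros(15)
  and exec_While_True = exec.intros(16)
  and exec_While_False = exec.intros(17)

fun while_free :: "prog \<Rightarrow> bool" where
  "while_free (WhileLess x y P) = False"
| "while_free (Seq P Q) = (while_free P \<and> while_free Q)"
| "while_free (IfLess x y P Q) = (while_free P \<and> while_free Q)"
| "while_free _ = True"

text \<open>With \<open>duration\<close>, an evaluator for loop-free programs, which lets
  simplification compute final store and time. The catch-all equation also matches loops, which
  \<open>while_free\<close> excludes.\<close>

fun effect :: "answers \<Rightarrow> prog \<Rightarrow> store \<Rightarrow> store" where
  "effect f (NConst x c) (M, Z) = (M(x := c), Z)"
| "effect f (NAdd x y z) (M, Z) = (M(x := M y + M z), Z)"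
| "effect f (NSub x y z) (M, Z) = (M(x := M y - M z), Z)"
| "effect f (NLoad x y) (M, Z) = (M(x := M (M y)), Z)"
| "effect f (NStore x y) (M, Z) = (M(M x := M y), Z)"
| "effect f (ZNat x y) (M, Z) = (M, Z(x := of_nat (M y)))"
| "effect f (ZAdd x y z) (M, Z) = (M, Z(x := Z y + Z z))"
| "effect f (ZMul x y z) (M, Z) = (M, Z(x := Z y * Z z))"
| "effect f (ZLoad x y) (M, Z) = (M, Z(x := Z (M y)))"
| "effect f (ZStore x y) (M, Z) = (M, Z(M x := Z y))"
| "effect f (Call q xs ys z) (M, Z) = (fold (\<lambda>(y, v) M'. M'(y := v)) (zip ys (fst (f q (map M xs)))) M,
     Z(z := snd (f q (map M xs))))"
| "effect f (Seq P Q) st = effect f Q (effect f P st)"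
| "effect f (IfLess x y P Q) st = (if fst st x < fst st y then effect f P st else effect f Q st)"
| "effect f _ st = st"

fun duration :: "answers \<Rightarrow> (subroutine \<Rightarrow> nat) \<Rightarrow> prog \<Rightarrow> store \<Rightarrow> nat" where
  "duration f cost Skip st = 0"
| "duration f cost (Call q xs ys z) st = cost q"
| "duration f cost (Seq P Q) st = duration f cost P st + duration f cost Q (effect f P st)"
| "duration f cost (IfLess x y P Q) st =
     1 + (if fst st x < fst st y then duration f cost P st else duration f cost Q st)"
| "duration f cost _ st = 1"

lemma exec_while_free: "while_free P \<Longrightarrow> exec f cost P st (duration f cost P st) (effect f P st)"
proof (induction P arbitrary: st)
  case (Call q xs ys z)
  obtain M Z where st: "st = (M, Z)" by (cases st)
  show ?case unfolding st
    using exec.intros(12)[of f q M xs "fst (f q (map M xs))" "snd (f q (map M xs))"] by simp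
next
  case (Seq P Q)
  then show ?case using exec_Seq[OF Seq.IH(1) Seq.IH(2)] by simp
next
  case (IfLess x y P Q)
  show ?case
  proof (cases "fst st x < fst st y")
    case True
    then show ?thesis using exec_If_True[OF True IfLess.IH(1)] IfLess.prems by simp
  next
    case False
    then show ?thesis using exec_If_False[OF False IfLess.IH(2)] IfLess.prems by simp
  qed
qed (case_tac st; simp del: One_nat_def; rule exec.intros)+

lemma exec_while_freeI:
  "while_free P \<Longrightarrow> duration f cost P st = t \<Longrightarrow> effect f P st = st' \<Longrightarrow> exec f cost P st t st'"
  using exec_while_free by metis

text \<open>The invariant records the round and the time spent so far, including one unit per
  successful test; the final \<open>+ 1\<close> is the failing test.\<close>

lemma exec_for:
  assumes step: "\<And>p t st. p < n \<Longrightarrow> Q p t st \<Longrightarrow> fst st x < fst st y \<and>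
      (\<exists>u st'. exec f cost P st u st' \<and> Q (Suc p) (t + 1 + u) st')"
    and final: "\<And>t st. Q n t st \<Longrightarrow> \<not> fst st x < fst st y"
    and start: "Q 0 0 st"
  shows "\<exists>t st'. exec f cost (WhileLess x y P) st (t + 1) st' \<and> Q n t st'"
proof -
  have "\<exists>t' st'. exec f cost (WhileLess x y P) st (t' + 1) st' \<and> Q n (t + t') st'"
    if "p \<le> n" "Q p t st" for p t st
    using that
  proof (induction p arbitrary: t st rule: inc_induct)
    case base
    then show ?case using final[of t st] exec_While_False[of st x y f cost P] by (intro exI[of _ 0] exI[of _ st]) auto
  next
    case (step p)
    obtain u st1 where 1: "fst st x < fst st y" "exec f cost P st u st1" "Q (Suc p) (t + 1 + u) st1"
      using assms(1)[OF step(2,4)] by blast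
    obtain t' st' where 2: "exec f cost (WhileLess x y P) st1 (t' + 1) st'" "Q n (t + 1 + u + t') st'"
      using step(3)[OF 1(3)] by blast
    have "exec f cost (WhileLess x y P) st (1 + u + (t' + 1)) st'"
      by (rule exec_While_True[OF 1(1,2) 2(1)])
    then show ?case using 2(2) by (intro exI[of _ "1 + u + t'"] exI[of _ st']) (simp add: add_ac)
  qed
  from this[OF _ start] show ?thesis by simp
qed

text \<open>\<open>e\<close> is a ghost description of the store, later the list of pending nodes. A
  round lowers the potential by at least its own duration including the test, so termination and
  time bound come from the same induction.\<close>

lemma exec_while_potential:
  assumes step: "\<And>e st. Q e st \<Longrightarrow> fst st x < fst st y \<Longrightarrow>
      \<exists>u e' st'. exec f cost P st u st' \<and> Q e' st' \<and> 1 + u + \<Phi> e' \<le> (\<Phi> e :: nat)"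
    and start: "Q e st"
  shows "\<exists>t e' st'. exec f cost (WhileLess x y P) st t st' \<and> Q e' st' \<and> \<not> fst st' x < fst st' y \<and> t \<le> \<Phi> e + 1"
  using start
proof (induction "\<Phi> e" arbitrary: e st rule: less_induct)
  case less
  show ?case
  proof (cases "fst st x < fst st y")
    case False
    then show ?thesis using exec_While_False[OF False] less(2) by (intro exI[of _ 1] exI[of _ e] exI[of _ st]) auto
  next
    case True
    obtain u e1 st1 where 1: "exec f cost P st u st1" "Q e1 st1" "1 + u + \<Phi> e1 \<le> \<Phi> e"
      using step[OF less(2) True] by blast
    obtain t e' st' where 2: "exec f cost (WhileLess x y P) st1 t st'" "Q e' st'" "\<not> fst st' x < fst st' y" "t \<le> \<Phi> e1 + 1"
      using less(1)[OF _ 1(2)] 1(3) by auto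
    have "exec f cost (WhileLess x y P) st (1 + u + t) st'" by (rule exec_While_True[OF True 1(1) 2(1)])
    then show ?thesis using 1(3) 2 by (intro exI[of _ "1 + u + t"] exI[of _ e'] exI[of _ st']) auto
  qed
qed

section \<open>Straight-line blocks and the stack\<close>

fun seqs :: "prog list \<Rightarrow> prog" where
  "seqs [] = Skip"
| "seqs (P # Ps) = Seq P (seqs Ps)"

lemma duration_seqs:
  "(\<And>P st. P \<in> set Ps \<Longrightarrow> duration f cost P st = 1) \<Longrightarrow> duration f cost (seqs Ps) st = length Ps"
  by (induction Ps arbitrary: st) auto

text \<open>
  Pending nodes \<open>(i, b, l, w)\<close> of the path tree: slot, basis operator, number of non-trivial operators
  still allowed, weight of the partial path. Each takes five cells of the stack, which starts at
  address \<open>32\<close>; register \<open>6\<close> is the stack pointer and register \<open>4\<close> holds the constant \<open>1\<close>.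
\<close>

type_synonym node = "nat \<times> label \<times> nat \<times> complex"

fun node_at :: "store \<Rightarrow> nat \<Rightarrow> node \<Rightarrow> bool" where
  "node_at (M, Z) p (i, (l, a, k), n, w) \<longleftrightarrow>
     M p = i \<and> M (p + 1) = l \<and> M (p + 2) = a \<and> M (p + 3) = k \<and> M (p + 4) = n \<and> Z p = w"

definition stack :: "node list \<Rightarrow> store \<Rightarrow> bool" where
  "stack es st \<longleftrightarrow> fst st 6 = 32 + 5 * length es \<and> (\<forall>q<length es. node_at st (32 + 5 * q) (es ! q))"

definition push :: "nat \<Rightarrow> nat \<Rightarrow> nat \<Rightarrow> nat \<Rightarrow> nat \<Rightarrow> nat \<Rightarrow> prog" where
  "push i l a k n w = seqs [ZStore 6 w, NStore 6 i, NAdd 6 6 4, NStore 6 l, NAdd 6 6 4, NStore 6 a,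
     NAdd 6 6 4, NStore 6 k, NAdd 6 6 4, NStore 6 n, NAdd 6 6 4]"

definition pop :: prog where
  "pop = seqs [NSub 6 6 4, NLoad 14 6, NSub 6 6 4, NLoad 13 6, NSub 6 6 4, NLoad 12 6, NSub 6 6 4,
     NLoad 11 6, NSub 6 6 4, NLoad 10 6, ZLoad 1 6]"

lemma node_at_cong:
  assumes "\<And>m. p \<le> m \<Longrightarrow> m < p + 5 \<Longrightarrow> M' m = M m" "Z' p = Z p"
  shows "node_at (M', Z') p e = node_at (M, Z) p e"
  using assms by (cases e) auto

text \<open>The source registers lie below the stack and differ from the moving pointer, so no write
  of the block destroys a value that is still to be stored.\<close>

lemma exec_push:
  assumes st: "stack es (M, Z)" and one: "M 4 = 1"
    and regs: "i < 32" "l < 32" "a < 32" "k < 32" "n < 32" "w < 32" "i \<noteq> 6" "l \<noteq> 6" "a \<noteq> 6" "k \<noteq> 6" "n \<noteq> 6"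
  shows "\<exists>M' Z'. exec f cost (push i l a k n w) (M, Z) 11 (M', Z') \<and>
    stack (es @ [(M i, (M l, M a, M k), M n, Z w)]) (M', Z') \<and>
    (\<forall>x<32. x \<noteq> 6 \<longrightarrow> M' x = M x) \<and> (\<forall>x<32. Z' x = Z x)"
proof -
  define p where "p = 32 + 5 * length es"
  have p: "M 6 = p" "p \<ge> 32" using st by (auto simp: stack_def p_def)
  define M' where "M' = M(p := M i, p + 1 := M l, p + 2 := M a, p + 3 := M k, p + 4 := M n, 6 := p + 5)"
  define Z' where "Z' = Z(p := Z w)"
  have "exec f cost (push i l a k n w) (M, Z) 11 (M', Z')"
  proof (rule exec_while_freeI)
    show "effect f (push i l a k n w) (M, Z) = (M', Z')"
      unfolding push_def M'_def Z'_def using p one regs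
      by (auto simp: fun_eq_iff)
    show "duration f cost (push i l a k n w) (M, Z) = 11"
      unfolding push_def by (subst duration_seqs) auto
  qed (simp add: push_def)
  moreover have "stack (es @ [(M i, (M l, M a, M k), M n, Z w)]) (M', Z')"
    unfolding stack_def
  proof (intro conjI allI impI)
    show "fst (M', Z') 6 = 32 + 5 * length (es @ [(M i, (M l, M a, M k), M n, Z w)])"
      by (simp add: M'_def p_def)
    fix q assume q: "q < length (es @ [(M i, (M l, M a, M k), M n, Z w)])"
    show "node_at (M', Z') (32 + 5 * q) ((es @ [(M i, (M l, M a, M k), M n, Z w)]) ! q)"
    proof (cases "q < length es")
      case True
      have "node_at (M', Z') (32 + 5 * q) (es ! q) = node_at (M, Z) (32 + 5 * q) (es ! q)"
        by (rule node_at_cong) (use True in \<open>auto simp: M'_def Z'_def p_def\<close>)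
      then show ?thesis using True st by (simp add: stack_def nth_append)
    next
      case False
      then have "q = length es" using q by simp
      then show ?thesis by (auto simp: M'_def Z'_def p_def)
    qed
  qed
  moreover have "\<forall>x<32. x \<noteq> 6 \<longrightarrow> M' x = M x" "\<forall>x<32. Z' x = Z x"
    using p by (auto simp: M'_def Z'_def)
  ultimately show ?thesis by blast
qed

lemma exec_pop:
  assumes st: "stack (es @ [(i, (l, a, k), n, w)]) (M, Z)" and one: "M 4 = 1"
  shows "\<exists>M' Z'. exec f cost pop (M, Z) 11 (M', Z') \<and> stack es (M', Z') \<and>
    M' 10 = i \<and> M' 11 = l \<and> M' 12 = a \<and> M' 13 = k \<and> M' 14 = n \<and> Z' 1 = w \<and>
    (\<forall>x<32. x \<notin> {6, 10, 11, 12, 13, 14} \<longrightarrow> M' x = M x) \<and> (\<forall>x<32. x \<noteq> 1 \<longrightarrow> Z' x = Z x)"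
proof -
  define p where "p = 32 + 5 * length es"
  have p: "M 6 = p + 5" "p \<ge> 32" using st by (auto simp: stack_def p_def)
  have "node_at (M, Z) p (i, (l, a, k), n, w)"
    using st by (auto simp: stack_def p_def dest: spec[of _ "length es"])
  then have e: "M p = i" "M (Suc p) = l" "M (p + 2) = a" "M (p + 3) = k" "M (p + 4) = n" "Z p = w"
    by auto
  define M' where "M' = M(14 := n, 13 := k, 12 := a, 11 := l, 10 := i, 6 := p)"
  define Z' where "Z' = Z(1 := w)"
  have "exec f cost pop (M, Z) 11 (M', Z')"
  proof (rule exec_while_freeI)
    show "effect f pop (M, Z) = (M', Z')"
      unfolding pop_def M'_def Z'_def using p one e
      by (auto simp: fun_eq_iff eval_nat_numeral)
    show "duration f cost pop (M, Z) = 11"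
      unfolding pop_def by (subst duration_seqs) auto
  qed (simp add: pop_def)
  moreover have "stack es (M', Z')"
    unfolding stack_def
  proof (intro conjI allI impI)
    fix q assume q: "q < length es"
    have "node_at (M', Z') (32 + 5 * q) (es ! q) = node_at (M, Z) (32 + 5 * q) (es ! q)"
      by (rule node_at_cong) (auto simp: M'_def Z'_def)
    then show "node_at (M', Z') (32 + 5 * q) (es ! q)" using q st by (auto simp: stack_def nth_append dest: spec[of _ q])
  qed (simp add: M'_def p_def)
  ultimately show ?thesis by (intro exI[of _ M'] exI[of _ Z']) (auto simp: M'_def Z'_def)
qed

lemma stack_cong:
  assumes "stack es (M, Z)" "M' 6 = M 6" "\<And>x. x \<ge> 32 \<Longrightarrow> M' x = M x" "\<And>x. x \<ge> 32 \<Longrightarrow> Z' x = Z x"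
  shows "stack es (M', Z')"
  unfolding stack_def
proof (intro conjI allI impI)
  fix q assume q: "q < length es"
  have "node_at (M', Z') (32 + 5 * q) (es ! q) = node_at (M, Z) (32 + 5 * q) (es ! q)"
    by (rule node_at_cong) (auto simp: assms)
  then show "node_at (M', Z') (32 + 5 * q) (es ! q)" using q assms(1) by (simp add: stack_def)
qed (use assms in \<open>simp add: stack_def\<close>)

text \<open>Register convention: 3 and 4 hold the constants 0 and 1, 5 the depth plus one, 7 the
  stack base; 10 to 14 the popped node, 15 the number of children, 16 a loop counter, 17 the irrep
  dimension, 18 the current row, 19 to 22 slot and label of a child, 23 its budget. Complex cell 0
  accumulates the result, 1 holds the weight of the node times its noise eigenvalue, 2 that product
  times the matrix coefficient, 3 is scratch.\<close>

definition expand_child :: prog where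
  "expand_child = Seq (seqs [Call QContract [10, 11, 12, 18, 16] [15, 19, 20, 21, 22] 3, ZMul 3 2 3])
     (Seq (push 19 20 21 22 23 3) (NAdd 16 16 4))"

definition expand :: prog where
  "expand = Seq (seqs [NSub 23 14 4, NConst 16 0]) (WhileLess 16 15 expand_child)"

text \<open>The contraction with index 0 is made to learn the number of children and the end slot.
  If the run reaches the last slot, the overlap is added to the result; otherwise children are
  pushed, provided the budget is positive.\<close>

definition column :: prog where
  "column = Seq (seqs [Call QCoeff [10, 11, 13, 18] [] 2, ZMul 2 1 2,
       Call QContract [10, 11, 12, 18, 3] [15, 19, 20, 21, 22] 3])
     (Seq (IfLess 19 5 (IfLess 3 14 expand Skip)
         (seqs [Call QOverlap [10, 11, 12, 18] [] 3, ZMul 3 2 3, ZAdd 0 0 3]))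
       (NAdd 18 18 4))"

definition process :: prog where
  "process = Seq pop (Seq (seqs [Call QNoise [10, 11, 12, 13] [] 2, ZMul 1 1 2,
     Call QDim [10, 11] [17] 3, NConst 18 0]) (WhileLess 18 17 column))"

definition root :: prog where
  "root = Seq (seqs [Call QObs [16] [11, 12, 13] 1, NAdd 14 1 3,
     IfLess 3 11 (NSub 14 1 4) Skip, NAdd 10 4 3]) (Seq (push 10 11 12 13 14 1) (NAdd 16 16 4))"

definition path_program :: prog where
  "path_program = Seq (seqs [NConst 3 0, NConst 4 1, NAdd 5 2 4, NConst 7 32, NConst 6 32, NConst 16 0])
     (Seq (WhileLess 16 0 root) (WhileLess 7 6 process))"

lemma exec_NAdd_const:
  "M 4 = 1 \<Longrightarrow> exec f cost (NAdd x x 4) (M, Z) 1 (M(x := M x + 1), Z)"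
  by (metis exec.intros(3))

text \<open>Hides the circuit behind what the search uses: the answers of the subroutines, the shape
  of the tree and the recursion \<open>val_eq\<close> for the values. \<open>valid\<close> marks the
  nodes for which answers are specified. A node has one column per row of its irrep, and each column
  has its own list of children at its own end slot.\<close>

locale path_tree =
  fixes f :: answers and cost :: "subroutine \<Rightarrow> nat" and D :: nat and d s :: nat
    and valid :: "nat \<Rightarrow> label \<Rightarrow> bool" and dm :: "nat \<Rightarrow> nat \<Rightarrow> nat"
    and nei :: "nat \<Rightarrow> label \<Rightarrow> complex" and cf :: "nat \<Rightarrow> label \<Rightarrow> nat \<Rightarrow> complex"
    and nxt :: "nat \<Rightarrow> label \<Rightarrow> nat" and ch :: "nat \<Rightarrow> label \<Rightarrow> label list"
    and me :: "nat \<Rightarrow> label \<Rightarrow> label \<Rightarrow> complex" and ovl :: "nat \<Rightarrow> label \<Rightarrow> complex"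
    and val :: "nat \<Rightarrow> label \<Rightarrow> nat \<Rightarrow> complex"
  assumes noise: "valid i (l, a, k) \<Longrightarrow> f QNoise [i, l, a, k] = ([], nei i (l, a, k))"
    and dim: "valid i (l, a, k) \<Longrightarrow> f QDim [i, l] = ([dm i l], 0)"
    and coeff: "valid i (l, a, k) \<Longrightarrow> k' < dm i l \<Longrightarrow> f QCoeff [i, l, k, k'] = ([], cf i (l, a, k) k')"
    and overlap: "valid i (l, a, k) \<Longrightarrow> f QOverlap [i, l, a, k] = ([], ovl i (l, a, k))"
    and contract: "valid i (l, a, k) \<Longrightarrow> p < length (ch i (l, a, k)) \<Longrightarrow> f QContract [i, l, a, k, p] =
      (length (ch i (l, a, k)) # nxt i (l, a, k) # code_of (ch i (l, a, k) ! p), me i (l, a, k) (ch i (l, a, k) ! p))"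
    and valid_column: "valid i (l, a, k) \<Longrightarrow> k' < dm i l \<Longrightarrow> valid i (l, a, k')"
    and valid_child: "valid i b \<Longrightarrow> nxt i b \<le> D \<Longrightarrow> c \<in> set (ch i b) \<Longrightarrow> valid (nxt i b) c"
    and nxt_le: "valid i b \<Longrightarrow> nxt i b \<le> Suc D"
    and ch_nonempty: "valid i b \<Longrightarrow> ch i b \<noteq> []"
    and ch_length: "valid i b \<Longrightarrow> length (ch i b) \<le> s"
    and dm_pos: "valid i (l, a, k) \<Longrightarrow> 1 \<le> dm i l"
    and dm_le: "valid i (l, a, k) \<Longrightarrow> dm i l \<le> d"
    and val_eq: "valid i (l, a, k) \<Longrightarrow> val i (l, a, k) n = nei i (l, a, k) * (\<Sum>k'<dm i l. cf i (l, a, k) k' *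
      (if nxt i (l, a, k') = Suc D then ovl i (l, a, k') else if n = 0 then 0
       else \<Sum>c\<leftarrow>ch i (l, a, k'). me i (l, a, k') c * val (nxt i (l, a, k')) c (n - 1)))"
    and cost_pos: "1 \<le> cost QContract"
    and cost_unit: "cost QObs = 1" "cost QDim = 1"
begin

definition run_val :: "nat \<Rightarrow> label \<Rightarrow> nat \<Rightarrow> complex" where
  "run_val i b n = (if nxt i b = Suc D then ovl i b else if n = 0 then 0
     else \<Sum>c\<leftarrow>ch i b. me i b c * val (nxt i b) c (n - 1))"

text \<open>
  The factor \<open>40\<close> pays for all basic instructions between two subroutine calls, as every contraction
  takes at least one time unit.
\<close>

definition step_cost :: nat where
  "step_cost = 40 * (cost QContract + cost QCoeff + cost QNoise)"

text \<open>Time allowed for one column of a node with budget n and everything below it: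
  \<open>(s * d) ^ n\<close> branches, each paying n + 1 steps and one overlap. The columns of all
  children together take \<open>s * d * potential (n - 1)\<close>, which leaves
  \<open>(s * d) ^ n * step_cost\<close> for the column itself.\<close>

definition potential :: "nat \<Rightarrow> nat" where
  "potential n = (s * d) ^ n * ((n + 1) * step_cost + cost QOverlap)"

fun node_valid :: "node \<Rightarrow> bool" where
  "node_valid (i, b, n, w) = valid i b"

fun node_val :: "node \<Rightarrow> complex" where
  "node_val (i, b, n, w) = w * val i b n"

fun node_pot :: "node \<Rightarrow> nat" where
  "node_pot (i, (l, a, k), n, w) = dm i l * potential n"

abbreviation "total_val es \<equiv> \<Sum>e\<leftarrow>es. node_val e"
abbreviation "total_pot es \<equiv> \<Sum>e\<leftarrow>es. node_pot e"

definition const_regs :: "(nat \<Rightarrow> nat) \<Rightarrow> bool" where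
  "const_regs M \<longleftrightarrow> M 3 = 0 \<and> M 4 = 1 \<and> M 5 = Suc D \<and> M 7 = 32"

lemma exec_expand:
  assumes st: "stack es (M, Z)" and cs: "const_regs M" and v: "valid i (l, a, k)"
    and M: "M 10 = i" "M 11 = l" "M 12 = a" "M 18 = k" "M 14 = n" "M 15 = length (ch i (l, a, k))"
  shows "\<exists>M' Z'. exec f cost expand (M, Z) (3 + length (ch i (l, a, k)) * (14 + cost QContract)) (M', Z') \<and>
    stack (es @ map (\<lambda>c. (nxt i (l, a, k), c, n - 1, Z 2 * me i (l, a, k) c)) (ch i (l, a, k))) (M', Z') \<and>
    (\<forall>x<32. x \<notin> {6, 15, 16, 19, 20, 21, 22, 23} \<longrightarrow> M' x = M x) \<and> (\<forall>x<32. x \<noteq> 3 \<longrightarrow> Z' x = Z x)"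
proof -
  define C where "C = ch i (l, a, k)"
  let ?node = "\<lambda>c. (nxt i (l, a, k), c, n - 1, Z 2 * me i (l, a, k) c)"
  let ?F = "{6, 15, 16, 19, 20, 21, 22, 23} :: nat set"
  define Q where "Q p t st \<longleftrightarrow> (\<exists>M' Z'. st = (M', Z') \<and> M' 15 = length C \<and> M' 16 = p \<and> M' 23 = n - 1 \<and>
    t = p * (14 + cost QContract) \<and> stack (es @ map ?node (take p C)) (M', Z') \<and>
    (\<forall>x<32. x \<notin> ?F \<longrightarrow> M' x = M x) \<and> (\<forall>x<32. x \<noteq> 3 \<longrightarrow> Z' x = Z x))" for p t st
  define M0 where "M0 = M(23 := n - 1, 16 := 0)"
  have e0: "exec f cost (seqs [NSub 23 14 4, NConst 16 0]) (M, Z) 2 (M0, Z)"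
    by (rule exec_while_freeI) (use M cs in \<open>auto simp: M0_def const_regs_def fun_eq_iff\<close>)
  have "\<exists>t st'. exec f cost (WhileLess 16 15 expand_child) (M0, Z) (t + 1) st' \<and> Q (length C) t st'"
  proof (rule exec_for)
    show "Q 0 0 (M0, Z)"
      unfolding Q_def using M stack_cong[OF st, of M0 Z]
      by (intro exI[of _ M0] exI[of _ Z]) (auto simp: M0_def C_def)
    show "\<not> fst st 16 < fst st 15" if "Q (length C) t st" for t st
      using that by (auto simp: Q_def)
    fix p t st assume p: "p < length C" and "Q p t st"
    then obtain M1 Z1 where st1: "st = (M1, Z1)" and M1: "M1 15 = length C" "M1 16 = p" "M1 23 = n - 1"
      and t: "t = p * (14 + cost QContract)" and stk: "stack (es @ map ?node (take p C)) (M1, Z1)"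
      and fr: "\<And>x. x < 32 \<Longrightarrow> x \<notin> ?F \<Longrightarrow> M1 x = M x" "\<And>x. x < 32 \<Longrightarrow> x \<noteq> 3 \<Longrightarrow> Z1 x = Z x"
      unfolding Q_def by blast
    obtain l' a' k' where c: "C ! p = (l', a', k')" by (cases "C ! p")
    define M2 where "M2 = M1(15 := length C, 19 := nxt i (l, a, k), 20 := l', 21 := a', 22 := k')"
    define Z2 where "Z2 = Z1(3 := Z 2 * me i (l, a, k) (l', a', k'))"
    have r: "M1 10 = i" "M1 11 = l" "M1 12 = a" "M1 18 = k" "M1 4 = 1" "Z1 2 = Z 2"
      using fr M cs by (auto simp: const_regs_def)
    have ans: "f QContract [i, l, a, k, p] = ([length C, nxt i (l, a, k), l', a', k'], me i (l, a, k) (l', a', k'))"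
      using contract[OF v, of p] p c by (simp add: C_def)
    have e1: "exec f cost (seqs [Call QContract [10, 11, 12, 18, 16] [15, 19, 20, 21, 22] 3, ZMul 3 2 3]) (M1, Z1)
      (cost QContract + 1) (M2, Z2)"
      by (rule exec_while_freeI) (use r ans M1 in \<open>auto simp: M2_def Z2_def fun_eq_iff\<close>)
    have stk2: "stack (es @ map ?node (take p C)) (M2, Z2)"
      by (rule stack_cong[OF stk]) (auto simp: M2_def Z2_def)
    obtain M3 Z3 where e2: "exec f cost (push 19 20 21 22 23 3) (M2, Z2) 11 (M3, Z3)"
      and stk3: "stack ((es @ map ?node (take p C)) @ [(M2 19, (M2 20, M2 21, M2 22), M2 23, Z2 3)]) (M3, Z3)"
      and fr3: "\<And>x. x < 32 \<Longrightarrow> x \<noteq> 6 \<Longrightarrow> M3 x = M2 x" "\<And>x. x < 32 \<Longrightarrow> Z3 x = Z2 x"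
      using exec_push[OF stk2, of 19 20 21 22 23 3 f cost] r by (auto simp: M2_def)
    define M4 where "M4 = M3(16 := p + 1)"
    have "M3 4 = 1" "M3 16 = p" using fr3 r M1 by (auto simp: M2_def)
    then have e3: "exec f cost (NAdd 16 16 4) (M3, Z3) 1 (M4, Z3)"
      using exec_NAdd_const[of M3 f cost 16 Z3] by (simp add: M4_def)
    have ex: "exec f cost expand_child (M1, Z1) (cost QContract + 1 + (11 + 1)) (M4, Z3)"
      unfolding expand_child_def by (intro exec_Seq[OF e1] exec_Seq[OF e2] e3)
    have "Q (Suc p) (t + 1 + (cost QContract + 1 + (11 + 1))) (M4, Z3)"
      unfolding Q_def
    proof (intro exI[of _ M4] exI[of _ Z3] conjI)
      have "(es @ map ?node (take p C)) @ [(M2 19, (M2 20, M2 21, M2 22), M2 23, Z2 3)] = es @ map ?node (take (Suc p) C)"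
        using p c M1 by (simp add: take_Suc_conv_app_nth M2_def Z2_def)
      then show "stack (es @ map ?node (take (Suc p) C)) (M4, Z3)"
        using stack_cong[OF stk3, of M4 Z3] by (simp add: M4_def)
      show "\<forall>x<32. x \<notin> ?F \<longrightarrow> M4 x = M x"
        using fr3(1) fr(1) by (auto simp: M4_def M2_def)
      show "\<forall>x<32. x \<noteq> 3 \<longrightarrow> Z3 x = Z x" using fr3(2) fr(2) by (auto simp: Z2_def)
    qed (use fr3 M1 t in \<open>auto simp: M4_def M2_def\<close>)
    moreover have "fst st 16 < fst st 15" using p M1 by (simp add: st1)
    ultimately show "fst st 16 < fst st 15 \<and> (\<exists>u st'. exec f cost expand_child st u st' \<and> Q (Suc p) (t + 1 + u) st')"
      using ex unfolding st1 by blast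
  qed
  then obtain t st' where e1: "exec f cost (WhileLess 16 15 expand_child) (M0, Z) (t + 1) st'" and "Q (length C) t st'"
    by blast
  then obtain M' Z' where st': "st' = (M', Z')" and t: "t = length C * (14 + cost QContract)"
    and q: "stack (es @ map ?node (take (length C) C)) (M', Z')"
      "\<forall>x<32. x \<notin> ?F \<longrightarrow> M' x = M x" "\<forall>x<32. x \<noteq> 3 \<longrightarrow> Z' x = Z x"
    unfolding Q_def by blast
  have "exec f cost expand (M, Z) (2 + (t + 1)) (M', Z')"
    unfolding expand_def using e0 e1 unfolding st' by (rule exec_Seq)
  moreover have "2 + (t + 1) = 3 + length (ch i (l, a, k)) * (14 + cost QContract)" by (simp add: t C_def)
  ultimately have "exec f cost expand (M, Z) (3 + length C * (14 + cost QContract)) (M', Z')"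
    by (simp only: C_def)
  moreover have "stack (es @ map ?node C) (M', Z')" using q(1) by simp
  ultimately show ?thesis using q(2,3) unfolding C_def by blast
qed

lemma potential_ge: "valid i (l, a, k) \<Longrightarrow> step_cost + cost QOverlap \<le> potential n"
proof -
  assume v: "valid i (l, a, k)"
  have "1 \<le> s * d" using ch_length[OF v] ch_nonempty[OF v] dm_le[OF v] dm_pos[OF v]
    by (cases "ch i (l, a, k)") (auto simp: Suc_le_eq)
  then have "1 \<le> (s * d) ^ n" by simp
  then have "1 * (1 * step_cost + cost QOverlap) \<le> potential n"
    unfolding potential_def by (intro mult_mono add_mono) auto
  then show ?thesis by simp
qed

text \<open>The \<open>17 + cost QNoise\<close> set aside belongs to the caller: one unit for the
  loop test of this column, the rest towards the overhead of the node.\<close>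

lemma exec_column:
  assumes st: "stack es (M, Z)" and cs: "const_regs M" and v: "valid i (l, a, k)" and k': "k' < dm i l"
    and M: "M 10 = i" "M 11 = l" "M 12 = a" "M 13 = k" "M 14 = n" "M 18 = k'"
  shows "\<exists>t M' Z' new. exec f cost column (M, Z) t (M', Z') \<and> stack (es @ new) (M', Z') \<and>
    (\<forall>e\<in>set new. node_valid e) \<and>
    Z' 0 + total_val new = Z 0 + Z 1 * (cf i (l, a, k) k' * run_val i (l, a, k') n) \<and>
    17 + cost QNoise + t + total_pot new \<le> potential n \<and>
    M' 18 = Suc k' \<and> (\<forall>x<32. x \<notin> {6, 15, 16, 18, 19, 20, 21, 22, 23} \<longrightarrow> M' x = M x) \<and> Z' 1 = Z 1"
proof -
  let ?b = "(l, a, k')"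
  let ?F = "{6, 15, 16, 18, 19, 20, 21, 22, 23} :: nat set"
  have vb: "valid i ?b" by (rule valid_column[OF v k'])
  define C where "C = ch i ?b"
  have C: "0 < length C" using ch_nonempty[OF vb] by (simp add: C_def)
  obtain l0 a0 k0 where c0: "C ! 0 = (l0, a0, k0)" by (cases "C ! 0")
  define M1 where "M1 = M(15 := length C, 19 := nxt i ?b, 20 := l0, 21 := a0, 22 := k0)"
  define Z1 where "Z1 = Z(2 := Z 1 * cf i (l, a, k) k', 3 := me i ?b (l0, a0, k0))"
  have ans: "f QContract [i, l, a, k', 0] = ([length C, nxt i ?b, l0, a0, k0], me i ?b (l0, a0, k0))"
    using contract[OF vb, of 0] C c0 by (simp add: C_def)
  have c: "M 3 = 0" "M 4 = 1" "M 5 = Suc D" using cs by (auto simp: const_regs_def)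
  have e1: "exec f cost (seqs [Call QCoeff [10, 11, 13, 18] [] 2, ZMul 2 1 2,
      Call QContract [10, 11, 12, 18, 3] [15, 19, 20, 21, 22] 3]) (M, Z) (cost QCoeff + 1 + cost QContract) (M1, Z1)"
    by (rule exec_while_freeI) (use M c ans coeff[OF v k'] in \<open>auto simp: M1_def Z1_def fun_eq_iff\<close>)
  have st1: "stack es (M1, Z1)" by (rule stack_cong[OF st]) (auto simp: M1_def Z1_def)
  have cs1: "const_regs M1" using cs by (simp add: const_regs_def M1_def)
  have M1: "M1 10 = i" "M1 11 = l" "M1 12 = a" "M1 18 = k'" "M1 14 = n" "M1 15 = length C" "M1 19 = nxt i ?b" "M1 3 = 0" "M1 5 = Suc D"
    using M c by (auto simp: M1_def)
  let ?branch = "IfLess 19 5 (IfLess 3 14 expand Skip) (seqs [Call QOverlap [10, 11, 12, 18] [] 3, ZMul 3 2 3, ZAdd 0 0 3])"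
  \<comment> \<open>19 is the reserve of 17 plus the multiplication before and the increment after
    the branch.\<close>
  have "\<exists>t M' Z' new. exec f cost ?branch (M1, Z1) t (M', Z') \<and> stack (es @ new) (M', Z') \<and>
    (\<forall>e\<in>set new. node_valid e) \<and>
    Z' 0 + total_val new = Z 0 + Z 1 * (cf i (l, a, k) k' * run_val i ?b n) \<and>
    19 + cost QNoise + cost QCoeff + cost QContract + t + total_pot new \<le> potential n \<and>
    (\<forall>x<32. x \<notin> {6, 15, 16, 19, 20, 21, 22, 23} \<longrightarrow> M' x = M1 x) \<and> Z' 1 = Z 1"
  proof (cases "nxt i ?b < Suc D")
    case False
    then have nx: "nxt i ?b = Suc D" using nxt_le[OF vb] by simp
    define Z2 where "Z2 = Z1(3 := Z1 2 * ovl i ?b, 0 := Z 0 + Z1 2 * ovl i ?b)"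
    have "exec f cost (seqs [Call QOverlap [10, 11, 12, 18] [] 3, ZMul 3 2 3, ZAdd 0 0 3]) (M1, Z1) (cost QOverlap + 2) (M1, Z2)"
      by (rule exec_while_freeI) (use M1 overlap[OF vb] in \<open>auto simp: Z2_def Z1_def fun_eq_iff\<close>)
    then have "exec f cost ?branch (M1, Z1) (1 + (cost QOverlap + 2)) (M1, Z2)"
      by (rule exec_If_False[rotated]) (use M1 nx in auto)
    moreover have "stack (es @ []) (M1, Z2)" using stack_cong[OF st1, of M1 Z2] by (auto simp: Z2_def)
    moreover have "19 + cost QNoise + cost QCoeff + cost QContract + (1 + (cost QOverlap + 2)) \<le> potential n"
      using potential_ge[OF v, of n] cost_pos by (simp add: step_cost_def)
    moreover have "Z2 0 = Z 0 + Z 1 * (cf i (l, a, k) k' * run_val i ?b n)" "Z2 1 = Z 1"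
      using nx by (auto simp: Z2_def Z1_def run_val_def)
    ultimately show ?thesis
      by (intro exI[of _ "1 + (cost QOverlap + 2)"] exI[of _ M1] exI[of _ Z2] exI[of _ "[]"]) simp
  next
    case True
    show ?thesis
    proof (cases "n = 0")
      case n: True
      have "exec f cost (IfLess 3 14 expand Skip) (M1, Z1) (1 + 0) (M1, Z1)"
        by (rule exec_If_False[OF _ exec.intros(1)]) (use M1 n in auto)
      then have "exec f cost ?branch (M1, Z1) (1 + (1 + 0)) (M1, Z1)"
        by (rule exec_If_True[rotated]) (use M1 True in auto)
      moreover have "19 + cost QNoise + cost QCoeff + cost QContract + (1 + (1 + 0)) \<le> potential n"
        using potential_ge[OF v, of n] cost_pos by (simp add: step_cost_def)
      moreover have "Z1 0 = Z 0 + Z 1 * (cf i (l, a, k) k' * run_val i ?b n)" "Z1 1 = Z 1"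
        using True n by (auto simp: Z1_def run_val_def)
      ultimately show ?thesis using st1
        by (intro exI[of _ "1 + (1 + 0)"] exI[of _ M1] exI[of _ Z1] exI[of _ "[]"]) simp
    next
      case n: False
      let ?new = "map (\<lambda>c. (nxt i ?b, c, n - 1, Z1 2 * me i ?b c)) C"
      let ?t = "3 + length C * (14 + cost QContract)"
      obtain M2 Z2 where e: "exec f cost expand (M1, Z1) ?t (M2, Z2)"
        and stk: "stack (es @ ?new) (M2, Z2)"
        and fr: "\<forall>x<32. x \<notin> {6, 15, 16, 19, 20, 21, 22, 23} \<longrightarrow> M2 x = M1 x" "\<forall>x<32. x \<noteq> 3 \<longrightarrow> Z2 x = Z1 x"
        using exec_expand[OF st1 cs1 vb M1(1-5)] M1(6) unfolding C_def by blast
      have "exec f cost (IfLess 3 14 expand Skip) (M1, Z1) (1 + ?t) (M2, Z2)"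
        by (rule exec_If_True[OF _ e]) (use M1 n in auto)
      then have ex: "exec f cost ?branch (M1, Z1) (1 + (1 + ?t)) (M2, Z2)"
        by (rule exec_If_True[rotated]) (use M1 True in auto)
      have val: "total_val ?new = Z 1 * (cf i (l, a, k) k' * run_val i ?b n)"
        using True n by (simp add: run_val_def Z1_def C_def comp_def sum_list_const_mult mult.assoc)
      have pot: "total_pot ?new \<le> (s * d) ^ n * (n * step_cost + cost QOverlap)"
      proof -
        have "node_pot (nxt i ?b, c, n - 1, Z1 2 * me i ?b c) \<le> d * potential (n - 1)" if "c \<in> set C" for c
        proof -
          obtain l' a' k'' where c': "c = (l', a', k'')" by (cases c)
          have "valid (nxt i ?b) c" using valid_child[OF vb] True that by (simp add: C_def)
          then show ?thesis using dm_le c' by simp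
        qed
        then have "total_pot ?new \<le> (\<Sum>c\<leftarrow>C. d * potential (n - 1))"
          unfolding map_map comp_def by (intro sum_list_mono) auto
        also have "\<dots> = length C * (d * potential (n - 1))" by (simp add: sum_list_triv)
        also have "\<dots> \<le> s * (d * potential (n - 1))"
          using ch_length[OF vb] by (intro mult_right_mono) (auto simp: C_def)
        also have "\<dots> = (s * d) ^ n * (n * step_cost + cost QOverlap)"
          using n by (cases n) (simp_all add: potential_def mult_ac)
        finally show ?thesis .
      qed
      \<comment> \<open>24 consists of these 19, two tests and the 3 units of \<open>expand\<close>;
        each child costs another 14. Together with the two contraction costs, 24 + 14 + 2 gives the
        factor 40 in \<open>step_cost\<close>.\<close>
      have "19 + cost QNoise + cost QCoeff + cost QContract + (1 + (1 + ?t)) \<le> s * step_cost"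
      proof -
        have s: "1 \<le> s" using C ch_length[OF vb] unfolding C_def by linarith
        have arith: "19 + q + r + c + (1 + (1 + (3 + x))) \<le> w"
          if "x \<le> y" "1 * (24 + q + r + c) \<le> z" "z + y \<le> w" for q r c x y z w :: nat
          using that unfolding mult_1 by linarith
        have "length C * (14 + cost QContract) \<le> s * (14 + cost QContract)"
          using ch_length[OF vb] by (intro mult_right_mono) (auto simp: C_def)
        moreover have "1 * (24 + cost QNoise + cost QCoeff + cost QContract) \<le> s * (24 + cost QNoise + cost QCoeff + cost QContract)"
          using s by (intro mult_right_mono) auto
        moreover have "s * (24 + cost QNoise + cost QCoeff + cost QContract) + s * (14 + cost QContract) \<le> s * step_cost"
          unfolding distrib_left[symmetric] using cost_pos by (intro mult_left_mono) (auto simp: step_cost_def)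
        ultimately show ?thesis by (rule arith)
      qed
      also have "\<dots> \<le> (s * d) ^ n * step_cost"
      proof (rule mult_right_mono)
        have "1 \<le> s" "1 \<le> d" using C ch_length[OF vb] dm_le[OF v] dm_pos[OF v] unfolding C_def by linarith+
        then have "s * 1 \<le> s * d" "1 \<le> s * d" by auto
        then have "s \<le> (s * d) ^ 1" by simp
        also have "\<dots> \<le> (s * d) ^ n" using n \<open>1 \<le> s * d\<close> by (intro power_increasing) auto
        finally show "s \<le> (s * d) ^ n" .
      qed simp
      finally have "19 + cost QNoise + cost QCoeff + cost QContract + (1 + (1 + ?t)) + total_pot ?new \<le> potential n"
        using pot by (simp add: potential_def distrib_left distrib_right)
      moreover have "\<forall>e\<in>set ?new. node_valid e" using valid_child[OF vb] True by (auto simp: C_def)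
      moreover have "Z2 0 = Z 0" "Z2 1 = Z 1" using fr(2) by (auto simp: Z1_def)
      ultimately show ?thesis using ex stk fr(1) val
        by (intro exI[of _ "1 + (1 + ?t)"] exI[of _ M2] exI[of _ Z2] exI[of _ ?new]) simp
    qed
  qed
  then obtain t M2 Z2 new where e2: "exec f cost ?branch (M1, Z1) t (M2, Z2)" and stk: "stack (es @ new) (M2, Z2)"
    and new: "\<forall>e\<in>set new. node_valid e"
      "Z2 0 + total_val new = Z 0 + Z 1 * (cf i (l, a, k) k' * run_val i ?b n)"
      "19 + cost QNoise + cost QCoeff + cost QContract + t + total_pot new \<le> potential n"
    and fr: "\<And>x. x < 32 \<Longrightarrow> x \<notin> {6, 15, 16, 19, 20, 21, 22, 23} \<Longrightarrow> M2 x = M1 x" "Z2 1 = Z 1"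
    by blast
  define M3 where "M3 = M2(18 := Suc k')"
  have "M2 4 = 1" "M2 18 = k'" using fr(1) M1 c by (auto simp: M1_def M)
  then have e3: "exec f cost (NAdd 18 18 4) (M2, Z2) 1 (M3, Z2)"
    using exec_NAdd_const[of M2 f cost 18 Z2] by (simp add: M3_def)
  have "exec f cost column (M, Z) (cost QCoeff + 1 + cost QContract + (t + 1)) (M3, Z2)"
    unfolding column_def by (intro exec_Seq[OF e1] exec_Seq[OF e2] e3)
  moreover have "stack (es @ new) (M3, Z2)" using stack_cong[OF stk, of M3 Z2] by (simp add: M3_def)
  moreover have "\<forall>x<32. x \<notin> ?F \<longrightarrow> M3 x = M x" using fr(1) by (auto simp: M3_def M1_def)
  moreover have "M3 18 = Suc k'" by (simp add: M3_def)
  moreover have "17 + cost QNoise + (cost QCoeff + 1 + cost QContract + (t + 1)) + total_pot new \<le> potential n"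
    using new(3) by simp
  ultimately show ?thesis using new fr(2) by blast
qed

lemma exec_process:
  assumes st: "stack (es @ [e]) (M, Z)" and cs: "const_regs M" and v: "node_valid e"
  shows "\<exists>t M' Z' new. exec f cost process (M, Z) t (M', Z') \<and> stack (es @ new) (M', Z') \<and> const_regs M' \<and>
    (\<forall>e\<in>set new. node_valid e) \<and> Z' 0 + total_val new = Z 0 + node_val e \<and> 1 + t + total_pot new \<le> node_pot e"
proof -
  obtain i l a k n w where e: "e = (i, (l, a, k), n, w)" by (cases e) (metis prod.collapse)
  have vb: "valid i (l, a, k)" using v e by simp
  have c: "M 3 = 0" "M 4 = 1" "M 5 = Suc D" "M 7 = 32" using cs by (auto simp: const_regs_def)
  obtain M1 Z1 where e1: "exec f cost pop (M, Z) 11 (M1, Z1)" and st1: "stack es (M1, Z1)"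
    and M1: "M1 10 = i" "M1 11 = l" "M1 12 = a" "M1 13 = k" "M1 14 = n" "Z1 1 = w"
    and fr1: "\<And>x. x < 32 \<Longrightarrow> x \<notin> {6, 10, 11, 12, 13, 14} \<Longrightarrow> M1 x = M x" "\<And>x. x < 32 \<Longrightarrow> x \<noteq> 1 \<Longrightarrow> Z1 x = Z x"
    using exec_pop[OF st[unfolded e] c(2), of f cost] by blast
  define M2 where "M2 = M1(17 := dm i l, 18 := 0)"
  define Z2 where "Z2 = Z1(2 := nei i (l, a, k), 1 := w * nei i (l, a, k), 3 := 0)"
  have e2: "exec f cost (seqs [Call QNoise [10, 11, 12, 13] [] 2, ZMul 1 1 2, Call QDim [10, 11] [17] 3, NConst 18 0])
    (M1, Z1) (cost QNoise + 3) (M2, Z2)"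
    by (rule exec_while_freeI)
      (use M1 noise[OF vb] dim[OF vb] cost_unit in \<open>auto simp: M2_def Z2_def fun_eq_iff\<close>)
  have st2: "stack es (M2, Z2)" by (rule stack_cong[OF st1]) (auto simp: M2_def Z2_def)
  let ?F = "{6, 15, 16, 18, 19, 20, 21, 22, 23} :: nat set"
  define Q where "Q p t st \<longleftrightarrow> (\<exists>M' Z' new. st = (M', Z') \<and> M' 18 = p \<and> stack (es @ new) (M', Z') \<and>
    (\<forall>e\<in>set new. node_valid e) \<and>
    Z' 0 + total_val new = Z 0 + Z2 1 * (\<Sum>k'<p. cf i (l, a, k) k' * run_val i (l, a, k') n) \<and>
    t + total_pot new + p * (16 + cost QNoise) \<le> p * potential n \<and>
    (\<forall>x<32. x \<notin> ?F \<longrightarrow> M' x = M2 x) \<and> Z' 1 = Z2 1)" for p t st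
  have "\<exists>t st'. exec f cost (WhileLess 18 17 column) (M2, Z2) (t + 1) st' \<and> Q (dm i l) t st'"
  proof (rule exec_for)
    show "Q 0 0 (M2, Z2)"
      unfolding Q_def using st2 fr1(2)
      by (intro exI[of _ M2] exI[of _ Z2] exI[of _ "[]"]) (auto simp: M2_def Z2_def)
    show "\<not> fst st 18 < fst st 17" if "Q (dm i l) t st" for t st
      using that by (auto simp: Q_def M2_def)
    fix p t st assume p: "p < dm i l" and "Q p t st"
    then obtain M3 Z3 new where st3: "st = (M3, Z3)" "M3 18 = p" and stk: "stack (es @ new) (M3, Z3)"
      and new: "\<forall>e\<in>set new. node_valid e"
        "Z3 0 + total_val new = Z 0 + Z2 1 * (\<Sum>k'<p. cf i (l, a, k) k' * run_val i (l, a, k') n)"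
        "t + total_pot new + p * (16 + cost QNoise) \<le> p * potential n"
      and fr3: "\<And>x. x < 32 \<Longrightarrow> x \<notin> ?F \<Longrightarrow> M3 x = M2 x" "Z3 1 = Z2 1"
      unfolding Q_def by blast
    have cs3: "const_regs M3" using fr3(1) fr1(1) c by (simp add: const_regs_def M2_def)
    have M3: "M3 10 = i" "M3 11 = l" "M3 12 = a" "M3 13 = k" "M3 14 = n" "M3 17 = dm i l"
      using fr3(1) M1 by (auto simp: M2_def)
    obtain u M4 Z4 new' where e4: "exec f cost column (M3, Z3) u (M4, Z4)" and stk4: "stack ((es @ new) @ new') (M4, Z4)"
      and new': "\<forall>e\<in>set new'. node_valid e"
        "Z4 0 + total_val new' = Z3 0 + Z3 1 * (cf i (l, a, k) p * run_val i (l, a, p) n)"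
        "17 + cost QNoise + u + total_pot new' \<le> potential n"
      and fr4: "M4 18 = Suc p" "\<And>x. x < 32 \<Longrightarrow> x \<notin> ?F \<Longrightarrow> M4 x = M3 x" "Z4 1 = Z3 1"
      using exec_column[OF stk cs3 vb p M3(1-5) st3(2)] by blast
    have "Q (Suc p) (t + 1 + u) (M4, Z4)"
      unfolding Q_def
    proof (intro exI[of _ M4] exI[of _ Z4] exI[of _ "new @ new'"] conjI)
      have "Z4 0 + total_val (new @ new') = (Z4 0 + total_val new') + total_val new" by simp
      also have "\<dots> = (Z3 0 + total_val new) + Z2 1 * (cf i (l, a, k) p * run_val i (l, a, p) n)"
        unfolding new'(2) fr3(2) by simp
      also have "\<dots> = Z 0 + Z2 1 * (\<Sum>k'<Suc p. cf i (l, a, k) k' * run_val i (l, a, k') n)"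
        unfolding new(2) by (simp add: distrib_left)
      finally show "Z4 0 + total_val (new @ new') = Z 0 + Z2 1 * (\<Sum>k'<Suc p. cf i (l, a, k) k' * run_val i (l, a, k') n)" .
      show "t + 1 + u + total_pot (new @ new') + Suc p * (16 + cost QNoise) \<le> Suc p * potential n"
        using new(3) new'(3) by simp
      show "\<forall>x<32. x \<notin> ?F \<longrightarrow> M4 x = M2 x" using fr4(2) fr3(1) by auto
    qed (use stk4 new(1) new'(1) fr4 fr3 in auto)
    moreover have "fst st 18 < fst st 17" using p M3 st3 by simp
    ultimately show "fst st 18 < fst st 17 \<and> (\<exists>u st'. exec f cost column st u st' \<and> Q (Suc p) (t + 1 + u) st')"
      using e4 unfolding st3(1) by blast
  qed
  then obtain t st' where e3: "exec f cost (WhileLess 18 17 column) (M2, Z2) (t + 1) st'" and "Q (dm i l) t st'" by blast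
  then obtain M' Z' new where st': "st' = (M', Z')" and stk: "stack (es @ new) (M', Z')"
    and new: "\<forall>e\<in>set new. node_valid e"
      "Z' 0 + total_val new = Z 0 + Z2 1 * (\<Sum>k'<dm i l. cf i (l, a, k) k' * run_val i (l, a, k') n)"
      "t + total_pot new + dm i l * (16 + cost QNoise) \<le> dm i l * potential n"
    and fr: "\<And>x. x < 32 \<Longrightarrow> x \<notin> ?F \<Longrightarrow> M' x = M2 x"
    unfolding Q_def by blast
  have ex: "exec f cost process (M, Z) (11 + (cost QNoise + 3 + (t + 1))) (M', Z')"
    unfolding process_def using exec_Seq[OF e1 exec_Seq[OF e2 e3]] st' by simp
  have "const_regs M'" using fr fr1(1) c by (simp add: const_regs_def M2_def)
  moreover have "node_val e = Z2 1 * (\<Sum>k'<dm i l. cf i (l, a, k) k' * run_val i (l, a, k') n)"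
    unfolding e by (simp add: val_eq[OF vb] run_val_def Z2_def mult.assoc)
  ultimately have "const_regs M'" "Z' 0 + total_val new = Z 0 + node_val e" using new(2) by simp_all
  \<comment> \<open>There is at least one column, and its reserve alone covers the outer test, the
    pop, the noise, three further units and the failing inner test.\<close>
  moreover have "1 + (11 + (cost QNoise + 3 + (t + 1))) + total_pot new \<le> node_pot e"
  proof -
    have "1 * (16 + cost QNoise) \<le> dm i l * (16 + cost QNoise)" using dm_pos[OF vb] by (intro mult_right_mono) auto
    moreover have "1 + (11 + (c + 3 + (t + 1))) + p \<le> y" if "1 * (16 + c) \<le> x" "t + p + x \<le> y" for c p x y :: nat
      using that unfolding mult_1 by linarith
    ultimately show ?thesis using new(3) unfolding e node_pot.simps by blast
  qed
  ultimately show ?thesis using ex stk new(1) by blast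
qed

text \<open>The accumulator plus the weighted values of the pending nodes is invariant, so with an
  empty stack the accumulator holds the total.\<close>

lemma exec_process_loop:
  assumes st: "stack es (M, Z)" and cs: "const_regs M" and v: "\<forall>e\<in>set es. node_valid e"
  shows "\<exists>t st'. exec f cost (WhileLess 7 6 process) (M, Z) t st' \<and> snd st' 0 = Z 0 + total_val es \<and> t \<le> total_pot es + 1"
proof -
  define Q where "Q es' st \<longleftrightarrow> stack es' st \<and> const_regs (fst st) \<and> (\<forall>e\<in>set es'. node_valid e) \<and>
    snd st 0 + total_val es' = Z 0 + total_val es" for es' st
  have "\<exists>t e' st'. exec f cost (WhileLess 7 6 process) (M, Z) t st' \<and> Q e' st' \<and> \<not> fst st' 7 < fst st' 6 \<and> t \<le> total_pot es + 1"
  proof (rule exec_while_potential)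
    show "Q es (M, Z)" using assms by (simp add: Q_def)
    fix es' st assume Q: "Q es' st" and lt: "fst st 7 < fst st 6"
    obtain M1 Z1 where st1: "st = (M1, Z1)" by (cases st)
    have "es' \<noteq> []" using Q lt by (auto simp: Q_def stack_def const_regs_def)
    then obtain es1 e where es': "es' = es1 @ [e]" by (metis rev_exhaust)
    obtain u M2 Z2 new where e: "exec f cost process (M1, Z1) u (M2, Z2)" "stack (es1 @ new) (M2, Z2)" "const_regs M2"
      "\<forall>e\<in>set new. node_valid e" "Z2 0 + total_val new = Z1 0 + node_val e" "1 + u + total_pot new \<le> node_pot e"
      using exec_process[of es1 e M1 Z1] Q unfolding Q_def st1 es' by auto
    have "Q (es1 @ new) (M2, Z2)"
      unfolding Q_def
    proof (intro conjI)
      have "Z2 0 + total_val (es1 @ new) = (Z2 0 + total_val new) + total_val es1" by simp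
      also have "\<dots> = Z1 0 + total_val es'" unfolding e(5) es' by simp
      finally show "snd (M2, Z2) 0 + total_val (es1 @ new) = Z 0 + total_val es"
        using Q by (simp add: Q_def st1)
    qed (use Q e in \<open>auto simp: Q_def es'\<close>)
    moreover have "1 + u + total_pot (es1 @ new) \<le> total_pot es'" using e(6) by (simp add: es')
    ultimately show "\<exists>u e' st'. exec f cost process st u st' \<and> Q e' st' \<and> 1 + u + total_pot e' \<le> total_pot es'"
      using e(1) st1 by blast
  qed
  then obtain t e' st' where r: "exec f cost (WhileLess 7 6 process) (M, Z) t st'" "Q e' st'" "\<not> fst st' 7 < fst st' 6" "t \<le> total_pot es + 1"
    by blast
  have "e' = []" using r(2,3) by (auto simp: Q_def stack_def const_regs_def)
  then have "snd st' 0 = Z 0 + total_val es" using r(2) by (simp add: Q_def)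
  then show ?thesis using r(1,4) by blast
qed

text \<open>The charge that \<open>visit\<close> makes at slot 1.\<close>

definition root_budget :: "nat \<Rightarrow> label \<Rightarrow> nat" where
  "root_budget L b = (if 0 < fst b then L - 1 else L)"

lemma exec_path_program:
  assumes L: "1 \<le> L" and roots: "\<And>b. b \<in> set bs \<Longrightarrow> valid 1 b"
    and triv: "\<And>b. b \<in> set bs \<Longrightarrow> fst b = 0 \<Longrightarrow> dm 1 (fst b) = 1"
    and obs: "\<And>p. p < length bs \<Longrightarrow> f QObs [p] = (code_of (bs ! p), rc (bs ! p))"
  shows "\<exists>t st'. exec f cost path_program (init_store (length bs) L D) t st' \<and>
    snd st' 0 = (\<Sum>b\<leftarrow>bs. rc b * val 1 b (root_budget L b)) \<and>
    t \<le> 8 + length bs * (18 + potential L)"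
proof -
  let ?node = "\<lambda>b. (1, b, root_budget L b, rc b)"
  obtain M Z where init: "init_store (length bs) L D = (M, Z)" by (cases "init_store (length bs) L D")
  have M: "M 0 = length bs" "M 1 = L" "M 2 = D" "Z 0 = 0"
    using init by (auto simp: init_store_def)
  define M0 where "M0 = M(3 := 0, 4 := 1, 5 := Suc D, 7 := 32, 6 := 32, 16 := 0)"
  have e0: "exec f cost (seqs [NConst 3 0, NConst 4 1, NAdd 5 2 4, NConst 7 32, NConst 6 32, NConst 16 0]) (M, Z) 6 (M0, Z)"
    by (rule exec_while_freeI) (use M in \<open>auto simp: M0_def fun_eq_iff\<close>)
  define Q where "Q p t st \<longleftrightarrow> (\<exists>M' Z'. st = (M', Z') \<and> M' 16 = p \<and> M' 0 = length bs \<and> M' 1 = L \<and> const_regs M' \<and> Z' 0 = 0 \<and>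
    stack (map ?node (take p bs)) (M', Z') \<and> t \<le> p * 18)" for p t st
  have "\<exists>t st'. exec f cost (WhileLess 16 0 root) (M0, Z) (t + 1) st' \<and> Q (length bs) t st'"
  proof (rule exec_for)
    show "Q 0 0 (M0, Z)"
      unfolding Q_def using M by (intro exI[of _ M0] exI[of _ Z]) (auto simp: M0_def const_regs_def stack_def)
    show "\<not> fst st 16 < fst st 0" if "Q (length bs) t st" for t st
      using that by (auto simp: Q_def)
    fix p t st assume p: "p < length bs" and "Q p t st"
    then obtain M1 Z1 where st1: "st = (M1, Z1)" and M1: "M1 16 = p" "M1 0 = length bs" "M1 1 = L" "Z1 0 = 0"
      and cs: "const_regs M1" and stk: "stack (map ?node (take p bs)) (M1, Z1)" and t: "t \<le> p * 18"
      unfolding Q_def by blast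
    have c: "M1 3 = 0" "M1 4 = 1" "M1 5 = Suc D" "M1 7 = 32" using cs by (auto simp: const_regs_def)
    obtain l a k where b: "bs ! p = (l, a, k)" by (cases "bs ! p")
    define M2 where "M2 = M1(11 := l, 12 := a, 13 := k, 14 := root_budget L (l, a, k), 10 := 1)"
    define Z2 where "Z2 = Z1(1 := rc (l, a, k))"
    let ?blk = "seqs [Call QObs [16] [11, 12, 13] 1, NAdd 14 1 3, IfLess 3 11 (NSub 14 1 4) Skip, NAdd 10 4 3]"
    have "effect f ?blk (M1, Z1) = (M2, Z2)"
      using obs[OF p] b c M1 by (auto simp: M2_def Z2_def root_budget_def fun_eq_iff)
    then have "exec f cost ?blk (M1, Z1) (duration f cost ?blk (M1, Z1)) (M2, Z2)" by (intro exec_while_freeI) auto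
    \<comment> \<open>With the push, the counter and the loop test this gives 5 + 11 + 1 + 1 = 18
      per root.\<close>
    moreover have "duration f cost ?blk (M1, Z1) \<le> 5" using cost_unit by simp
    ultimately obtain u where e1: "exec f cost ?blk (M1, Z1) u (M2, Z2)" and u: "u \<le> 5" by blast
    have stk2: "stack (map ?node (take p bs)) (M2, Z2)"
      by (rule stack_cong[OF stk]) (auto simp: M2_def Z2_def)
    obtain M3 Z3 where e2: "exec f cost (push 10 11 12 13 14 1) (M2, Z2) 11 (M3, Z3)"
      and stk3: "stack (map ?node (take p bs) @ [(M2 10, (M2 11, M2 12, M2 13), M2 14, Z2 1)]) (M3, Z3)"
      and fr3: "\<And>x. x < 32 \<Longrightarrow> x \<noteq> 6 \<Longrightarrow> M3 x = M2 x" "\<And>x. x < 32 \<Longrightarrow> Z3 x = Z2 x"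
      using exec_push[OF stk2, of 10 11 12 13 14 1 f cost] c by (auto simp: M2_def)
    define M4 where "M4 = M3(16 := Suc p)"
    have "M3 4 = 1" "M3 16 = p" using fr3 c M1 by (auto simp: M2_def)
    then have e3: "exec f cost (NAdd 16 16 4) (M3, Z3) 1 (M4, Z3)"
      using exec_NAdd_const[of M3 f cost 16 Z3] by (simp add: M4_def)
    have ex: "exec f cost root (M1, Z1) (u + (11 + 1)) (M4, Z3)"
      unfolding root_def by (intro exec_Seq[OF e1] exec_Seq[OF e2] e3)
    have "Q (Suc p) (t + 1 + (u + (11 + 1))) (M4, Z3)"
      unfolding Q_def
    proof (intro exI[of _ M4] exI[of _ Z3] conjI)
      have "map ?node (take p bs) @ [(M2 10, (M2 11, M2 12, M2 13), M2 14, Z2 1)] = map ?node (take (Suc p) bs)"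
        using p b by (simp add: take_Suc_conv_app_nth M2_def Z2_def)
      then show "stack (map ?node (take (Suc p) bs)) (M4, Z3)"
        using stack_cong[OF stk3, of M4 Z3] by (simp add: M4_def)
      show "const_regs M4" using fr3 c by (simp add: const_regs_def M4_def M2_def)
      show "t + 1 + (u + (11 + 1)) \<le> Suc p * 18" using t u by simp
    qed (use fr3 M1 in \<open>auto simp: M4_def M2_def Z2_def\<close>)
    moreover have "fst st 16 < fst st 0" using p M1 by (simp add: st1)
    ultimately show "fst st 16 < fst st 0 \<and> (\<exists>u st'. exec f cost root st u st' \<and> Q (Suc p) (t + 1 + u) st')"
      using ex unfolding st1 by blast
  qed
  then obtain t st1 where e1: "exec f cost (WhileLess 16 0 root) (M0, Z) (t + 1) st1" and "Q (length bs) t st1" by blast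
  then obtain M1 Z1 where st1: "st1 = (M1, Z1)" and cs: "const_regs M1" and Z1: "Z1 0 = 0"
    and stk: "stack (map ?node bs) (M1, Z1)" and t: "t \<le> length bs * 18"
    unfolding Q_def by auto
  obtain t2 st2 where e2: "exec f cost (WhileLess 7 6 process) (M1, Z1) t2 st2"
    and v: "snd st2 0 = Z1 0 + total_val (map ?node bs)" and t2: "t2 \<le> total_pot (map ?node bs) + 1"
    using exec_process_loop[OF stk cs] roots by auto
  have "exec f cost path_program (M, Z) (6 + (t + 1 + t2)) st2"
    unfolding path_program_def using exec_Seq[OF e0 exec_Seq[OF e1[unfolded st1] e2]] .
  moreover have "snd st2 0 = (\<Sum>b\<leftarrow>bs. rc b * val 1 b (root_budget L b))"
    using v Z1 by (simp add: comp_def)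
  moreover have "total_pot (map ?node bs) \<le> length bs * potential L"
  proof -
    have "node_pot (?node b) \<le> potential L" if b: "b \<in> set bs" for b
    proof -
      obtain l a k where b': "b = (l, a, k)" by (cases b)
      have vb: "valid 1 (l, a, k)" using roots[OF b] b' by simp
      \<comment> \<open>A trivial root keeps the full budget but has a single column; a non-trivial
        root has up to d columns but one unit less.\<close>
      show ?thesis
      proof (cases "l = 0")
        case True
        then show ?thesis using triv[OF b] b' by (simp add: root_budget_def)
      next
        case False
        have s: "1 \<le> s" using ch_length[OF vb] ch_nonempty[OF vb] by (cases "ch 1 (l, a, k)") auto
        obtain L' where L': "L = Suc L'" using L by (cases L) auto
        have "dm 1 l * potential L' \<le> (s * d) * potential L'"
          using dm_le[OF vb] s by (intro mult_right_mono) (auto intro: order_trans[of _ "1 * d"])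
        also have "\<dots> = (s * d) ^ L * ((L' + 1) * step_cost + cost QOverlap)" by (simp add: potential_def L')
        also have "\<dots> \<le> potential L" unfolding potential_def L' by (intro mult_left_mono add_mono mult_right_mono) auto
        finally show ?thesis using False b' L' by (simp add: root_budget_def)
      qed
    qed
    then have "total_pot (map ?node bs) \<le> (\<Sum>b\<leftarrow>bs. potential L)"
      unfolding map_map comp_def by (intro sum_list_mono) auto
    then show ?thesis by (simp add: sum_list_triv)
  qed
  \<comment> \<open>6 for the initial block and one failing test for each of the two loops.\<close>
  then have "6 + (t + 1 + t2) \<le> 8 + length bs * (18 + potential L)"
    using t t2 by (simp add: distrib_left)
  ultimately show ?thesis unfolding init by blast
qed

end

section \<open>The circuit as an instance of the path tree\<close>

context contractible_circuit
begin

lemma max_irdim_ge: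
  assumes i: "1 \<le> i" "i \<le> D" and l: "l \<in> irreps X i"
  shows "irdim X i l \<le> max_irdim X"
  unfolding max_irdim_def
proof (rule Max_ge)
  have "{irdim X i l | i l. i \<in> {1..D} \<and> l \<in> irreps X i} \<subseteq> (\<Union>i\<in>{1..D}. irdim X i ` irreps X i)"
    by auto
  moreover have "finite (\<Union>i\<in>{1..D}. irdim X i ` irreps X i)"
    using adapted by (intro finite_UN_I finite_imageI) (auto simp: symmetry_adapted_def)
  ultimately show "finite {irdim X i l | i l. i \<in> {1..D} \<and> l \<in> irreps X i}" by (rule finite_subset)
  show "irdim X i l \<in> {irdim X i l | i l. i \<in> {1..D} \<and> l \<in> irreps X i}"
    using i l by (intro CollectI exI[of _ i] exI[of _ l]) auto
qed

lemma computes_truncation: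
  assumes cnt: "path_count X s" and pos: "positive_costs c" and L: "1 \<le> L"
    and g: "g \<in> Pi\<^sub>E {1..D} (\<lambda>_. carrier G)" and imp: "implements N X g f"
  shows "computes_in path_program f (call_cost c) (init_store (op_rank X) L D) (truncated_value N X L g)
    (98 * (1 + real (op_rank X) * (real s * real (max_irdim X)) ^ L * real (evaluate_cost c L)))"
proof -
  have D1: "1 \<le> D" using circ by (simp add: is_circuit_def)
  have gc: "g m \<in> carrier G" if "1 \<le> m" "m \<le> D" for m using g that by auto
  define valid where "valid i b \<longleftrightarrow> 1 \<le> i \<and> i \<le> D \<and> b \<in> I i" for i b
  let ?nxt = "next_slot N X"
  let ?me = "\<lambda>i b c. hs (T i b) (propagate X i (?nxt i b) (T (?nxt i b) c))"
  obtain os where os: "distinct os" "set os = op_support X"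
    "\<And>p. p < length os \<Longrightarrow> f QObs [p] = (code_of (os ! p), hs (obsv X) (T 1 (os ! p)))"
    using imp unfolding implements_def by blast
  have q1: "f QDim [i, l] = ([irdim X i l], 0)"
    "\<And>k k'. k < irdim X i l \<Longrightarrow> k' < irdim X i l \<Longrightarrow> f QCoeff [i, l, k, k'] = ([], mcoef X i l (g i) $$ (k, k'))"
    if "1 \<le> i" "i \<le> D" "l \<in> irreps X i" for i l
    using imp that unfolding implements_def by auto
  have q2: "f QNoise (i # code_of b) = ([], neig X i b)"
    "f QOverlap (i # code_of b) = ([], hs (T i b) (propagate X i (Suc D) (zero_state N)))"
    "\<exists>cs. distinct cs \<and> set cs = contraction i b \<and> (\<forall>p<length cs. f QContract (i # code_of b @ [p]) =
      (length cs # ?nxt i b # code_of (cs ! p), ?me i b (cs ! p)))"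
    if "valid i b" for i b
    using imp that unfolding implements_def valid_def contraction_def Let_def by auto
  have "\<forall>x\<in>{(i, b). valid i b}. \<exists>cs. distinct cs \<and> set cs = contraction (fst x) (snd x) \<and>
    (\<forall>p<length cs. f QContract (fst x # code_of (snd x) @ [p]) =
      (length cs # ?nxt (fst x) (snd x) # code_of (cs ! p), ?me (fst x) (snd x) (cs ! p)))"
    using q2(3) by auto
  \<comment> \<open>The order of each list is only known to exist; choice fixes one list per slot
    and operator.\<close>
  from bchoice[OF this] obtain h where h: "\<And>i b. valid i b \<Longrightarrow> distinct (h (i, b)) \<and> set (h (i, b)) = contraction i b \<and>
    (\<forall>p<length (h (i, b)). f QContract (i # code_of b @ [p]) =
      (length (h (i, b)) # ?nxt i b # code_of (h (i, b) ! p), ?me i b (h (i, b) ! p)))"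
    by fastforce
  define ch where "ch i b = h (i, b)" for i b
  have ch: "distinct (ch i b)" "set (ch i b) = contraction i b"
    "\<And>p. p < length (ch i b) \<Longrightarrow> f QContract (i # code_of b @ [p]) =
      (length (ch i b) # ?nxt i b # code_of (ch i b ! p), ?me i b (ch i b ! p))" if "valid i b" for i b
    using h[OF that] by (auto simp: ch_def)
  have lab: "l \<in> irreps X i" "k < irdim X i l" if "valid i (l, a, k)" for i l a k
    using that by (auto simp: valid_def labels_def)
  \<comment> \<open>The value of a node is \<open>tail_sum\<close>, whose budget concerns later
    slots only: the operator of the node itself has been charged when the node was created.\<close>
  interpret path_tree f "call_cost c" D "max_irdim X" s valid "irdim X" "neig X"
    "\<lambda>i b k'. mcoef X i (fst b) (g i) $$ (snd (snd b), k')" ?nxt ch ?me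
    "\<lambda>i b. hs (T i b) (propagate X i (Suc D) (zero_state N))" "tail_sum g"
  proof
    fix i l a k assume v: "valid i (l, a, k)"
    have i: "1 \<le> i" "i \<le> D" and b: "(l, a, k) \<in> I i" using v by (auto simp: valid_def)
    show "f QNoise [i, l, a, k] = ([], neig X i (l, a, k))" using q2(1)[OF v] by simp
    show "f QOverlap [i, l, a, k] = ([], hs (T i (l, a, k)) (propagate X i (Suc D) (zero_state N)))"
      using q2(2)[OF v] by simp
    show "f QDim [i, l] = ([irdim X i l], 0)" using q1(1)[OF i] lab[OF v] by simp
    show "f QContract [i, l, a, k, p] = (length (ch i (l, a, k)) # ?nxt i (l, a, k) # code_of (ch i (l, a, k) ! p), ?me i (l, a, k) (ch i (l, a, k) ! p))"
      if "p < length (ch i (l, a, k))" for p using ch(3)[OF v that] by simp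
    show "f QCoeff [i, l, k, k'] = ([], mcoef X i (fst (l, a, k)) (g i) $$ (snd (snd (l, a, k)), k'))"
      if "k' < irdim X i l" for k' using q1(2)[OF i] lab[OF v] that by simp
    show col: "valid i (l, a, k')" if "k' < irdim X i l" for k'
      using i label_dim[OF b that] by (simp add: valid_def)
    show "1 \<le> irdim X i l" using lab[OF v] by simp
    show "irdim X i l \<le> max_irdim X" using lab[OF v] i by (intro max_irdim_ge) auto
    show "tail_sum g i (l, a, k) n = neig X i (l, a, k) * (\<Sum>k'<irdim X i l. mcoef X i (fst (l, a, k)) (g i) $$ (snd (snd (l, a, k)), k') *
      (if ?nxt i (l, a, k') = Suc D then hs (T i (l, a, k')) (propagate X i (Suc D) (zero_state N)) else if n = 0 then 0
       else \<Sum>c\<leftarrow>ch i (l, a, k'). ?me i (l, a, k') c * tail_sum g (?nxt i (l, a, k')) c (n - 1)))" for n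
    proof -
      have "run_sum g i (l, a, k') n = (if ?nxt i (l, a, k') = Suc D then hs (T i (l, a, k')) (propagate X i (Suc D) (zero_state N)) else if n = 0 then 0
       else \<Sum>c\<leftarrow>ch i (l, a, k'). ?me i (l, a, k') c * tail_sum g (?nxt i (l, a, k')) c (n - 1))" if k': "k' < irdim X i l" for k'
        using run_sum_eq[where g = g and l = n, OF i label_dim[OF b k'] gc refl] ch(1,2)[OF col[OF k']]
        by (simp add: sum_list_distinct_conv_sum_set)
      then show ?thesis unfolding tail_sum_run[where g = g, OF i b gc[OF i]] by simp
    qed
  next
    fix i b assume v: "valid i b"
    have i: "1 \<le> i" "i \<le> D" and b: "b \<in> I i" using v by (auto simp: valid_def)
    note nx = next_slot[where b = b, OF i(2) refl]
    show "?nxt i b \<le> Suc D" by (rule nx(2))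
    show "ch i b \<noteq> []" using contraction_nonempty[OF i b] ch(2)[OF v] by auto
    show "length (ch i b) \<le> s"
    proof -
      have "card (contraction i b) \<le> s"
        using cnt i b nx(1,2) unfolding path_count_def contraction_def by auto
      then show ?thesis using distinct_card[OF ch(1)[OF v]] ch(2)[OF v] by simp
    qed
    show "valid (?nxt i b) c" if "?nxt i b \<le> D" "c \<in> set (ch i b)" for c
      using that nx(1) i ch(2)[OF v] by (auto simp: valid_def contraction_def)
  next
    show "1 \<le> call_cost c QContract" using pos by (simp add: positive_costs_def)
  qed simp_all
  have sup: "b \<in> op_support X \<Longrightarrow> valid 1 b" for b using D1 by (simp add: op_support_def valid_def)
  have rank: "length os = op_rank X" using distinct_card[OF os(1)] os(2) by (simp add: op_rank_def)
  have "\<exists>t st'. exec f (call_cost c) path_program (init_store (length os) L D) t st' \<and>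
    snd st' 0 = (\<Sum>b\<leftarrow>os. hs (obsv X) (T 1 b) * tail_sum g 1 b (root_budget L b)) \<and>
    t \<le> 8 + length os * (18 + potential L)"
  proof (rule exec_path_program[OF L])
    show "valid 1 b" if "b \<in> set os" for b using that os(2) sup by simp
    show "irdim X 1 (fst b) = 1" if "b \<in> set os" "fst b = 0" for b
      using trivial_label[where i = 1 and \<gamma> = "g 1" and b = b] that sup[of b] os(2) gc[of 1] D1 by (auto simp: valid_def)
  qed (rule os(3))
  then obtain t st' where ex: "exec f (call_cost c) path_program (init_store (op_rank X) L D) t st'"
    and v: "snd st' 0 = (\<Sum>b\<leftarrow>os. hs (obsv X) (T 1 b) * tail_sum g 1 b (root_budget L b))"
    and t: "t \<le> 8 + op_rank X * (18 + potential L)"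
    unfolding rank by blast
  have "snd st' 0 = truncated_value N X L g"
  proof -
    have "snd st' 0 = (\<Sum>b\<in>op_support X. hs (obsv X) (T 1 b) * tail_sum g 1 b (root_budget L b))"
      unfolding v using os(1,2) by (simp add: sum_list_distinct_conv_sum_set)
    \<comment> \<open>A positive L keeps \<open>visit\<close> out of its zero case, so that it
      agrees with \<open>root_budget\<close>.\<close>
    also have "\<dots> = (\<Sum>b\<in>op_support X. hs (obsv X) (T 1 b) * visit g 1 b L)"
      using L D1 by (intro sum.cong refl) (auto simp: visit_def root_budget_def)
    also have "\<dots> = (\<Sum>b\<in>I 1. hs (obsv X) (T 1 b) * visit g 1 b L)"
    proof (rule sum.mono_neutral_left)
      show "finite (I 1)" by simp
      show "op_support X \<subseteq> I 1" by (auto simp: op_support_def)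
      show "\<forall>b\<in>I 1 - op_support X. hs (obsv X) (T 1 b) * visit g 1 b L = 0"
      proof
        fix b assume b: "b \<in> I 1 - op_support X"
        then have "hs (T 1 b) (obsv X) = 0" by (simp add: op_support_def)
        then have "hs (obsv X) (T 1 b) = 0" using hs_cnj[of "T 1 b" N "obsv X"] b by simp
        then show "hs (obsv X) (T 1 b) * visit g 1 b L = 0" by simp
      qed
    qed
    finally show ?thesis by (simp only: truncated_visit)
  qed
  moreover have "t \<le> 98 * (1 + op_rank X * (s * max_irdim X) ^ L * evaluate_cost c L)"
  proof -
    have "op_rank X * (18 + potential L) \<le> op_rank X * ((s * max_irdim X) ^ L * (98 * evaluate_cost c L))"
    \<comment> \<open>Without roots both sides are 0. Otherwise a supported basis operator forces s
      and d_max to be positive, so that their power can absorb the constant overhead.\<close>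
    proof (cases "op_rank X = 0")
      case False
      then obtain b where "b \<in> op_support X" unfolding op_rank_def by (metis card.empty equals0I)
      then have vb: "valid 1 b" by (rule sup)
      obtain l a k where b: "b = (l, a, k)" by (cases b)
      have "1 \<le> s" using ch_length[OF vb] ch_nonempty[OF vb] by (cases "ch 1 b") auto
      moreover have "1 \<le> max_irdim X" using dm_le[of 1 l a k] dm_pos[of 1 l a k] vb b by simp
      ultimately have sd: "1 \<le> (s * max_irdim X) ^ L" by simp
      define u where "u = contract_cost c + coeff_cost c + neig_cost c"
      have u: "1 \<le> L * u" using L pos by (simp add: u_def positive_costs_def)
      have "18 + ((L + 1) * step_cost + overlap_cost c) \<le> 98 * evaluate_cost c L"
      proof -
        \<comment> \<open>98 = 18 + 40 + 40: the overhead of a root, and \<open>L + 1\<close> levels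
          that cost at most twice as much as L levels.\<close>
        have arith: "18 + (40 * x + 40 * y + z) \<le> 98 * (x + z)" if "1 \<le> x" "y \<le> x" for x y z :: nat
          using that by simp
        have ss: "(L + 1) * step_cost = 40 * (L * u) + 40 * u" by (simp add: step_cost_def u_def algebra_simps)
        have "u \<le> L * u" using L by simp
        have ev: "evaluate_cost c L = L * u + overlap_cost c"
          by (simp add: evaluate_cost_def u_def algebra_simps)
        show ?thesis unfolding ss ev by (rule arith[OF u \<open>u \<le> L * u\<close>])
      qed
      then have hi: "(s * max_irdim X) ^ L * (18 + ((L + 1) * step_cost + overlap_cost c)) \<le> (s * max_irdim X) ^ L * (98 * evaluate_cost c L)"
        by (intro mult_left_mono) auto
      have "1 * 18 \<le> (s * max_irdim X) ^ L * 18" using sd by (intro mult_right_mono) auto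
      then have "18 + potential L \<le> (s * max_irdim X) ^ L * (18 + ((L + 1) * step_cost + overlap_cost c))"
        by (simp add: potential_def distrib_left)
      from this hi have "18 + potential L \<le> (s * max_irdim X) ^ L * (98 * evaluate_cost c L)"
        by (rule order_trans)
      then show ?thesis by (rule mult_left_mono) simp
    qed simp
    then have "t \<le> 8 + op_rank X * ((s * max_irdim X) ^ L * (98 * evaluate_cost c L))" using t by linarith
    also have "\<dots> \<le> 98 * (1 + op_rank X * (s * max_irdim X) ^ L * evaluate_cost c L)" by simp
    finally show ?thesis .
  qed
  then have "real t \<le> real (98 * (1 + op_rank X * (s * max_irdim X) ^ L * evaluate_cost c L))"
    by (rule of_nat_mono)
  then have "real t \<le> 98 * (1 + real (op_rank X) * (real s * real (max_irdim X)) ^ L * real (evaluate_cost c L))"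
    by simp
  ultimately show ?thesis unfolding computes_in_def using ex by blast
qed

end

theorem theorem9:
  "\<exists>(P :: prog) (K :: real).
     \<forall>(d :: nat) (X :: nat \<Rightarrow> 'g circuit) (s :: nat \<Rightarrow> nat) (c :: nat \<Rightarrow> cost_params).
       d \<ge> 1 \<longrightarrow>
       (\<forall>n\<ge>1. is_circuit (d ^ n) (X n) \<and> observable (d ^ n) (obsv (X n)) \<and>
          symmetry_adapted (d ^ n) (X n) \<and> noise_penalisation (d ^ n) (X n) \<and>
          tree_growth (d ^ n) (X n) \<and> path_count (X n) (s n) \<and> positive_costs (c n)) \<longrightarrow>
       poly_bounded (\<lambda>n. op_rank (X n)) \<longrightarrow>
       poly_bounded s \<longrightarrow>
       poly_bounded (\<lambda>n. contract_cost (c n)) \<longrightarrow>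
       (\<forall>n\<ge>1. \<forall>L\<ge>1.
          (let err = (\<lambda>g. noisy_value (d ^ n) (X n) g - truncated_value (d ^ n) (X n) L g) in
             square_integrable (product_haar (X n)) err \<and>
             l2_norm (product_haar (X n)) err
               \<le> exp (- spectral_gap (d ^ n) (noise (X n)) * real L) * hs_norm (obsv (X n))) \<and>
          (\<forall>g\<in>Pi\<^sub>E {1..depth (X n)} (\<lambda>_. carrier (grp (X n))). \<forall>f.
             implements (d ^ n) (X n) g f \<longrightarrow>
             computes_in P f (call_cost (c n)) (init_store (op_rank (X n)) L (depth (X n)))
               (truncated_value (d ^ n) (X n) L g)
               (K * (1 + real (op_rank (X n)) * (real (s n) * real (max_irdim (X n))) ^ L
                  * real (evaluate_cost (c n) L)))))"
\<comment> \<open>Program and constant are chosen before the circuit family, so the implicit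
  constant of the run-time is uniform in d, n and L.\<close>
proof (intro exI[of _ path_program] exI[of _ 98] allI impI)
  fix d :: nat and X :: "nat \<Rightarrow> 'g circuit" and s :: "nat \<Rightarrow> nat" and c :: "nat \<Rightarrow> cost_params" and n L :: nat
  assume d: "d \<ge> 1" and A: "\<forall>n\<ge>1. is_circuit (d ^ n) (X n) \<and> observable (d ^ n) (obsv (X n)) \<and>
      symmetry_adapted (d ^ n) (X n) \<and> noise_penalisation (d ^ n) (X n) \<and>
      tree_growth (d ^ n) (X n) \<and> path_count (X n) (s n) \<and> positive_costs (c n)"
    and n: "n \<ge> 1" and L: "L \<ge> 1"
  interpret contractible_circuit "d ^ n" "X n"
    using A n d by unfold_locales auto
  show "(let err = (\<lambda>g. noisy_value (d ^ n) (X n) g - truncated_value (d ^ n) (X n) L g) in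
       square_integrable (product_haar (X n)) err \<and>
       l2_norm (product_haar (X n)) err
         \<le> exp (- spectral_gap (d ^ n) (noise (X n)) * real L) * hs_norm (obsv (X n))) \<and>
    (\<forall>g\<in>Pi\<^sub>E {1..depth (X n)} (\<lambda>_. carrier (grp (X n))). \<forall>f.
       implements (d ^ n) (X n) g f \<longrightarrow>
       computes_in path_program f (call_cost (c n)) (init_store (op_rank (X n)) L (depth (X n)))
         (truncated_value (d ^ n) (X n) L g)
         (98 * (1 + real (op_rank (X n)) * (real (s n) * real (max_irdim (X n))) ^ L
            * real (evaluate_cost (c n) L))))"
    unfolding Let_def
  proof (intro conjI ballI allI impI)
    fix g f assume "g \<in> Pi\<^sub>E {1..depth (X n)} (\<lambda>_. carrier (grp (X n)))" "implements (d ^ n) (X n) g f"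
    then show "computes_in path_program f (call_cost (c n)) (init_store (op_rank (X n)) L (depth (X n)))
         (truncated_value (d ^ n) (X n) L g)
         (98 * (1 + real (op_rank (X n)) * (real (s n) * real (max_irdim (X n))) ^ L
            * real (evaluate_cost (c n) L)))"
      using A n L by (intro computes_truncation) auto
  qed (rule truncation_error)+
qed

end
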